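(* In the hybrid human/AI control model described in the context, the optimal risk threshold $T^*(q,\theta)$ is monotonically non-decreasing in the queue length $q$: for every $\theta\in\Theta$ and all $q_1,q_2\in\mathbb{N}_0$, $$q_1<q_2\implies T^*(q_1,\theta)\le T^*(q_2,\theta).$$
   Context: Model. Tasks arrive according to a Poisson process of rate $\lambda>0$, with arrival times $\tau_1<\tau_2<\dots$. The $n$-th task has a risk score $s_n\in[0,1]$, observed on arrival; the scores are i.i.d. with a distribution function $F_S$ on $[0,1]$ having a continuous density $f_S$ that is strictly positive on $(0,1)$. An exogenous reliability process $\theta(t)$ is an irreducible, ergodic continuous-time Markov chain on $\Theta=\{1,\dots,K\}$ with generator $Q=[q_{ij}]$ (so $q_{ii}=-\sum_{j\ne i}q_{ij}$). Arrivals, scores, service times and $\theta(t)$ are independent. Actions. At the arrival of the $n$-th task the controller observes the queue length $q(\tau_n^-)\in\mathbb{N}_0$, the regime $\theta(\tau_n^-)$ and $s_n$, and chooses $a_n\in\{0,1\}$. If $a_n=0$ (automate), the cost $c_{\mathrm{auto}}(s_n,\theta(\tau_n^-))$ is incurred and the queue is unchanged. If $a_n=1$ (escalate), the fixed cost $c_h>0$ is incurred and the queue length increases by $1$. Escalated tasks are served in a queue with infinite buffer and $m\geq 1$ parallel servers with independent exponential service times of rate $\mu>0$ each, so the total service rate with $n$ tasks in system is $\min(n,m)\mu$; $q(t)$ is the number of tasks in system. Cost assumptions. $h:\mathbb{N}_0\to\mathbb{R}_+$ is non-decreasing and convex with $h(0)=0$. $c_{\mathrm{auto}}:[0,1]\times\Theta\to\mathbb{R}_+$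 satisfies: (i) for each fixed $\theta$, $c_{\mathrm{auto}}(\cdot,\theta)$ is strictly increasing, continuous and convex; (ii) for each fixed $s$, $c_{\mathrm{auto}}(s,\theta)$ is non-decreasing in $\theta$; (iii) for $s'>s$ and $\theta'>\theta$, $c_{\mathrm{auto}}(s',\theta')-c_{\mathrm{auto}}(s,\theta')\ge c_{\mathrm{auto}}(s',\theta)-c_{\mathrm{auto}}(s,\theta)$. Objective. A stationary Markovian policy is a (measurable) function $u:\mathbb{N}_0\times\Theta\times[0,1]\to\{0,1\}$, with $a_n=u(q(\tau_n^-),\theta(\tau_n^-),s_n)$. For a discount rate $\alpha>0$, $$J_u(q_0,\theta_0)=\mathbb{E}\Big[\int_0^\infty e^{-\alpha t}h(q(t))\,dt+\sum_{n\ge1}e^{-\alpha\tau_n}\big((1-a_n)c_{\mathrm{auto}}(s_n,\theta(\tau_n^-))+a_n c_h\big)\,\Big|\,q(0)=q_0,\theta(0)=\theta_0\Big],$$ and the optimal value function is $V(q,\theta)=\inf_u J_u(q,\theta)$, the infimum being over stationary Markovian policies. Threshold. With $\Delta_q V(q,\theta)=V(q+1,\theta)-V(q,\theta)$, the optimal risk threshold is $$T^*(q,\theta)=\inf\{s\in[0,1]:c_{\mathrm{auto}}(s,\theta)\ge c_h+\Delta_q V(q,\theta)\}\in[0,1]\cup\{\infty\},$$ with $T^*(q,\theta)=\infty$ if the set is empty. (The optimal policy escalates a task of score $s$ in state $(q,\theta)$ iff $s\ge T^*(q,\theta)$.) *)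

theory Defs
  imports "HOL-Probability.Probability"
begin

text \<open>
  First-come-first-served service by \<open>m\<close> parallel servers. A system content is the list of the
  remaining service times of the tasks in system, in order of arrival; the first \<open>m\<close> entries are
  in service. \<open>serve m d w\<close> is the content just before \<open>d\<close> time units have elapsed without
  arrivals: a task whose remaining service time is exactly used up at that moment is still counted.
\<close>

function serve :: "nat \<Rightarrow> real \<Rightarrow> real list \<Rightarrow> real list" where
  "serve m d w =
    (if m = 0 \<or> w = [] then w
     else let r = Min (set (take m w)) in
       if d \<le> r then map (\<lambda>x. x - d) (take m w) @ drop m w
       else serve m (d - r) (filter (\<lambda>x. x > 0) (map (\<lambda>x. x - r) (take m w)) @ drop m w))"
  by pat_completeness auto
termination
proof (relation "Wellfounded.measure (\<lambda>(m, d, w). length w)", goal_cases)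
  case 1
  show ?case by simp
next
  case (2 m d w r)
  then have "take m w \<noteq> []" by simp
  then have "r \<in> set (take m w)" unfolding 2(2) by (intro Min_in) auto
  then have "r - r \<in> set (map (\<lambda>x. x - r) (take m w))" by auto
  then have "length (filter (\<lambda>x. x > 0) (map (\<lambda>x. x - r) (take m w))) < length (take m w)"
    using length_filter_less[of "r - r" "map (\<lambda>x. x - r) (take m w)" "\<lambda>x. x > 0"] by simp
  then show ?case by (simp, linarith)
qed

declare serve.simps [simp del]

abbreviation exp_law :: "real \<Rightarrow> real measure" where
  "exp_law r \<equiv> density lborel (\<lambda>x. ennreal (exponential_density r x))"

text \<open>\<open>arr x n\<close> is the time of the \<open>n\<close>-th arrival, where \<open>x\<close> lists the interarrival times; \<open>arr x 0 = 0\<close>.\<close>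

definition arr :: "real stream \<Rightarrow> nat \<Rightarrow> real" where
  "arr x n = (\<Sum>k<n. x !! k)"

text \<open>
  Irreducibility is stated through the transition graph of the generator; a finite irreducible
  chain is automatically ergodic. A policy returns \<open>True\<close> for the action 1 (escalate).
  Streams are indexed from 0, so the \<open>n\<close>-th task has score \<open>s !! (n - 1)\<close>.
\<close>

locale hybrid_control =
  fixes lam mu alpha c_h :: real
    and m K :: nat
    and Q :: "nat \<Rightarrow> nat \<Rightarrow> real"
    and f_S :: "real \<Rightarrow> real"
    and h :: "nat \<Rightarrow> real"
    and c_auto :: "real \<Rightarrow> nat \<Rightarrow> real"
  assumes lam_pos: "lam > 0"
    and mu_pos: "mu > 0"
    and alpha_pos: "alpha > 0"
    and c_h_pos: "c_h > 0"
    and m_ge_1: "m \<ge> 1"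
    and K_ge_1: "K \<ge> 1"
    and Q_offdiag: "\<And>i j. i \<in> {1..K} \<Longrightarrow> j \<in> {1..K} \<Longrightarrow> i \<noteq> j \<Longrightarrow> Q i j \<ge> 0"
    and Q_diag: "\<And>i. i \<in> {1..K} \<Longrightarrow> Q i i = - (\<Sum>j\<in>{1..K} - {i}. Q i j)"
    and Q_irreducible: "\<And>i j. i \<in> {1..K} \<Longrightarrow> j \<in> {1..K} \<Longrightarrow>
          (i, j) \<in> {(k, l). k \<in> {1..K} \<and> l \<in> {1..K} \<and> k \<noteq> l \<and> Q k l > 0}\<^sup>*"
    and f_S_cont: "continuous_on {0..1} f_S"
    and f_S_pos: "\<And>s. s \<in> {0<..<1} \<Longrightarrow> f_S s > 0"
    and f_S_density: "(f_S has_integral 1) {0..1}"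
    and h_zero: "h 0 = 0"
    and h_nonneg: "\<And>n. h n \<ge> 0"
    and h_mono: "mono h"
    and h_convex: "\<And>n. h (n + 1) - h n \<le> h (n + 2) - h (n + 1)"
    and c_auto_nonneg: "\<And>s \<theta>. s \<in> {0..1} \<Longrightarrow> \<theta> \<in> {1..K} \<Longrightarrow> c_auto s \<theta> \<ge> 0"
    and c_auto_strict_mono: "\<And>\<theta>. \<theta> \<in> {1..K} \<Longrightarrow> strict_mono_on {0..1} (\<lambda>s. c_auto s \<theta>)"
    and c_auto_cont: "\<And>\<theta>. \<theta> \<in> {1..K} \<Longrightarrow> continuous_on {0..1} (\<lambda>s. c_auto s \<theta>)"
    and c_auto_convex: "\<And>\<theta>. \<theta> \<in> {1..K} \<Longrightarrow> convex_on {0..1} (\<lambda>s. c_auto s \<theta>)"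
    and c_auto_mono_regime: "\<And>s. s \<in> {0..1} \<Longrightarrow> mono_on {1..K} (c_auto s)"
    and c_auto_incr_diff: "\<And>s s' \<theta> \<theta>'. s \<in> {0..1} \<Longrightarrow> s' \<in> {0..1} \<Longrightarrow> \<theta> \<in> {1..K} \<Longrightarrow> \<theta>' \<in> {1..K} \<Longrightarrow>
          s < s' \<Longrightarrow> \<theta> < \<theta>' \<Longrightarrow> c_auto s' \<theta>' - c_auto s \<theta>' \<ge> c_auto s' \<theta> - c_auto s \<theta>"
begin

definition score_law :: "real measure" where
  "score_law = density (restrict_space lborel {0..1}) (\<lambda>s. ennreal (f_S s))"

text \<open>
  The regime process is given by its jump chain and holding times: the \<open>n\<close>-th visited state
  \<open>i\<close> is held for \<open>e !! n / (- Q i i)\<close> with \<open>e !! n\<close> standard exponential, and left for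
  \<open>(\<phi> !! n) i\<close>, where \<open>(\<phi> !! n) i\<close> has the law \<open>jump i\<close>. The extended reals make the holding time
  infinite when \<open>Q i i = 0\<close>, which happens only for \<open>K = 1\<close>.
\<close>

definition jump :: "nat \<Rightarrow> nat pmf" where
  "jump i = (if Q i i = 0 then return_pmf i
     else embed_pmf (\<lambda>j. if j \<in> {1..K} \<and> j \<noteq> i then Q i j / (- Q i i) else 0))"

primrec visited :: "nat \<Rightarrow> (nat \<Rightarrow> nat) stream \<Rightarrow> nat \<Rightarrow> nat" where
  "visited \<theta>0 \<phi> 0 = \<theta>0"
| "visited \<theta>0 \<phi> (Suc n) = (\<phi> !! n) (visited \<theta>0 \<phi> n)"

definition jump_time :: "nat \<Rightarrow> real stream \<Rightarrow> (nat \<Rightarrow> nat) stream \<Rightarrow> nat \<Rightarrow> ereal" where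
  "jump_time \<theta>0 e \<phi> n =
     (\<Sum>k<n. ereal (e !! k) / ereal (- Q (visited \<theta>0 \<phi> k) (visited \<theta>0 \<phi> k)))"

text \<open>The left limit \<open>\<theta>(t-)\<close>.\<close>

definition regime_left :: "nat \<Rightarrow> real stream \<Rightarrow> (nat \<Rightarrow> nat) stream \<Rightarrow> real \<Rightarrow> nat" where
  "regime_left \<theta>0 e \<phi> t = visited \<theta>0 \<phi> (LEAST n. ereal t \<le> jump_time \<theta>0 e \<phi> (Suc n))"

text \<open>
  The system content right after the \<open>n\<close>-th arrival, for the policy \<open>u\<close>, \<open>q0\<close> initial tasks, regime
  path \<open>rg\<close> (left limits), interarrival times \<open>x\<close>, scores \<open>s\<close> and service times \<open>v\<close>. The initial
  tasks take the first \<open>q0\<close> service times, the \<open>n\<close>-th arriving task has its own one \<open>v !! (q0 + n - 1)\<close>.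
\<close>

primrec content :: "(nat \<Rightarrow> nat \<Rightarrow> real \<Rightarrow> bool) \<Rightarrow> nat \<Rightarrow> (real \<Rightarrow> nat) \<Rightarrow>
    real stream \<Rightarrow> real stream \<Rightarrow> real stream \<Rightarrow> nat \<Rightarrow> real list" where
  "content u q0 rg x s v 0 = stake q0 v"
| "content u q0 rg x s v (Suc n) =
    (let w = serve m (x !! n) (content u q0 rg x s v n) in
       if u (length w) (rg (arr x (Suc n))) (s !! n) then w @ [v !! (q0 + n)] else w)"

text \<open>
  The left limit \<open>q(t-)\<close>. On every path it differs from \<open>q(t)\<close> only at jump times, hence has the
  same integral over time.
\<close>

definition queue_left :: "(nat \<Rightarrow> nat \<Rightarrow> real \<Rightarrow> bool) \<Rightarrow> nat \<Rightarrow> (real \<Rightarrow> nat) \<Rightarrow>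
    real stream \<Rightarrow> real stream \<Rightarrow> real stream \<Rightarrow> real \<Rightarrow> nat" where
  "queue_left u q0 rg x s v t =
    (let n = (LEAST n. t \<le> arr x (Suc n)) in length (serve m (t - arr x n) (content u q0 rg x s v n)))"

definition path_cost :: "(nat \<Rightarrow> nat \<Rightarrow> real \<Rightarrow> bool) \<Rightarrow> nat \<Rightarrow> (real \<Rightarrow> nat) \<Rightarrow>
    real stream \<Rightarrow> real stream \<Rightarrow> real stream \<Rightarrow> ennreal" where
  "path_cost u q0 rg x s v =
    (\<integral>\<^sup>+t\<in>{0..}. ennreal (exp (- alpha * t) * h (queue_left u q0 rg x s v t)) \<partial>lborel)
    + (\<Sum>n. let \<tau> = arr x (Suc n) in
         ennreal (exp (- alpha * \<tau>) *
           (if u (queue_left u q0 rg x s v \<tau>) (rg \<tau>) (s !! n) then c_h else c_auto (s !! n) (rg \<tau>))))"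

text \<open>
  The joint law of interarrival times, scores, service times, holding times and jumps: independent
  i.i.d. sequences. By memorylessness it also applies to the remaining service times of initial tasks.
\<close>

definition input_law ::
    "(real stream \<times> real stream \<times> real stream \<times> real stream \<times> (nat \<Rightarrow> nat) stream) measure" where
  "input_law = stream_space (exp_law lam) \<Otimes>\<^sub>M stream_space score_law \<Otimes>\<^sub>M stream_space (exp_law mu)
     \<Otimes>\<^sub>M stream_space (exp_law 1) \<Otimes>\<^sub>M stream_space (Pi\<^sub>M {1..K} (\<lambda>i. measure_pmf (jump i)))"

definition J :: "(nat \<Rightarrow> nat \<Rightarrow> real \<Rightarrow> bool) \<Rightarrow> nat \<Rightarrow> nat \<Rightarrow> ennreal" where
  "J u q0 \<theta>0 = (\<integral>\<^sup>+(x, s, v, e, \<phi>). path_cost u q0 (regime_left \<theta>0 e \<phi>) x s v \<partial>input_law)"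

definition policies :: "(nat \<Rightarrow> nat \<Rightarrow> real \<Rightarrow> bool) set" where
  "policies = {u. \<forall>q. \<forall>\<theta>\<in>{1..K}. u q \<theta> \<in> restrict_space borel {0..1} \<rightarrow>\<^sub>M count_space UNIV}"

text \<open>
  The infimum is finite, so \<open>enn2real\<close> loses nothing: never escalating from \<open>q\<close> costs at most
  \<open>h q / alpha + lam * c_auto 1 K / alpha\<close>.
\<close>

definition V :: "nat \<Rightarrow> nat \<Rightarrow> real" where
  "V q \<theta> = enn2real (INF u\<in>policies. J u q \<theta>)"

definition threshold :: "nat \<Rightarrow> nat \<Rightarrow> ereal" where
  "threshold q \<theta> = Inf (ereal ` {s \<in> {0..1}. c_auto s \<theta> \<ge> c_h + (V (q + 1) \<theta> - V q \<theta>)})"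

end

end

theory Submission
  imports Defs
begin

text \<open>
  It suffices that the value function is convex in the queue length. Observed at the arrival times, the
  system is a Markov decision process: by memorylessness of the exponential law, the remaining
  service times of the tasks still in system and the remaining holding time of the current regime are
  fresh exponential variables. The cost up to the \<open>n\<close>-th arrival therefore satisfies a recursion in \<open>n\<close>,
  value iteration from \<open>0\<close> increases to a solution of the Bellman equation, and this solution is the
  value function because it is a lower bound for every policy and is attained by the greedy one.
  Value iteration preserves monotonicity and convexity in \<open>q\<close>: between arrivals the mean of a
  function of the queue length solves the linear system \<open>p\<^sub>q' = min(q, m) \<mu> (p\<^sub>q\<^sub>-\<^sub>1 - p\<^sub>q)\<close>, whose first and
  second differences in \<open>q\<close> stay nonnegative since the rates are concave; the minimum over the two
  decisions and mixing over regimes and scores also preserve both properties.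
\<close>

subsection \<open>Measurability of service on lists\<close>

text \<open>The model is given pathwise, by service times attached to tasks and clocks attached to
  regimes, whereas the recursion lives on pairs of queue length and regime. The hidden variables can
  be integrated out because a policy sees the length of the content but never its entries: given the
  length, the entries met by an arrival are again independent exponential times, and given the
  regime in force, its clock is again standard exponential. Until this is used, the content has to
  be carried along as a list, which calls for a measurable structure on lists. All costs are
  nonnegative and stay in \<open>ennreal\<close>, so Fubini and monotone convergence apply without
  integrability, and the unbounded holding cost is handled by monotone iteration rather than by a
  contraction. The price is that subtraction is unusable there: convexity is stated with sums, and
  an explicit finite bound is what allows real differences to be formed.\<close>

definition nth0 :: "real list \<Rightarrow> nat \<Rightarrow> real" where
  "nth0 w i = (if i < length w then w ! i else 0)"

text \<open>The sigma-algebra is pulled back along the length and the zero-padded entries, so a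
  list-valued map is measurable as soon as these countably many coordinates are.\<close>

definition list_space :: "real list measure" where
  "list_space = vimage_algebra UNIV (\<lambda>w. (length w, nth0 w)) (count_space UNIV \<Otimes>\<^sub>M (\<Pi>\<^sub>M i\<in>UNIV. borel))"

lemma space_list_space [simp]: "space list_space = UNIV"
  by (simp add: list_space_def)

lemma measurable_list_spaceI:
  assumes [measurable]: "(\<lambda>x. length (f x)) \<in> M \<rightarrow>\<^sub>M count_space UNIV"
    and [measurable]: "\<And>i. (\<lambda>x. nth0 (f x) i) \<in> borel_measurable M"
  shows "f \<in> M \<rightarrow>\<^sub>M list_space"
  unfolding list_space_def
proof (rule measurable_vimage_algebra2)
  have "(\<lambda>x. \<lambda>i\<in>UNIV. nth0 (f x) i) \<in> M \<rightarrow>\<^sub>M (\<Pi>\<^sub>M i\<in>UNIV. borel)"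
    by measurable
  also have "(\<lambda>x. \<lambda>i\<in>UNIV. nth0 (f x) i) = (\<lambda>x. nth0 (f x))"
    by (simp add: restrict_def)
  finally have [measurable]: "(\<lambda>x. nth0 (f x)) \<in> M \<rightarrow>\<^sub>M (\<Pi>\<^sub>M i\<in>UNIV. borel)" .
  show "(\<lambda>x. (length (f x), nth0 (f x))) \<in> M \<rightarrow>\<^sub>M count_space UNIV \<Otimes>\<^sub>M (\<Pi>\<^sub>M i\<in>UNIV. borel)"
    by measurable
qed simp

lemma measurable_length_list_space [measurable]: "length \<in> list_space \<rightarrow>\<^sub>M count_space UNIV"
  and measurable_nth0 [measurable]: "(\<lambda>w. nth0 w i) \<in> borel_measurable list_space"
proof -
  have *: "(\<lambda>w. (length w, nth0 w)) \<in> list_space \<rightarrow>\<^sub>M count_space UNIV \<Otimes>\<^sub>M (\<Pi>\<^sub>M i\<in>UNIV. borel)"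
    unfolding list_space_def by (rule measurable_vimage_algebra1) (auto simp: space_pair_measure space_PiM)
  show "length \<in> list_space \<rightarrow>\<^sub>M count_space UNIV"
    using measurable_compose[OF * measurable_fst] by simp
  show "(\<lambda>w. nth0 w i) \<in> borel_measurable list_space"
    using measurable_compose[OF measurable_compose[OF * measurable_snd], of "\<lambda>f. f i" borel]
    by (simp add: measurable_component_singleton)
qed

lemma measurable_Nil [measurable]: "(\<lambda>x. []) \<in> M \<rightarrow>\<^sub>M list_space"
  by (rule measurable_list_spaceI) (simp_all add: nth0_def)

lemma nth0_Cons: "nth0 (a # w) i = (case i of 0 \<Rightarrow> a | Suc j \<Rightarrow> nth0 w j)"
  by (auto simp: nth0_def split: nat.split)

lemma nth0_append: "nth0 (v @ w) i = (if i < length v then nth0 v i else nth0 w (i - length v))"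
  by (auto simp: nth0_def nth_append)

lemma measurable_Cons_list_space [measurable (raw)]:
  assumes [measurable]: "f \<in> borel_measurable M" "g \<in> M \<rightarrow>\<^sub>M list_space"
  shows "(\<lambda>x. f x # g x) \<in> M \<rightarrow>\<^sub>M list_space"
proof (rule measurable_list_spaceI)
  show "(\<lambda>x. nth0 (f x # g x) i) \<in> borel_measurable M" for i
    by (cases i) (simp_all add: nth0_Cons)
qed simp

lemma measurable_append_list_space [measurable (raw)]:
  assumes [measurable]: "f \<in> M \<rightarrow>\<^sub>M list_space" "g \<in> M \<rightarrow>\<^sub>M list_space"
  shows "(\<lambda>x. f x @ g x) \<in> M \<rightarrow>\<^sub>M list_space"
proof (rule measurable_list_spaceI)
  have [measurable]: "(\<lambda>x. nth0 (g x) (i - length (f x))) \<in> borel_measurable M" for i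
    by (rule measurable_compose_countable[where g="\<lambda>x. length (f x)" and f="\<lambda>n x. nth0 (g x) (i - n)"])
      measurable
  show "(\<lambda>x. nth0 (f x @ g x) i) \<in> borel_measurable M" for i
    unfolding nth0_append by measurable
qed simp

lemma measurable_tl_list_space [measurable]: "tl \<in> list_space \<rightarrow>\<^sub>M list_space"
proof (rule measurable_list_spaceI)
  have "nth0 (tl w) i = nth0 w (Suc i)" for w i
    by (cases w) (auto simp: nth0_def)
  then show "(\<lambda>w. nth0 (tl w) i) \<in> borel_measurable list_space" for i
    by simp
qed simp

lemma measurable_take_list_space [measurable]: "take n \<in> list_space \<rightarrow>\<^sub>M list_space"
proof (rule measurable_list_spaceI)
  have "nth0 (take n w) i = (if i < n then nth0 w i else 0)" for w i
    by (auto simp: nth0_def)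
  then show "(\<lambda>w. nth0 (take n w) i) \<in> borel_measurable list_space" for i
    by simp
qed simp

lemma measurable_drop_list_space [measurable]: "drop n \<in> list_space \<rightarrow>\<^sub>M list_space"
proof (rule measurable_list_spaceI)
  have "nth0 (drop n w) i = nth0 w (n + i)" for w i
    by (auto simp: nth0_def)
  then show "(\<lambda>w. nth0 (drop n w) i) \<in> borel_measurable list_space" for i
    by simp
qed simp

lemma measurable_map_diff_list_space [measurable (raw)]:
  assumes [measurable]: "f \<in> borel_measurable M" "g \<in> M \<rightarrow>\<^sub>M list_space"
  shows "(\<lambda>x. map (\<lambda>y. y - f x) (g x)) \<in> M \<rightarrow>\<^sub>M list_space"
proof (rule measurable_list_spaceI)
  have "nth0 (map (\<lambda>y. y - f x) (g x)) i = (if i < length (g x) then nth0 (g x) i - f x else 0)" for x i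
    by (auto simp: nth0_def)
  then show "(\<lambda>x. nth0 (map (\<lambda>y. y - f x) (g x)) i) \<in> borel_measurable M" for i
    by simp
qed simp

text \<open>The position of an entry after filtering depends on the data, so coordinates do not help
  directly. The filter is built up over prefixes by head and tail, and the prefix length is then set
  to the length of the list, a countable choice.\<close>

lemma measurable_filter_pos_list_space [measurable]:
  "filter (\<lambda>x. x > 0) \<in> list_space \<rightarrow>\<^sub>M list_space"
proof -
  have *: "(\<lambda>w. filter (\<lambda>x. x > 0) (take n w)) \<in> list_space \<rightarrow>\<^sub>M list_space" for n
  proof (induction n)
    case (Suc n)
    note [measurable] = measurable_compose[OF measurable_tl_list_space Suc]
    have "filter (\<lambda>x. x > 0) (take (Suc n) w) =
        (if 0 < length w \<and> nth0 w 0 > 0 then nth0 w 0 # filter (\<lambda>x. x > 0) (take n (tl w))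
         else filter (\<lambda>x. x > 0) (take n (tl w)))" for w
      by (cases w) (auto simp: nth0_def)
    then show ?case
      by (simp only:) measurable
  qed simp
  have "(\<lambda>w. filter (\<lambda>x. x > 0) (take (length w) w)) \<in> list_space \<rightarrow>\<^sub>M list_space"
    by (rule measurable_compose_countable[where g=length and f="\<lambda>n w. filter (\<lambda>x. x > 0) (take n w)"])
      (use * in measurable)
  then show ?thesis by simp
qed

lemma measurable_Min_list_space [measurable]: "(\<lambda>w. Min (set w)) \<in> borel_measurable list_space"
proof -
  have *: "Min (set w) = Min (nth0 w ` {..<length w})" for w
    by (rule arg_cong[where f=Min]) (force simp: nth0_def set_conv_nth)
  have [measurable]: "(\<lambda>w. Min ((\<lambda>i. nth0 w i) ` {..<n})) \<in> borel_measurable list_space" for n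
    by (rule borel_measurable_Min) auto
  show ?thesis
    unfolding *
    by (rule measurable_compose_countable[where g=length and f="\<lambda>n w. Min (nth0 w ` {..<n})"]) measurable
qed

text \<open>The fuel bounds the number of departure epochs and turns the well-founded recursion of
  \<open>serve\<close> into one over the naturals, along which measurability can be proved. Fuel
  \<open>length w\<close> suffices, since every epoch removes a task.\<close>

primrec serve_fuel :: "nat \<Rightarrow> nat \<Rightarrow> real \<Rightarrow> real list \<Rightarrow> real list" where
  "serve_fuel 0 m d w = w"
| "serve_fuel (Suc n) m d w =
    (if m = 0 \<or> length w = 0 then w
     else let r = Min (set (take m w)) in
       if d \<le> r then map (\<lambda>x. x - d) (take m w) @ drop m w
       else serve_fuel n m (d - r) (filter (\<lambda>x. x > 0) (map (\<lambda>x. x - r) (take m w)) @ drop m w))"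

text \<open>The task that attains the minimum is left with remaining time exactly 0 and is filtered
  out.\<close>

lemma length_after_departure_less:
  fixes w :: "real list"
  assumes "m \<noteq> 0" "w \<noteq> []"
  shows "length (filter (\<lambda>x. x > 0) (map (\<lambda>x. x - Min (set (take m w))) (take m w)) @ drop m w) < length w"
proof -
  let ?r = "Min (set (take m w))"
  have "?r \<in> set (take m w)" using assms by (intro Min_in) auto
  then have "?r - ?r \<in> set (map (\<lambda>x. x - ?r) (take m w))" unfolding set_map by (rule imageI)
  then have "length (filter (\<lambda>x. x > 0) (map (\<lambda>x. x - ?r) (take m w))) < length (map (\<lambda>x. x - ?r) (take m w))"
    by (rule length_filter_less) simp
  then show ?thesis by (simp, linarith)
qed

lemma serve_eq_serve_fuel: "length w \<le> n \<Longrightarrow> serve m d w = serve_fuel n m d w"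
proof (induction n arbitrary: d w)
  case 0
  then show ?case by (simp add: serve.simps)
next
  case (Suc n)
  show ?case
  proof (cases "m = 0 \<or> w = []")
    case False
    then have "length (filter (\<lambda>x. x > 0) (map (\<lambda>x. x - Min (set (take m w))) (take m w)) @ drop m w) \<le> n"
      using length_after_departure_less[of m w] Suc.prems by linarith
    from Suc.IH[OF this] show ?thesis
      using False by (subst serve.simps) (auto simp: Let_def)
  qed (auto simp: serve.simps)
qed

lemma measurable_serve_fuel:
  "(\<lambda>(d, w). serve_fuel n m d w) \<in> borel \<Otimes>\<^sub>M list_space \<rightarrow>\<^sub>M list_space"
proof (induction n)
  case (Suc n)
  note [measurable] = measurable_compose[OF _ Suc, unfolded case_prod_beta fst_conv snd_conv]
  have [measurable]: "(\<lambda>x. serve_fuel n m (f x) (g x)) \<in> N \<rightarrow>\<^sub>M list_space"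
    if [measurable]: "f \<in> borel_measurable N" "g \<in> N \<rightarrow>\<^sub>M list_space"
    for f g and N :: "(real \<times> real list) measure"
    using measurable_compose[OF measurable_Pair[OF that] Suc] by simp
  show ?case
    unfolding serve_fuel.simps Let_def case_prod_beta by measurable
qed simp

lemma measurable_serve [measurable (raw)]:
  assumes [measurable]: "f \<in> borel_measurable M" "g \<in> M \<rightarrow>\<^sub>M list_space"
  shows "(\<lambda>x. serve m (f x) (g x)) \<in> M \<rightarrow>\<^sub>M list_space"
proof -
  have [measurable]: "(\<lambda>x. serve_fuel n m (f x) (g x)) \<in> M \<rightarrow>\<^sub>M list_space" for n
    using measurable_compose[OF measurable_Pair[OF assms] measurable_serve_fuel] by simp
  have "serve m (f x) (g x) = serve_fuel (length (g x)) m (f x) (g x)" for x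
    by (rule serve_eq_serve_fuel) simp
  then show ?thesis
    by (simp only:, intro measurable_compose_countable[where g="\<lambda>x. length (g x)"
          and f="\<lambda>n x. serve_fuel n m (f x) (g x)"]) measurable
qed

lemma length_serve_le: "length (serve m d w) \<le> length w"
proof (induction "length w" arbitrary: d w rule: less_induct)
  case less
  show ?case
  proof (cases "m = 0 \<or> w = []")
    case False
    then show ?thesis
      using less[OF length_after_departure_less[of m w], of "d - Min (set (take m w))"]
        length_after_departure_less[of m w]
      by (subst serve.simps) (auto simp: Let_def)
  qed (auto simp: serve.simps)
qed

lemma measurable_stake_list_space [measurable]:
  assumes "sets M = sets borel"
  shows "stake n \<in> stream_space M \<rightarrow>\<^sub>M list_space"
proof -
  have [measurable_cong]: "sets (stream_space M) = sets (stream_space borel)"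
    by (rule sets_stream_space_cong[OF assms])
  show ?thesis
  proof (rule measurable_list_spaceI)
    have "nth0 (stake n v) i = (if i < n then v !! i else 0)" for v i
      by (auto simp: nth0_def)
    then show "(\<lambda>v. nth0 (stake n v) i) \<in> borel_measurable (stream_space M)" for i
      by simp
  qed simp
qed

subsection \<open>Memorylessness of service\<close>

lemma prob_space_exp_law: "0 < r \<Longrightarrow> prob_space (exp_law r)"
  by (rule prob_space_exponential_density)

lemma nn_integral_exp_law:
  "F \<in> borel_measurable borel \<Longrightarrow>
    (\<integral>\<^sup>+x. F x \<partial>exp_law r) = (\<integral>\<^sup>+x. ennreal (exponential_density r x) * F x \<partial>lborel)"
  by (subst nn_integral_density) auto

lemma AE_exp_law_nonneg: "AE x in exp_law r. 0 \<le> x"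
  by (subst AE_density) (auto simp: exponential_density_def)

lemma AE_exp_law_neq: "AE x in exp_law r. x \<noteq> c"
proof -
  have "AE x in lborel. x \<noteq> c" by (rule AE_lborel_singleton)
  then show ?thesis by (subst AE_density) auto
qed

lemma AE_exp_law_pos: "AE x in exp_law r. 0 < x"
  using AE_exp_law_nonneg[of r] AE_exp_law_neq[of 0 r] by eventually_elim auto

text \<open>Shifting the variable by \<open>d\<close> splits the survival probability off the
  density. Survival of the clock is kept as a case distinction in the integrand instead of a
  conditional law, so that the rule can be iterated inside other integrals.\<close>

lemma nn_integral_exp_law_memoryless:
  fixes F :: "real \<Rightarrow> ennreal"
  assumes [measurable]: "F \<in> borel_measurable borel" and "0 < r" "0 \<le> d"
  shows "(\<integral>\<^sup>+x. (if d \<le> x then F (x - d) else 0) \<partial>exp_law r)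
       = ennreal (exp (- r * d)) * (\<integral>\<^sup>+x. F x \<partial>exp_law r)"
proof -
  have "(\<integral>\<^sup>+x. (if d \<le> x then F (x - d) else 0) \<partial>exp_law r)
      = (\<integral>\<^sup>+x. ennreal (exponential_density r x) * (if d \<le> x then F (x - d) else 0) \<partial>lborel)"
    by (rule nn_integral_exp_law) measurable
  also have "\<dots> = (\<integral>\<^sup>+x. ennreal (exponential_density r (d + x)) * (if 0 \<le> x then F x else 0) \<partial>lborel)"
    by (subst nn_integral_real_affine[where c=1 and t=d]) (auto intro!: nn_integral_cong)
  also have "\<dots> = (\<integral>\<^sup>+x. ennreal (exp (- r * d)) * (ennreal (exponential_density r x) * F x) \<partial>lborel)"
  proof (rule nn_integral_cong)
    fix x :: real
    have "r * exp (- (d + x) * r) = exp (- r * d) * (r * exp (- x * r))"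
      by (simp add: mult_exp_exp mult.left_commute[of "exp _" r] algebra_simps)
    then have "0 \<le> x \<Longrightarrow> exponential_density r (d + x) = exp (- r * d) * exponential_density r x"
      using assms unfolding exponential_density_def by simp
    then show "ennreal (exponential_density r (d + x)) * (if 0 \<le> x then F x else 0)
       = ennreal (exp (- r * d)) * (ennreal (exponential_density r x) * F x)"
      by (cases "0 \<le> x") (simp_all add: ennreal_mult' mult.assoc, simp add: exponential_density_def)
  qed
  also have "\<dots> = ennreal (exp (- r * d)) * (\<integral>\<^sup>+x. F x \<partial>exp_law r)"
    by (subst nn_integral_cmult) (auto simp: nn_integral_exp_law)
  finally show ?thesis .
qed

lemma nn_integral_exp_law_memoryless_strict:
  fixes F :: "real \<Rightarrow> ennreal"
  assumes "F \<in> borel_measurable borel" and "0 < r" "0 \<le> d"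
  shows "(\<integral>\<^sup>+x. (if d < x then F (x - d) else 0) \<partial>exp_law r)
       = ennreal (exp (- r * d)) * (\<integral>\<^sup>+x. F x \<partial>exp_law r)"
  unfolding nn_integral_exp_law_memoryless[OF assms, symmetric]
  by (rule nn_integral_cong_AE) (use AE_exp_law_neq[of d r] in eventually_elim, auto)

lemma pred_all_ge [measurable (raw)]:
  assumes [measurable]: "f \<in> borel_measurable M" "g \<in> M \<rightarrow>\<^sub>M list_space"
  shows "Measurable.pred M (\<lambda>x. \<forall>y\<in>set (g x). f x \<le> y)"
    and "Measurable.pred M (\<lambda>x. \<forall>y\<in>set (g x). f x < y)"
proof -
  have "(\<forall>y\<in>set w. P y) \<longleftrightarrow> (\<forall>i. i < length w \<longrightarrow> P (nth0 w i))" for P :: "real \<Rightarrow> bool" and w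
    by (simp add: nth0_def all_set_conv_all_nth)
  then show "Measurable.pred M (\<lambda>x. \<forall>y\<in>set (g x). f x \<le> y)" "Measurable.pred M (\<lambda>x. \<forall>y\<in>set (g x). f x < y)"
    by simp_all
qed

text \<open>These are the clocks still running right after the first of them has expired. Ties would
  be removed together, but they are null events under the exponential law.\<close>

definition residuals :: "real list \<Rightarrow> real list" where
  "residuals w = filter (\<lambda>x. x > 0) (map (\<lambda>x. x - Min (set w)) w)"

lemma measurable_residuals [measurable]: "residuals \<in> list_space \<rightarrow>\<^sub>M list_space"
  unfolding residuals_def by measurable

text \<open>Here \<open>w\<close> are the tasks in service and \<open>w'\<close> those waiting; the
  condition on the lengths says that nobody waits while a server is idle.\<close>

lemma serve_append:
  assumes "m \<noteq> 0" "w \<noteq> []" "length w = m \<or> length w < m \<and> w' = []"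
  shows "serve m d (w @ w') = (if \<forall>y\<in>set w. d \<le> y then map (\<lambda>y. y - d) w @ w'
     else serve m (d - Min (set w)) (residuals w @ w'))"
proof -
  have t: "take m (w @ w') = w" "drop m (w @ w') = w'" using assms by auto
  have all: "(\<forall>y\<in>set w. d \<le> y) \<longleftrightarrow> d \<le> Min (set w)" using assms by simp
  have "(m = 0 \<or> w @ w' = []) = False" using assms by auto
  then show ?thesis
    by (subst serve.simps) (simp only: t Let_def residuals_def all if_False)
qed

section \<open>Lists of independent exponential times\<close>

definition exp_list :: "real \<Rightarrow> nat \<Rightarrow> real list measure" where
  "exp_list r n = distr (stream_space (exp_law r)) list_space (stake n)"

lemma sets_exp_list [simp, measurable_cong]: "sets (exp_list r n) = sets list_space"
  by (simp add: exp_list_def)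

lemma space_exp_list [simp]: "space (exp_list r n) = UNIV"
  by (simp add: exp_list_def)

lemma measurable_stake_exp [measurable]: "stake n \<in> stream_space (exp_law r) \<rightarrow>\<^sub>M list_space"
  by (rule measurable_stake_list_space) simp

context
  fixes r :: real
  assumes r_pos: "0 < r"
begin

interpretation X: prob_space "exp_law r"
  using r_pos by (rule prob_space_exp_law)

interpretation XS: prob_space "stream_space (exp_law r)"
  by (rule X.prob_space_stream_space)

lemma prob_space_exp_list: "prob_space (exp_list r n)"
  unfolding exp_list_def by (rule XS.prob_space_distr) simp

lemma nn_integral_exp_list:
  "F \<in> borel_measurable list_space \<Longrightarrow>
    (\<integral>\<^sup>+w. F w \<partial>exp_list r n) = (\<integral>\<^sup>+v. F (stake n v) \<partial>stream_space (exp_law r))"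
  unfolding exp_list_def by (rule nn_integral_distr) simp_all

lemma nn_integral_exp_list_0:
  "F \<in> borel_measurable list_space \<Longrightarrow> (\<integral>\<^sup>+w. F w \<partial>exp_list r 0) = F []"
  by (simp add: nn_integral_exp_list XS.emeasure_space_1)

lemma nn_integral_exp_list_Suc:
  assumes [measurable]: "F \<in> borel_measurable list_space"
  shows "(\<integral>\<^sup>+w. F w \<partial>exp_list r (Suc n)) = (\<integral>\<^sup>+x. \<integral>\<^sup>+w. F (x # w) \<partial>exp_list r n \<partial>exp_law r)"
proof -
  interpret B: prob_space "exp_list r n" by (rule prob_space_exp_list)
  have "(\<integral>\<^sup>+w. F w \<partial>exp_list r (Suc n))
      = (\<integral>\<^sup>+x. \<integral>\<^sup>+v. F (x # stake n v) \<partial>stream_space (exp_law r) \<partial>exp_law r)"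
    by (simp add: nn_integral_exp_list, subst X.nn_integral_stream_space) simp_all
  also have "\<dots> = (\<integral>\<^sup>+x. \<integral>\<^sup>+w. F (x # w) \<partial>exp_list r n \<partial>exp_law r)"
    by (simp add: nn_integral_exp_list)
  finally show ?thesis .
qed

text \<open>This separates the service times of the initial tasks from those of later arrivals,
  which are independent of them and identically distributed.\<close>

lemma nn_integral_stake_sdrop:
  assumes "(\<lambda>(w, v). F w v) \<in> borel_measurable (list_space \<Otimes>\<^sub>M stream_space (exp_law r))"
  shows "(\<integral>\<^sup>+v. F (stake n v) (sdrop n v) \<partial>stream_space (exp_law r))
       = (\<integral>\<^sup>+w. \<integral>\<^sup>+v. F w v \<partial>stream_space (exp_law r) \<partial>exp_list r n)"
  using assms
proof (induction n arbitrary: F)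
  case 0
  note 0 [measurable]
  show ?case by (simp add: nn_integral_exp_list_0)
next
  case (Suc n)
  note Suc.prems [measurable]
  have "(\<integral>\<^sup>+v. F (stake (Suc n) v) (sdrop (Suc n) v) \<partial>stream_space (exp_law r))
      = (\<integral>\<^sup>+x. \<integral>\<^sup>+v. F (x # stake n v) (sdrop n v) \<partial>stream_space (exp_law r) \<partial>exp_law r)"
    by (subst X.nn_integral_stream_space) simp_all
  also have "\<dots> = (\<integral>\<^sup>+x. \<integral>\<^sup>+w. \<integral>\<^sup>+v. F (x # w) v \<partial>stream_space (exp_law r) \<partial>exp_list r n \<partial>exp_law r)"
    by (intro nn_integral_cong Suc.IH) measurable
  also have "\<dots> = (\<integral>\<^sup>+w. \<integral>\<^sup>+v. F w v \<partial>stream_space (exp_law r) \<partial>exp_list r (Suc n))"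
    by (subst nn_integral_exp_list_Suc) simp_all
  finally show ?case .
qed

lemma nn_integral_exp_list_append:
  assumes "F \<in> borel_measurable list_space"
  shows "(\<integral>\<^sup>+w. F w \<partial>exp_list r (a + b)) = (\<integral>\<^sup>+w. \<integral>\<^sup>+w'. F (w @ w') \<partial>exp_list r b \<partial>exp_list r a)"
  using assms
proof (induction a arbitrary: F)
  case 0
  note 0 [measurable]
  interpret B: prob_space "exp_list r b" by (rule prob_space_exp_list)
  show ?case by (simp add: nn_integral_exp_list_0)
next
  case (Suc a)
  note Suc.prems [measurable]
  interpret B: prob_space "exp_list r b" by (rule prob_space_exp_list)
  have "(\<integral>\<^sup>+w. F w \<partial>exp_list r (Suc a + b)) = (\<integral>\<^sup>+x. \<integral>\<^sup>+w. F (x # w) \<partial>exp_list r (a + b) \<partial>exp_law r)"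
    by (simp add: nn_integral_exp_list_Suc)
  also have "\<dots> = (\<integral>\<^sup>+x. \<integral>\<^sup>+w. \<integral>\<^sup>+w'. F (x # (w @ w')) \<partial>exp_list r b \<partial>exp_list r a \<partial>exp_law r)"
    by (intro nn_integral_cong Suc.IH) measurable
  also have "\<dots> = (\<integral>\<^sup>+w. \<integral>\<^sup>+w'. F (w @ w') \<partial>exp_list r b \<partial>exp_list r (Suc a))"
    by (subst nn_integral_exp_list_Suc) simp_all
  finally show ?case .
qed

lemma AE_exp_list_length: "AE w in exp_list r n. length w = n"
proof -
  have "Measurable.pred list_space (\<lambda>w. length w = n)" by measurable
  then show ?thesis
    unfolding exp_list_def by (subst AE_distr_iff) (simp_all add: pred_def)
qed

text \<open>Memorylessness of \<open>n\<close> simultaneous clocks, by peeling off one clock at a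
  time. The weak inequality matches the test made by \<open>serve\<close>, the strict one the
  comparison of a clock with the minimum of the others; a single induction over an abstract order
  \<open>le\<close> treats both.\<close>

lemma nn_integral_exp_list_shift:
  assumes "F \<in> borel_measurable list_space" and d: "0 \<le> d"
  shows "(\<integral>\<^sup>+w. (if \<forall>y\<in>set w. d \<le> y then F (map (\<lambda>y. y - d) w) else 0) \<partial>exp_list r n)
       = ennreal (exp (- (n * r) * d)) * (\<integral>\<^sup>+w. F w \<partial>exp_list r n)"
    and "(\<integral>\<^sup>+w. (if \<forall>y\<in>set w. d < y then F (map (\<lambda>y. y - d) w) else 0) \<partial>exp_list r n)
       = ennreal (exp (- (n * r) * d)) * (\<integral>\<^sup>+w. F w \<partial>exp_list r n)"
proof -
  have *: "(\<integral>\<^sup>+w. (if \<forall>y\<in>set w. le d y then F (map (\<lambda>y. y - d) w) else 0) \<partial>exp_list r n)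
       = ennreal (exp (- (n * r) * d)) * (\<integral>\<^sup>+w. F w \<partial>exp_list r n)"
    if "F \<in> borel_measurable list_space" and le: "le = (\<le>) \<or> le = (<)" for le F n
    using that(1)
  proof (induction n arbitrary: F)
    case 0
    have [measurable]: "Measurable.pred list_space (\<lambda>w. \<forall>y\<in>set w. le d y)"
      using le by auto
    note 0 [measurable]
    show ?case by (simp add: nn_integral_exp_list_0)
  next
    case (Suc n)
    interpret B: prob_space "exp_list r n" by (rule prob_space_exp_list)
    have [measurable]: "Measurable.pred M (\<lambda>x. \<forall>y\<in>set (g x). le d y)"
      if [measurable]: "g \<in> M \<rightarrow>\<^sub>M list_space" for g and M :: "'b measure"
      using le by auto
    have [measurable]: "Measurable.pred borel (le d)"
      using le by auto
    note Suc.prems [measurable]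
    have "(\<integral>\<^sup>+w. (if \<forall>y\<in>set w. le d y then F (map (\<lambda>y. y - d) w) else 0) \<partial>exp_list r (Suc n))
        = (\<integral>\<^sup>+x. \<integral>\<^sup>+w. (if le d x then if \<forall>y\<in>set w. le d y then F ((x - d) # map (\<lambda>y. y - d) w) else 0 else 0)
            \<partial>exp_list r n \<partial>exp_law r)"
      by (subst nn_integral_exp_list_Suc) (auto intro!: nn_integral_cong)
    also have "\<dots> = (\<integral>\<^sup>+x. (if le d x then ennreal (exp (- (n * r) * d)) * (\<integral>\<^sup>+w. F ((x - d) # w) \<partial>exp_list r n) else 0)
           \<partial>exp_law r)"
    proof (intro nn_integral_cong)
      fix x
      show "(\<integral>\<^sup>+w. (if le d x then if \<forall>y\<in>set w. le d y then F ((x - d) # map (\<lambda>y. y - d) w) else 0 else 0) \<partial>exp_list r n)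
        = (if le d x then ennreal (exp (- (n * r) * d)) * (\<integral>\<^sup>+w. F ((x - d) # w) \<partial>exp_list r n) else 0)"
        using Suc.IH[of "\<lambda>w. F ((x - d) # w)"] by simp
    qed
    also have "\<dots> = ennreal (exp (- r * d)) *
        (\<integral>\<^sup>+x. ennreal (exp (- (n * r) * d)) * (\<integral>\<^sup>+w. F (x # w) \<partial>exp_list r n) \<partial>exp_law r)"
      using le r_pos d
        nn_integral_exp_law_memoryless[of "\<lambda>x. ennreal (exp (- (n * r) * d)) * (\<integral>\<^sup>+w. F (x # w) \<partial>exp_list r n)"]
        nn_integral_exp_law_memoryless_strict[of "\<lambda>x. ennreal (exp (- (n * r) * d)) * (\<integral>\<^sup>+w. F (x # w) \<partial>exp_list r n)"]
      by auto
    also have "\<dots> = ennreal (exp (- (Suc n * r) * d)) * (\<integral>\<^sup>+w. F w \<partial>exp_list r (Suc n))"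
    proof -
      have "exp (- r * d) * exp (- (n * r) * d) = exp (- (Suc n * r) * d)"
        by (simp add: mult_exp_exp algebra_simps)
      then have "ennreal (exp (- r * d)) * ennreal (exp (- (n * r) * d)) = ennreal (exp (- (Suc n * r) * d))"
        by (simp only: ennreal_mult'[symmetric] exp_ge_zero)
      then show ?thesis
        by (subst nn_integral_cmult, measurable)
          (simp only: nn_integral_exp_list_Suc[OF Suc.prems] mult.assoc[symmetric])
    qed
    finally show ?case .
  qed
  show "(\<integral>\<^sup>+w. (if \<forall>y\<in>set w. d \<le> y then F (map (\<lambda>y. y - d) w) else 0) \<partial>exp_list r n)
       = ennreal (exp (- (n * r) * d)) * (\<integral>\<^sup>+w. F w \<partial>exp_list r n)"
   "(\<integral>\<^sup>+w. (if \<forall>y\<in>set w. d < y then F (map (\<lambda>y. y - d) w) else 0) \<partial>exp_list r n)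
       = ennreal (exp (- (n * r) * d)) * (\<integral>\<^sup>+w. F w \<partial>exp_list r n)"
    using *[OF assms(1)] by blast+
qed

lemma AE_exp_list_nonneg: "AE w in exp_list r n. \<forall>y\<in>set w. 0 \<le> y"
proof -
  have "AE v in stream_space (exp_law r). stream_all (\<lambda>x. 0 \<le> x) v"
    by (rule X.AE_stream_all) (use AE_exp_law_nonneg in auto)
  then have "AE v in stream_space (exp_law r). \<forall>y\<in>set (stake n v). 0 \<le> y"
    by eventually_elim (auto simp: stream_all_def in_set_conv_nth)
  then show ?thesis
    unfolding exp_list_def using pred_all_ge(1)[of "\<lambda>_. 0" list_space "\<lambda>w. w"]
    by (subst AE_distr_iff) (simp_all add: pred_def)
qed

text \<open>Competing exponentials: the first of \<open>Suc k\<close> clocks rings at rate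
  \<open>Suc k * r\<close>, independently of the \<open>k\<close> residuals, which are fresh again.
  In the induction a new clock either rings first, and then all others are fresh by
  \<open>nn_integral_exp_list_shift\<close>, or it outlives the minimum of the others and its own
  remainder is fresh. The densities of the two cases add up to the one of the increased
  rate.\<close>

lemma nn_integral_exp_list_Min_residuals:
  assumes "(\<lambda>(t, w). F t w) \<in> borel_measurable (borel \<Otimes>\<^sub>M list_space)"
  shows "(\<integral>\<^sup>+w. F (Min (set w)) (residuals w) \<partial>exp_list r (Suc k))
       = (\<integral>\<^sup>+t. \<integral>\<^sup>+w. F t w \<partial>exp_list r k \<partial>exp_law (real (Suc k) * r))"
  using assms
proof (induction k arbitrary: F)
  case 0
  note 0 [measurable]
  interpret B: prob_space "exp_list r 0" by (rule prob_space_exp_list)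
  have "residuals [x] = []" "Min (set [x]) = x" for x by (simp_all add: residuals_def)
  then have "(\<integral>\<^sup>+w. F (Min (set w)) (residuals w) \<partial>exp_list r (Suc 0)) = (\<integral>\<^sup>+x. F x [] \<partial>exp_law r)"
    by (subst nn_integral_exp_list_Suc, measurable) (simp add: nn_integral_exp_list_0 del: set_simps)
  then show ?case by (simp add: nn_integral_exp_list_0)
next
  case (Suc k)
  note Suc.prems [measurable]
  interpret B: prob_space "exp_list r (Suc k)" by (rule prob_space_exp_list)
  interpret XB: pair_sigma_finite "exp_law r" "exp_list r (Suc k)" ..
  interpret B0: prob_space "exp_list r k" by (rule prob_space_exp_list)
  interpret XB0: pair_sigma_finite "exp_law r" "exp_list r k" ..
  define g where "g t = (\<integral>\<^sup>+w. F t w \<partial>exp_list r (Suc k))" for t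
  have [measurable]: "g \<in> borel_measurable borel" unfolding g_def by measurable
  \<comment> \<open>\<open>?A\<close> is the contribution when the new clock \<open>x\<close> rings
    first, \<open>?B\<close> the one when a clock of \<open>w\<close> does.\<close>
  let ?A = "\<lambda>x w. if \<forall>y\<in>set w. x < y then F x (map (\<lambda>y. y - x) w) else 0"
  let ?B = "\<lambda>x w. if Min (set w) < x then F (Min (set w)) ((x - Min (set w)) # residuals w) else 0"
  have residuals_Cons: "F (Min (set (x # w))) (residuals (x # w)) = ?A x w + ?B x w"
    if "w \<noteq> []" "x \<noteq> Min (set w)" for x w
  proof -
    have all: "(\<forall>y\<in>set w. x < y) \<longleftrightarrow> x < Min (set w)"
      using that by simp
    have Min: "Min (set (x # w)) = min x (Min (set w))"
      using that by (simp add: Min_insert)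
    show ?thesis
    proof (cases "x < Min (set w)")
      case True
      then have "residuals (x # w) = map (\<lambda>y. y - x) w"
        unfolding residuals_def Min using that by (auto intro!: filter_True)
      then show ?thesis
        unfolding all Min using True that by (simp del: Min_gr_iff Min_less_iff)
    next
      case False
      then have *: "Min (set w) < x" using that by linarith
      then have "residuals (x # w) = (x - Min (set w)) # residuals w"
        unfolding residuals_def Min by (simp add: min_def)
      then show ?thesis
        unfolding all Min using * by (simp add: min_def del: Min_gr_iff Min_less_iff)
    qed
  qed
  have "(\<integral>\<^sup>+w. F (Min (set w)) (residuals w) \<partial>exp_list r (Suc (Suc k)))
      = (\<integral>\<^sup>+x. \<integral>\<^sup>+w. F (Min (set (x # w))) (residuals (x # w)) \<partial>exp_list r (Suc k) \<partial>exp_law r)"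
    by (rule nn_integral_exp_list_Suc) measurable
  also have "\<dots> = (\<integral>\<^sup>+w. \<integral>\<^sup>+x. F (Min (set (x # w))) (residuals (x # w)) \<partial>exp_law r \<partial>exp_list r (Suc k))"
    by (rule XB.Fubini'[symmetric]) measurable
  also have "\<dots> = (\<integral>\<^sup>+w. \<integral>\<^sup>+x. ?A x w + ?B x w \<partial>exp_law r \<partial>exp_list r (Suc k))"
  proof (rule nn_integral_cong_AE, use AE_exp_list_length[of "Suc k"] in eventually_elim)
    fix w :: "real list" assume "length w = Suc k"
    then have "w \<noteq> []" by auto
    then show "(\<integral>\<^sup>+x. F (Min (set (x # w))) (residuals (x # w)) \<partial>exp_law r) = (\<integral>\<^sup>+x. ?A x w + ?B x w \<partial>exp_law r)"
      by (intro nn_integral_cong_AE eventually_mono[OF AE_exp_law_neq[of "Min (set w)"]] residuals_Cons)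
  qed
  also have "\<dots> = (\<integral>\<^sup>+w. (\<integral>\<^sup>+x. ?A x w \<partial>exp_law r) + (\<integral>\<^sup>+x. ?B x w \<partial>exp_law r) \<partial>exp_list r (Suc k))"
    by (intro nn_integral_cong nn_integral_add) measurable
  also have "\<dots> = (\<integral>\<^sup>+w. \<integral>\<^sup>+x. ?A x w \<partial>exp_law r \<partial>exp_list r (Suc k))
      + (\<integral>\<^sup>+w. \<integral>\<^sup>+x. ?B x w \<partial>exp_law r \<partial>exp_list r (Suc k))"
    by (rule nn_integral_add) measurable
  \<comment> \<open>The two contributions want opposite orders of integration: \<open>?A\<close>
    uses memorylessness of the list for fixed \<open>x\<close>, \<open>?B\<close> that of
    \<open>x\<close> for a fixed list.\<close>
  also have "(\<integral>\<^sup>+w. \<integral>\<^sup>+x. ?A x w \<partial>exp_law r \<partial>exp_list r (Suc k))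
      = (\<integral>\<^sup>+x. \<integral>\<^sup>+w. ?A x w \<partial>exp_list r (Suc k) \<partial>exp_law r)"
    by (rule XB.Fubini') measurable
  also have "\<dots> = (\<integral>\<^sup>+x. ennreal (exp (- (Suc k * r) * x)) * g x \<partial>exp_law r)"
    unfolding g_def
    by (intro nn_integral_cong_AE eventually_mono[OF AE_exp_law_nonneg] nn_integral_exp_list_shift(2)) measurable
  also have "(\<integral>\<^sup>+w. \<integral>\<^sup>+x. ?B x w \<partial>exp_law r \<partial>exp_list r (Suc k))
      = (\<integral>\<^sup>+w. ennreal (exp (- r * Min (set w))) * (\<integral>\<^sup>+x. F (Min (set w)) (x # residuals w) \<partial>exp_law r) \<partial>exp_list r (Suc k))"
  proof (rule nn_integral_cong_AE, use AE_exp_list_length[of "Suc k"] AE_exp_list_nonneg[of "Suc k"] in eventually_elim)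
    fix w :: "real list" assume "length w = Suc k" "\<forall>y\<in>set w. 0 \<le> y"
    then have "0 \<le> Min (set w)" by (subst Min_ge_iff) auto
    then show "(\<integral>\<^sup>+x. ?B x w \<partial>exp_law r) =
        ennreal (exp (- r * Min (set w))) * (\<integral>\<^sup>+x. F (Min (set w)) (x # residuals w) \<partial>exp_law r)"
      using r_pos by (intro nn_integral_exp_law_memoryless_strict) measurable
  qed
  also have "\<dots> = (\<integral>\<^sup>+t. \<integral>\<^sup>+w. ennreal (exp (- r * t)) * (\<integral>\<^sup>+x. F t (x # w) \<partial>exp_law r)
      \<partial>exp_list r k \<partial>exp_law (real (Suc k) * r))"
    by (rule Suc.IH) measurable
  also have "\<dots> = (\<integral>\<^sup>+t. ennreal (exp (- r * t)) * g t \<partial>exp_law (real (Suc k) * r))"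
  proof (rule nn_integral_cong)
    fix t
    have "g t = (\<integral>\<^sup>+w. \<integral>\<^sup>+x. F t (x # w) \<partial>exp_law r \<partial>exp_list r k)"
      unfolding g_def by (subst nn_integral_exp_list_Suc, measurable, rule XB0.Fubini'[symmetric]) measurable
    then show "(\<integral>\<^sup>+w. ennreal (exp (- r * t)) * (\<integral>\<^sup>+x. F t (x # w) \<partial>exp_law r) \<partial>exp_list r k) = ennreal (exp (- r * t)) * g t"
      by (simp add: nn_integral_cmult)
  qed
  also have "(\<integral>\<^sup>+x. ennreal (exp (- (Suc k * r) * x)) * g x \<partial>exp_law r)
      + (\<integral>\<^sup>+t. ennreal (exp (- r * t)) * g t \<partial>exp_law (real (Suc k) * r))
      = (\<integral>\<^sup>+t. ennreal (exponential_density r t) * (ennreal (exp (- (Suc k * r) * t)) * g t)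
          + ennreal (exponential_density (real (Suc k) * r) t) * (ennreal (exp (- r * t)) * g t) \<partial>lborel)"
    by (subst nn_integral_add) (simp_all add: nn_integral_exp_law)
  also have "\<dots> = (\<integral>\<^sup>+t. ennreal (exponential_density (real (Suc (Suc k)) * r) t) * g t \<partial>lborel)"
  proof (rule nn_integral_cong)
    fix t :: real
    have "r * exp (- (t * r)) * exp (- (Suc k * r) * t) + Suc k * r * exp (- (t * (Suc k * r))) * exp (- r * t)
        = Suc (Suc k) * r * exp (- (t * (Suc (Suc k) * r)))"
      by (simp add: mult.assoc mult_exp_exp) (simp add: algebra_simps)
    then have "exponential_density r t * exp (- (Suc k * r) * t) + exponential_density (real (Suc k) * r) t * exp (- r * t)
        = exponential_density (real (Suc (Suc k)) * r) t"
      by (simp add: exponential_density_def del: of_nat_Suc)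
    moreover have "0 \<le> exponential_density r t" "0 \<le> exponential_density (real (Suc k) * r) t"
      using r_pos by (simp_all add: exponential_density_def)
    ultimately have "ennreal (exponential_density r t) * ennreal (exp (- (Suc k * r) * t))
        + ennreal (exponential_density (real (Suc k) * r) t) * ennreal (exp (- r * t))
        = ennreal (exponential_density (real (Suc (Suc k)) * r) t)"
      by (simp add: ennreal_mult[symmetric] ennreal_plus[symmetric] del: ennreal_plus of_nat_Suc)
    then show "ennreal (exponential_density r t) * (ennreal (exp (- (Suc k * r) * t)) * g t)
          + ennreal (exponential_density (real (Suc k) * r) t) * (ennreal (exp (- r * t)) * g t)
        = ennreal (exponential_density (real (Suc (Suc k)) * r) t) * g t"
      by (simp add: mult.assoc[symmetric] distrib_right[symmetric] del: of_nat_Suc)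
  qed
  also have "\<dots> = (\<integral>\<^sup>+t. g t \<partial>exp_law (real (Suc (Suc k)) * r))"
    by (rule nn_integral_exp_law[symmetric]) measurable
  finally show ?case unfolding g_def .
qed

text \<open>Renewal equation at the first departure, which occurs at rate \<open>k * r\<close> when
  \<open>k\<close> servers are busy. If it comes after \<open>d\<close>, all tasks are present and
  fresh again; if it comes at \<open>t < d\<close>, service restarts with \<open>n\<close> fresh
  tasks. The Markov property of the content and the differential equations for its length both rest
  on this equation.\<close>

lemma nn_integral_serve_first_departure:
  fixes n m :: nat
  assumes [measurable]: "F \<in> borel_measurable list_space" and m: "m \<ge> 1" and d: "0 \<le> d"
  defines "k \<equiv> min (Suc n) m"
  shows "(\<integral>\<^sup>+w. F (serve m d w) \<partial>exp_list r (Suc n))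
     = ennreal (exp (- (k * r) * d)) * (\<integral>\<^sup>+w. F w \<partial>exp_list r (Suc n))
     + (\<integral>\<^sup>+t. (if t < d then \<integral>\<^sup>+w. F (serve m (d - t) w) \<partial>exp_list r n else 0) \<partial>exp_law (real k * r))"
proof -
  obtain j where j: "k = Suc j" using m unfolding k_def by (cases m) auto
  \<comment> \<open>\<open>l\<close> tasks wait. After the first departure the content consists of
    the \<open>j\<close> residuals followed by these \<open>l\<close> tasks, \<open>n\<close> in
    all.\<close>
  define l where "l = Suc n - k"
  have Sn: "Suc n = k + l" and n: "n = j + l" using j unfolding l_def k_def by auto
  interpret K: prob_space "exp_list r k" by (rule prob_space_exp_list)
  interpret L: prob_space "exp_list r l" by (rule prob_space_exp_list)
  have split: "serve m d (w @ w') = (if \<forall>y\<in>set w. d \<le> y then map (\<lambda>y. y - d) w @ w'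
     else serve m (d - Min (set w)) (residuals w @ w'))" if "length w = k" "length w' = l" for w w'
    using that m j unfolding k_def l_def by (intro serve_append) (auto simp: min_def split: if_splits)
  let ?A = "\<lambda>w. if \<forall>y\<in>set w. d \<le> y then \<integral>\<^sup>+w'. F (map (\<lambda>y. y - d) w @ w') \<partial>exp_list r l else 0"
  define G where "G t w = (if t < d then \<integral>\<^sup>+w'. F (serve m (d - t) (w @ w')) \<partial>exp_list r l else 0)" for t w
  have [measurable]: "(\<lambda>(t, w). G t w) \<in> borel_measurable (borel \<Otimes>\<^sub>M list_space)"
    unfolding G_def by measurable
  have "(\<integral>\<^sup>+w. F (serve m d w) \<partial>exp_list r (Suc n)) = (\<integral>\<^sup>+w. \<integral>\<^sup>+w'. F (serve m d (w @ w')) \<partial>exp_list r l \<partial>exp_list r k)"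
    unfolding Sn by (rule nn_integral_exp_list_append) measurable
  also have "\<dots> = (\<integral>\<^sup>+w. ?A w + G (Min (set w)) (residuals w) \<partial>exp_list r k)"
  proof (rule nn_integral_cong_AE, use AE_exp_list_length[of k] in eventually_elim)
    fix w :: "real list" assume w: "length w = k"
    then have ne: "w \<noteq> []" using j by auto
    have Min: "(\<forall>y\<in>set w. d \<le> y) \<longleftrightarrow> d \<le> Min (set w)" using ne by simp
    have "(\<integral>\<^sup>+w'. F (serve m d (w @ w')) \<partial>exp_list r l) = (\<integral>\<^sup>+w'. F (if \<forall>y\<in>set w. d \<le> y then map (\<lambda>y. y - d) w @ w'
          else serve m (d - Min (set w)) (residuals w @ w')) \<partial>exp_list r l)"
      by (intro nn_integral_cong_AE eventually_mono[OF AE_exp_list_length]) (simp only: split[OF w])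
    also have "\<dots> = ?A w + G (Min (set w)) (residuals w)"
      unfolding Min G_def by (auto simp: not_le)
    finally show "(\<integral>\<^sup>+w'. F (serve m d (w @ w')) \<partial>exp_list r l) = ?A w + G (Min (set w)) (residuals w)" .
  qed
  also have "\<dots> = (\<integral>\<^sup>+w. ?A w \<partial>exp_list r k) + (\<integral>\<^sup>+w. G (Min (set w)) (residuals w) \<partial>exp_list r k)"
    by (rule nn_integral_add) measurable
  also have "(\<integral>\<^sup>+w. ?A w \<partial>exp_list r k) = ennreal (exp (- (k * r) * d)) * (\<integral>\<^sup>+w. \<integral>\<^sup>+w'. F (w @ w') \<partial>exp_list r l \<partial>exp_list r k)"
    using d by (intro nn_integral_exp_list_shift(1)) measurable
  also have "(\<integral>\<^sup>+w. \<integral>\<^sup>+w'. F (w @ w') \<partial>exp_list r l \<partial>exp_list r k) = (\<integral>\<^sup>+w. F w \<partial>exp_list r (Suc n))"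
    unfolding Sn by (rule nn_integral_exp_list_append[symmetric]) measurable
  also have "(\<integral>\<^sup>+w. G (Min (set w)) (residuals w) \<partial>exp_list r k) = (\<integral>\<^sup>+t. \<integral>\<^sup>+w. G t w \<partial>exp_list r j \<partial>exp_law (real k * r))"
    unfolding j by (rule nn_integral_exp_list_Min_residuals) measurable
  also have "\<dots> = (\<integral>\<^sup>+t. (if t < d then \<integral>\<^sup>+w. F (serve m (d - t) w) \<partial>exp_list r n else 0) \<partial>exp_law (real k * r))"
  proof (rule nn_integral_cong)
    fix t
    show "(\<integral>\<^sup>+w. G t w \<partial>exp_list r j) = (if t < d then \<integral>\<^sup>+w. F (serve m (d - t) w) \<partial>exp_list r n else 0)"
      using nn_integral_exp_list_append[of "\<lambda>w. F (serve m (d - t) w)" j l] unfolding G_def n by simp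
  qed
  finally show ?thesis .
qed

text \<open>Given its length, the content at time \<open>d\<close> is a list of fresh exponential
  times. With \<open>F'\<close> the average of \<open>F\<close> over fresh lists of the same length,
  \<open>F\<close> and \<open>F'\<close> have equal means on fresh lists; the renewal equation
  expresses both sides through such means and through shorter lists, so induction on the number of
  tasks closes.\<close>

lemma nn_integral_serve_markov:
  assumes [measurable]: "F \<in> borel_measurable list_space" and m: "m \<ge> 1" and d: "0 \<le> d"
  shows "(\<integral>\<^sup>+w. F (serve m d w) \<partial>exp_list r n)
       = (\<integral>\<^sup>+w. \<integral>\<^sup>+w'. F w' \<partial>exp_list r (length (serve m d w)) \<partial>exp_list r n)"
proof -
  define F' where "F' w = (\<integral>\<^sup>+w'. F w' \<partial>exp_list r (length w))" for w :: "real list"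
  have [measurable]: "F' \<in> borel_measurable list_space"
    unfolding F'_def
    by (rule measurable_compose_countable[where g=length and f="\<lambda>n w. \<integral>\<^sup>+w'. F w' \<partial>exp_list r n"]) measurable
  have F': "(\<integral>\<^sup>+w. F' w \<partial>exp_list r n) = (\<integral>\<^sup>+w. F w \<partial>exp_list r n)" for n
  proof -
    interpret prob_space "exp_list r n" by (rule prob_space_exp_list)
    have "(\<integral>\<^sup>+w. F' w \<partial>exp_list r n) = (\<integral>\<^sup>+w. (\<integral>\<^sup>+w'. F w' \<partial>exp_list r n) \<partial>exp_list r n)"
      unfolding F'_def by (intro nn_integral_cong_AE eventually_mono[OF AE_exp_list_length]) simp
    then show ?thesis by (simp add: emeasure_space_1[simplified])
  qed
  have "(\<integral>\<^sup>+w. F (serve m d w) \<partial>exp_list r n) = (\<integral>\<^sup>+w. F' (serve m d w) \<partial>exp_list r n)"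
    using d
  proof (induction n arbitrary: d)
    case 0
    have "serve m d [] = []" for d by (simp add: serve.simps)
    then show ?case using F'[of 0] by (simp add: nn_integral_exp_list_0)
  next
    case (Suc n)
    show ?case
      unfolding nn_integral_serve_first_departure[OF \<open>F \<in> _\<close> m Suc.prems]
        nn_integral_serve_first_departure[OF \<open>F' \<in> _\<close> m Suc.prems] F'
      by (intro arg_cong2[where f="(+)"] nn_integral_cong refl) (use Suc.IH in auto)
  qed
  then show ?thesis unfolding F'_def .
qed

end

subsection \<open>Convexity of the pure death process\<close>

text \<open>Integrating factor: \<open>exp (k * t) * z t\<close> is nondecreasing. This absorbs the
  negative multiple of \<open>z\<close> that appears in every equation below.\<close>

lemma nonneg_if_deriv_plus_nonneg:
  fixes z :: "real \<Rightarrow> real" and k :: real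
  assumes z: "\<And>t. (z has_real_derivative z' t) (at t)"
    and "\<And>t. 0 \<le> t \<Longrightarrow> 0 \<le> z' t + k * z t" and "0 \<le> z 0" "0 \<le> t"
  shows "0 \<le> z t"
proof -
  have "exp (k * 0) * z 0 \<le> exp (k * t) * z t"
  proof (rule DERIV_nonneg_imp_nondecreasing[OF \<open>0 \<le> t\<close>])
    fix x :: real assume x: "0 \<le> x"
    have "((\<lambda>t. exp (k * t) * z t) has_real_derivative exp (k * x) * (z' x + k * z x)) (at x)"
      by (auto intro!: derivative_eq_intros z simp: algebra_simps)
    moreover have "0 \<le> exp (k * x) * (z' x + k * z x)" using assms(2)[OF x] by simp
    ultimately show "\<exists>y. ((\<lambda>t. exp (k * t) * z t) has_real_derivative y) (at x) \<and> 0 \<le> y"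
      by blast
  qed
  then have "0 \<le> exp (k * t) * z t" using assms(3) by simp
  then show ?thesis by (simp add: zero_le_mult_iff)
qed

text \<open>Variation of constants. Working on the whole real line keeps all derivatives two-sided,
  so time 0 needs no special treatment.\<close>

lemma linear_ode_solution:
  fixes y :: "real \<Rightarrow> real"
  assumes "\<And>t. isCont y t"
  shows "\<exists>z. z 0 = c \<and> (\<forall>t. (z has_real_derivative k * (y t - z t)) (at t))"
proof -
  have "\<exists>F. \<forall>x::real. -\<infinity> < ereal x \<longrightarrow> ereal x < \<infinity> \<longrightarrow> (F has_vector_derivative k * exp (k * x) * y x) (at x)"
    by (rule einterval_antiderivative) (auto intro!: continuous_intros assms)
  then obtain F where F: "\<And>x. (F has_real_derivative k * exp (k * x) * y x) (at x)"
    by (auto simp: has_real_derivative_iff_has_vector_derivative)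
  have "((\<lambda>t. exp (- k * t) * (c + F t - F 0)) has_real_derivative k * (y t - exp (- k * t) * (c + F t - F 0))) (at t)" for t
    by (auto intro!: derivative_eq_intros F simp: algebra_simps exp_minus field_simps)
  then show ?thesis by (intro exI[of _ "\<lambda>t. exp (- k * t) * (c + F t - F 0)"]) simp
qed

text \<open>The system is triangular and is solved one queue length at a time, each component
  serving as the inhomogeneity of the next. At \<open>q = 0\<close> the truncated
  \<open>q - 1\<close> is again 0, which is harmless because \<open>k 0 = 0\<close>.\<close>

lemma death_ode_solution:
  fixes k :: "nat \<Rightarrow> real"
  assumes "k 0 = 0"
  shows "\<exists>p. (\<forall>q. p q 0 = g q) \<and> (\<forall>q t. (p q has_real_derivative k q * (p (q - 1) t - p q t)) (at t))"
proof -
  \<comment> \<open>The last conjunct fixes the component 0 as a constant, which is what its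
    equation with rate 0 demands.\<close>
  let ?P = "\<lambda>n y. y 0 = g n \<and> (\<forall>t. isCont y t) \<and> (n = 0 \<longrightarrow> y = (\<lambda>_. g 0))"
  have "\<exists>p. \<forall>n. ?P n (p n) \<and> (\<forall>t. (p (Suc n) has_real_derivative k (Suc n) * (p n t - p (Suc n) t)) (at t))"
  proof (rule dependent_nat_choice[where P="?P" and
        Q="\<lambda>n y z. \<forall>t. (z has_real_derivative k (Suc n) * (y t - z t)) (at t)"])
    fix y :: "real \<Rightarrow> real" and n assume "?P n y"
    then obtain z where "z 0 = g (Suc n)" "\<And>t. (z has_real_derivative k (Suc n) * (y t - z t)) (at t)"
      using linear_ode_solution[of y] by blast
    then show "\<exists>z. ?P (Suc n) z \<and> (\<forall>t. (z has_real_derivative k (Suc n) * (y t - z t)) (at t))"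
      by (auto intro!: exI[of _ z] DERIV_isCont)
  qed auto
  then obtain p where p: "\<And>n. ?P n (p n)"
    "\<And>n t. (p (Suc n) has_real_derivative k (Suc n) * (p n t - p (Suc n) t)) (at t)" by blast
  have "(p q has_real_derivative k q * (p (q - 1) t - p q t)) (at t)" for q t
    using p(1)[of 0] p(2)[of "q - 1" t] assms by (cases q) auto
  then show ?thesis using p(1) by blast
qed

text \<open>Differences of the solution solve equations of the same shape; the inhomogeneous terms are
  nonnegative because the rates are nondecreasing and concave.\<close>

lemma death_ode_mono_convex:
  fixes p :: "nat \<Rightarrow> real \<Rightarrow> real" and k :: "nat \<Rightarrow> real"
  assumes init: "\<And>q. p q 0 = g q"
    and ode: "\<And>q t. (p q has_real_derivative k q * (p (q - 1) t - p q t)) (at t)"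
    and k0: "k 0 = 0" and k_nonneg: "\<And>q. 0 \<le> k q"
    and k_concave: "\<And>q. k q + k (q + 2) \<le> 2 * k (q + 1)"
    and g_nonneg: "0 \<le> g 0" and g_mono: "\<And>q. g q \<le> g (q + 1)"
    and g_convex: "\<And>q. 2 * g (q + 1) \<le> g q + g (q + 2)" and t: "0 \<le> t"
  shows "0 \<le> p q t" and "p q t \<le> p (q + 1) t" and "2 * p (q + 1) t \<le> p q t + p (q + 2) t"
proof -
  have nonneg: "0 \<le> p q t" if "0 \<le> t" for q t
    using that
  proof (induction q arbitrary: t)
    case 0
    show ?case
      by (rule nonneg_if_deriv_plus_nonneg[OF ode[of 0], where k=0])
        (use k0 init[of 0] g_nonneg \<open>0 \<le> t\<close> in auto)
  next
    case (Suc q)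
    have g: "0 \<le> g (Suc q)" using g_nonneg lift_Suc_mono_le[of g 0 "Suc q"] g_mono by fastforce
    show ?case
    proof (rule nonneg_if_deriv_plus_nonneg[OF ode[of "Suc q"], where k="k (Suc q)"])
      fix t :: real assume "0 \<le> t"
      then have "0 \<le> k (Suc q) * p q t" using Suc.IH k_nonneg by simp
      then show "0 \<le> k (Suc q) * (p (Suc q - 1) t - p (Suc q) t) + k (Suc q) * p (Suc q) t"
        by (simp add: algebra_simps)
    qed (use init g Suc.prems in auto)
  qed
  have D: "0 \<le> p (q + 1) t - p q t" if "0 \<le> t" for q t
    using that
  proof (induction q arbitrary: t)
    case 0
    show ?case
      by (rule nonneg_if_deriv_plus_nonneg[OF DERIV_diff[OF ode ode], where k="k 1"])
        (use k0 init g_mono[of 0] \<open>0 \<le> t\<close> in \<open>auto simp: algebra_simps\<close>)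
  next
    case (Suc q)
    show ?case
    proof (rule nonneg_if_deriv_plus_nonneg[OF DERIV_diff[OF ode ode], where k="k (q + 2)"])
      fix t :: real assume "0 \<le> t"
      then have "0 \<le> k (q + 1) * (p (q + 1) t - p q t)" using Suc.IH k_nonneg by simp
      then show "0 \<le> k (Suc q + 1) * (p (Suc q + 1 - 1) t - p (Suc q + 1) t)
          - k (Suc q) * (p (Suc q - 1) t - p (Suc q) t) + k (q + 2) * (p (Suc q + 1) t - p (Suc q) t)"
        by (simp add: algebra_simps)
    qed (use init g_mono[of "Suc q"] Suc.prems in auto)
  qed
  \<comment> \<open>Write \<open>e q\<close> for the first and \<open>s q\<close> for the second
    difference at \<open>q\<close>. The equations give \<open>s q' = - k (q + 2) * s q + (2 * k (q +
    1) - k q - k (q + 2)) * e q + k q * s (q - 1)\<close>. The middle term is nonnegative by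
    concavity of \<open>k\<close> and by \<open>D\<close>, the last one by induction; for
    \<open>q = 0\<close> it vanishes.\<close>
  have D2: "0 \<le> (p (q + 2) t - p (q + 1) t) - (p (q + 1) t - p q t)" if "0 \<le> t" for q t
    using that
  proof (induction q arbitrary: t)
    case 0
    show ?case
    proof (rule nonneg_if_deriv_plus_nonneg[OF DERIV_diff[OF DERIV_diff[OF ode ode] DERIV_diff[OF ode ode]], where k="k 2"])
      fix t :: real assume "0 \<le> t"
      then have "0 \<le> (2 * k 1 - k 0 - k 2) * (p 1 t - p 0 t)" using D[of t 0] k_concave[of 0] by (simp add: numeral_2_eq_2)
      then show "0 \<le> k (0 + 2) * (p (0 + 2 - 1) t - p (0 + 2) t) - k (0 + 1) * (p (0 + 1 - 1) t - p (0 + 1) t) -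
         (k (0 + 1) * (p (0 + 1 - 1) t - p (0 + 1) t) - k 0 * (p (0 - 1) t - p 0 t)) +
         k 2 * (p (0 + 2) t - p (0 + 1) t - (p (0 + 1) t - p 0 t))"
        using k0 by (simp add: algebra_simps numeral_2_eq_2)
    qed (use init g_convex[of 0] \<open>0 \<le> t\<close> in auto)
  next
    case (Suc q)
    show ?case
    proof (rule nonneg_if_deriv_plus_nonneg[OF DERIV_diff[OF DERIV_diff[OF ode ode] DERIV_diff[OF ode ode]], where k="k (q + 3)"])
      fix t :: real assume t: "0 \<le> t"
      have "0 \<le> (2 * k (q + 2) - k (q + 1) - k (q + 3)) * (p (q + 2) t - p (q + 1) t)"
        using D[OF t, of "q + 1"] k_concave[of "q + 1"] by (intro mult_nonneg_nonneg) (auto simp: eval_nat_numeral)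
      moreover have "0 \<le> k (q + 1) * ((p (q + 2) t - p (q + 1) t) - (p (q + 1) t - p q t))"
        using Suc.IH[OF t] k_nonneg by simp
      ultimately show "0 \<le> k (Suc q + 2) * (p (Suc q + 2 - 1) t - p (Suc q + 2) t) - k (Suc q + 1) * (p (Suc q + 1 - 1) t - p (Suc q + 1) t) -
         (k (Suc q + 1) * (p (Suc q + 1 - 1) t - p (Suc q + 1) t) - k (Suc q) * (p (Suc q - 1) t - p (Suc q) t)) +
         k (q + 3) * (p (Suc q + 2) t - p (Suc q + 1) t - (p (Suc q + 1) t - p (Suc q) t))"
        by (simp add: algebra_simps eval_nat_numeral)
    qed (use init g_convex[of "Suc q"] Suc.prems in auto)
  qed
  show "0 \<le> p q t" "p q t \<le> p (q + 1) t" "2 * p (q + 1) t \<le> p q t + p (q + 2) t"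
    using nonneg[OF t, of q] D[OF t, of q] D2[OF t, of q] by simp_all
qed

text \<open>As a function of \<open>q\<close> this is the transition operator, at time
  \<open>d\<close>, of the pure death process with rates \<open>min q m * r\<close>, realised by
  service of fresh tasks.\<close>

definition death_mean :: "real \<Rightarrow> nat \<Rightarrow> real \<Rightarrow> (nat \<Rightarrow> ennreal) \<Rightarrow> nat \<Rightarrow> ennreal" where
  "death_mean r m d g q = (\<integral>\<^sup>+w. g (length (serve m d w)) \<partial>exp_list r q)"

text \<open>The mean is not differentiated in \<open>d\<close>. Instead the solution
  \<open>p\<close> is shown to satisfy the renewal equation:
  \<open>- exp (- t * k) * p (Suc q) (d - t)\<close> is an antiderivative of the integrand, so the
  fundamental theorem of calculus evaluates the integral, and induction on \<open>q\<close>
  identifies mean and solution.\<close>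

lemma death_mean_eq_ode_solution:
  fixes p :: "nat \<Rightarrow> real \<Rightarrow> real" and r :: real
  assumes r: "0 < r" and m: "m \<ge> 1"
    and init: "\<And>q. p q 0 = g q"
    and ode: "\<And>q t. (p q has_real_derivative real (min q m) * r * (p (q - 1) t - p q t)) (at t)"
    and nonneg: "\<And>q t. 0 \<le> t \<Longrightarrow> 0 \<le> p q t" and d: "0 \<le> d"
  shows "death_mean r m d (\<lambda>n. ennreal (g n)) q = ennreal (p q d)"
  using d
proof (induction q arbitrary: d)
  case 0
  have "p 0 0 = p 0 d"
    by (rule DERIV_isconst_all[of "p 0"]) (use ode[of 0] in auto)
  moreover have "serve m d [] = []" by (simp add: serve.simps)
  ultimately show ?case
    by (simp add: death_mean_def nn_integral_exp_list_0[OF r] init)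
next
  case (Suc q)
  define k where "k = real (min (Suc q) m) * r"
  have k: "0 < k" using m r by (simp add: k_def)
  have ode': "(p (Suc q) has_real_derivative k * (p q t - p (Suc q) t)) (at t)" for t
    using ode[of "Suc q" t] by (simp add: k_def)
  have cont: "continuous_on UNIV (p q)"
    by (rule DERIV_continuous_on) (use ode in \<open>auto intro: has_field_derivative_at_within\<close>)
  then have [measurable]: "p q \<in> borel_measurable borel" by (rule borel_measurable_continuous_onI)
  interpret prob_space "exp_list r (Suc q)" by (rule prob_space_exp_list[OF r])
  let ?f = "\<lambda>t. k * exp (- t * k) * p q (d - t)"
  have "(\<integral>\<^sup>+w. ennreal (g (length w)) \<partial>exp_list r (Suc q)) = (\<integral>\<^sup>+w. ennreal (g (Suc q)) \<partial>exp_list r (Suc q))"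
    by (intro nn_integral_cong_AE eventually_mono[OF AE_exp_list_length[OF r]]) simp
  also have "\<dots> = ennreal (g (Suc q))" using emeasure_space_1 by simp
  finally have *: "death_mean r m d (\<lambda>n. ennreal (g n)) (Suc q) = ennreal (exp (- k * d)) * ennreal (g (Suc q))
     + (\<integral>\<^sup>+t. (if t < d then death_mean r m (d - t) (\<lambda>n. ennreal (g n)) q else 0) \<partial>exp_law k)"
    unfolding death_mean_def k_def
    by (subst nn_integral_serve_first_departure[OF r _ m Suc.prems]) simp_all
  have "(\<integral>\<^sup>+t. (if t < d then death_mean r m (d - t) (\<lambda>n. ennreal (g n)) q else 0) \<partial>exp_law k)
      = (\<integral>\<^sup>+t. (if t < d then ennreal (p q (d - t)) else 0) \<partial>exp_law k)"
    by (intro nn_integral_cong) (simp add: Suc.IH)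
  also have "\<dots> = (\<integral>\<^sup>+t. ennreal (exponential_density k t) * (if t < d then ennreal (p q (d - t)) else 0) \<partial>lborel)"
    by (rule nn_integral_exp_law) measurable
  also have "\<dots> = (\<integral>\<^sup>+t. ennreal (?f t) * indicator {0..d} t \<partial>lborel)"
  proof (rule nn_integral_cong_AE, rule eventually_mono[OF AE_lborel_singleton[of d]])
    fix t assume "t \<noteq> d"
    then show "ennreal (exponential_density k t) * (if t < d then ennreal (p q (d - t)) else 0) = ennreal (?f t) * indicator {0..d} t"
      using k by (auto simp: exponential_density_def ennreal_mult' split: split_indicator)
  qed
  also have "\<dots> = ennreal (- exp (- d * k) * p (Suc q) (d - d) - - exp (- 0 * k) * p (Suc q) (d - 0))"
  proof (rule nn_integral_FTC_Icc)
    show "0 \<le> ?f t" if "t \<in> {0..d}" for t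
      using that k nonneg by simp
    fix t :: real
    show "((\<lambda>t. - exp (- t * k) * p (Suc q) (d - t)) has_real_derivative ?f t) (at t)"
      by (auto intro!: derivative_eq_intros DERIV_chain2[OF ode'] simp: algebra_simps)
  qed (use Suc.prems in auto)
  also have "\<dots> = ennreal (p (Suc q) d - exp (- k * d) * g (Suc q))"
    by (simp add: init mult.commute)
  finally have **: "(\<integral>\<^sup>+t. (if t < d then death_mean r m (d - t) (\<lambda>n. ennreal (g n)) q else 0) \<partial>exp_law k)
      = ennreal (p (Suc q) d - exp (- k * d) * g (Suc q))" .
  \<comment> \<open>\<open>ennreal\<close> sends negative reals to 0, so the difference in
    \<open>**\<close> must be known to be nonnegative before the two terms can be added up to
    \<open>p (Suc q) d\<close>.\<close>
  have "exp (k * 0) * p (Suc q) 0 \<le> exp (k * d) * p (Suc q) d"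
  proof (rule DERIV_nonneg_imp_nondecreasing[OF Suc.prems])
    fix x :: real assume "0 \<le> x"
    then have "0 \<le> exp (k * x) * (k * p q x)" using k nonneg by simp
    moreover have "((\<lambda>t. exp (k * t) * p (Suc q) t) has_real_derivative exp (k * x) * (k * p q x)) (at x)"
      by (auto intro!: derivative_eq_intros ode' simp: algebra_simps)
    ultimately show "\<exists>y. ((\<lambda>t. exp (k * t) * p (Suc q) t) has_real_derivative y) (at x) \<and> 0 \<le> y" by blast
  qed
  then have "exp (- k * d) * g (Suc q) \<le> p (Suc q) d"
    by (simp add: init exp_minus field_simps)
  moreover have "0 \<le> g (Suc q)" using nonneg[of 0 "Suc q"] init by simp
  ultimately show ?case
    unfolding * ** by (simp add: ennreal_mult'[symmetric] ennreal_plus[symmetric] del: ennreal_plus)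
qed

text \<open>Convexity is written with sums because subtraction in \<open>ennreal\<close> is
  truncated; finiteness is part of the notion so that it can be transferred to real sequences and
  back.\<close>

definition mono_convex :: "(nat \<Rightarrow> ennreal) \<Rightarrow> bool" where
  "mono_convex f \<longleftrightarrow> (\<forall>q. f q < \<infinity> \<and> f q \<le> f (q + 1) \<and> f (q + 1) + f (q + 1) \<le> f q + f (q + 2))"

lemma mono_convexE:
  assumes "mono_convex f"
  obtains g :: "nat \<Rightarrow> real" where "f = (\<lambda>q. ennreal (g q))" "\<And>q. 0 \<le> g q" "\<And>q. g q \<le> g (q + 1)"
    "\<And>q. 2 * g (q + 1) \<le> g q + g (q + 2)"
proof
  let ?g = "\<lambda>q. enn2real (f q)"
  show f: "f = (\<lambda>q. ennreal (?g q))" using assms by (auto simp: mono_convex_def fun_eq_iff)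
  show g: "0 \<le> ?g q" for q by simp
  show "?g q \<le> ?g (q + 1)" for q
    using assms by (auto simp: mono_convex_def intro!: enn2real_mono)
  have "ennreal (?g (q + 1)) + ennreal (?g (q + 1)) \<le> ennreal (?g q) + ennreal (?g (q + 2))" for q
    using assms f by (metis mono_convex_def)
  then show "2 * ?g (q + 1) \<le> ?g q + ?g (q + 2)" for q
    using g by (metis ennreal_plus ennreal_le_iff add_nonneg_nonneg mult_2)
qed

lemma mono_convexI:
  assumes "\<And>q. 0 \<le> g q" "\<And>q. g q \<le> g (q + 1)" "\<And>q. 2 * g (q + 1) \<le> g q + g (q + 2)"
  shows "mono_convex (\<lambda>q. ennreal (g q))"
proof -
  have "ennreal (g (q + 1)) + ennreal (g (q + 1)) \<le> ennreal (g q) + ennreal (g (q + 2))" for q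
    using assms(3)[of q] assms(1)
    by (simp add: ennreal_plus[symmetric] del: ennreal_plus)
  then show ?thesis
    unfolding mono_convex_def using assms(2) by (auto intro!: ennreal_leI simp: less_top[symmetric])
qed

lemma mono_convex_death_mean:
  assumes r: "0 < r" and m: "m \<ge> 1" and f: "mono_convex f" and d: "0 \<le> d"
  shows "mono_convex (death_mean r m d f)"
proof -
  obtain g where g: "f = (\<lambda>q. ennreal (g q))" "\<And>q. 0 \<le> g q" "\<And>q. g q \<le> g (q + 1)"
    "\<And>q. 2 * g (q + 1) \<le> g q + g (q + 2)"
    using mono_convexE[OF f] by metis
  let ?k = "\<lambda>q. real (min q m) * r"
  obtain p where p: "\<And>q. p q 0 = g q" "\<And>q t. (p q has_real_derivative ?k q * (p (q - 1) t - p q t)) (at t)"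
    using death_ode_solution[of ?k g] by auto
  have k: "?k q + ?k (q + 2) \<le> 2 * ?k (q + 1)" for q
    unfolding distrib_right[symmetric] mult.assoc[symmetric]
    using r by (intro mult_right_mono) (auto simp: min_def)
  note pc = death_ode_mono_convex[OF p _ _ k g(2-4)]
  have "death_mean r m d f = (\<lambda>q. ennreal (p q d))"
    unfolding g(1) using pc r by (intro ext death_mean_eq_ode_solution[OF r m p _ d]) auto
  then show ?thesis
    using pc r d by (auto intro!: mono_convexI)
qed

subsection \<open>The regime process\<close>

text \<open>The Laplace transform, obtained by tilting the density to rate \<open>r + a\<close>. It
  yields both the divergence of exponential sums and the mean discount until the next
  arrival.\<close>

lemma nn_integral_exp_law_exp:
  assumes "0 < r" "0 \<le> a"
  shows "(\<integral>\<^sup>+x. ennreal (exp (- a * x)) \<partial>exp_law r) = ennreal (r / (r + a))"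
proof -
  interpret prob_space "exp_law (r + a)" using assms by (intro prob_space_exp_law) simp
  have "(\<integral>\<^sup>+x. ennreal (exp (- a * x)) \<partial>exp_law r)
      = (\<integral>\<^sup>+x. ennreal (exponential_density r x) * ennreal (exp (- a * x)) \<partial>lborel)"
    by (rule nn_integral_exp_law) measurable
  also have "\<dots> = (\<integral>\<^sup>+x. ennreal (r / (r + a)) * ennreal (exponential_density (r + a) x) \<partial>lborel)"
  proof (rule nn_integral_cong)
    fix x :: real
    have "exp (- x * r) * exp (- a * x) = exp (- x * (r + a))"
      by (simp add: mult_exp_exp algebra_simps)
    then have "exponential_density r x * exp (- a * x) = r / (r + a) * exponential_density (r + a) x"
      using assms by (simp add: exponential_density_def)
    then show "ennreal (exponential_density r x) * ennreal (exp (- a * x))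
        = ennreal (r / (r + a)) * ennreal (exponential_density (r + a) x)"
      using assms by (simp add: ennreal_mult'[symmetric] ennreal_mult''[symmetric])
  qed
  also have "\<dots> = ennreal (r / (r + a)) * (\<integral>\<^sup>+x. ennreal (exponential_density (r + a) x) \<partial>lborel)"
    by (rule nn_integral_cmult) measurable
  also have "(\<integral>\<^sup>+x. ennreal (exponential_density (r + a) x) \<partial>lborel) = (\<integral>\<^sup>+x. 1 \<partial>exp_law (r + a))"
    by (subst nn_integral_exp_law) simp_all
  also have "\<dots> = 1"
    using emeasure_space_1 by simp
  finally show ?thesis by simp
qed

text \<open>The mean of \<open>exp\<close> of minus the \<open>n\<close>-th partial sum is
  \<open>(r / (r + 1)) ^ n\<close>, which tends to 0. Hence the infimum over \<open>n\<close> of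
  these exponentials has mean 0 and vanishes almost surely, which is divergence of the sums.\<close>

lemma AE_stream_exp_law_sums_unbounded:
  assumes r: "0 < r"
  shows "AE x in stream_space (exp_law r). \<forall>B. \<exists>n. B \<le> (\<Sum>k<n. x !! k)"
proof -
  interpret X: prob_space "exp_law r" using r by (rule prob_space_exp_law)
  interpret XS: prob_space "stream_space (exp_law r)" by (rule X.prob_space_stream_space)
  let ?Y = "\<lambda>n x. ennreal (exp (- (\<Sum>k<n. x !! k)))"
  have E: "(\<integral>\<^sup>+x. ?Y n x \<partial>stream_space (exp_law r)) = ennreal (r / (r + 1)) ^ n" for n
  proof (induction n)
    case (Suc n)
    have "(\<integral>\<^sup>+x. ?Y (Suc n) x \<partial>stream_space (exp_law r))
        = (\<integral>\<^sup>+y. \<integral>\<^sup>+x. ?Y (Suc n) (y ## x) \<partial>stream_space (exp_law r) \<partial>exp_law r)"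
      by (rule X.nn_integral_stream_space) measurable
    also have "\<dots> = (\<integral>\<^sup>+y. \<integral>\<^sup>+x. ennreal (exp (- 1 * y)) * ?Y n x \<partial>stream_space (exp_law r) \<partial>exp_law r)"
      by (simp add: sum.lessThan_Suc_shift exp_diff exp_minus ennreal_mult'[symmetric] field_simps
          del: sum.lessThan_Suc)
    also have "\<dots> = (\<integral>\<^sup>+y. ennreal (exp (- 1 * y)) * ennreal (r / (r + 1)) ^ n \<partial>exp_law r)"
      using Suc by (simp add: nn_integral_cmult)
    also have "\<dots> = ennreal (r / (r + 1)) * ennreal (r / (r + 1)) ^ n"
      using nn_integral_exp_law_exp[of r 1] r by (simp add: nn_integral_multc)
    finally show ?case by simp
  qed (simp add: XS.emeasure_space_1)
  have "(\<integral>\<^sup>+x. (INF n. ?Y n x) \<partial>stream_space (exp_law r)) \<le> ennreal ((r / (r + 1)) ^ n)" for n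
  proof -
    have "(\<integral>\<^sup>+x. (INF n. ?Y n x) \<partial>stream_space (exp_law r)) \<le> (\<integral>\<^sup>+x. ?Y n x \<partial>stream_space (exp_law r))"
      by (intro nn_integral_mono INF_lower) simp
    then show ?thesis using r by (simp add: E ennreal_power)
  qed
  moreover have "(\<lambda>n. ennreal ((r / (r + 1)) ^ n)) \<longlonglongrightarrow> ennreal 0"
    using r by (intro tendsto_ennrealI LIMSEQ_realpow_zero) auto
  ultimately have "(\<integral>\<^sup>+x. (INF n. ?Y n x) \<partial>stream_space (exp_law r)) \<le> ennreal 0"
    by (intro LIMSEQ_le_const[where X="\<lambda>n. ennreal ((r / (r + 1)) ^ n)"]) auto
  then have "AE x in stream_space (exp_law r). (INF n. ?Y n x) = 0"
    by (subst nn_integral_0_iff_AE[symmetric]) auto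
  then show ?thesis
  proof eventually_elim
    fix x assume "(INF n. ?Y n x) = 0"
    then have "(INF n. ?Y n x) < ennreal (exp (- B))" for B by simp
    then have "\<exists>n. ?Y n x < ennreal (exp (- B))" for B by (simp add: INF_less_iff)
    then have "\<exists>n. B < (\<Sum>k<n. x !! k)" for B by (simp add: ennreal_less_iff)
    then show "\<forall>B. \<exists>n. B \<le> (\<Sum>k<n. x !! k)" by (meson less_imp_le)
  qed
qed

lemma sets_stream_exp_law [measurable_cong]: "sets (stream_space (exp_law r)) = sets (stream_space borel)"
  by (rule sets_stream_space_cong) simp

context hybrid_control
begin

section \<open>Laws and measurability of the regime path\<close>

definition jump_law :: "(nat \<Rightarrow> nat) measure" where
  "jump_law = Pi\<^sub>M {1..K} (\<lambda>i. measure_pmf (jump i))"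

abbreviation "holdings \<equiv> stream_space (exp_law 1)"
abbreviation "jumps \<equiv> stream_space jump_law"
abbreviation "regime_law \<equiv> holdings \<Otimes>\<^sub>M jumps"

abbreviation rate :: "nat \<Rightarrow> real" where "rate i \<equiv> - Q i i"

sublocale E1: prob_space "exp_law 1" by (rule prob_space_exp_law) simp
sublocale ES: prob_space holdings by (rule E1.prob_space_stream_space)
sublocale JL: prob_space jump_law unfolding jump_law_def by (intro prob_space_PiM measure_pmf.prob_space_axioms)
sublocale JS: prob_space jumps by (rule JL.prob_space_stream_space)
sublocale RL: pair_prob_space holdings jumps ..

lemma rate_nonneg: "i \<in> {1..K} \<Longrightarrow> 0 \<le> rate i"
  by (auto simp: Q_diag intro!: sum_nonneg Q_offdiag)

text \<open>The weights given to \<open>embed_pmf\<close> determine the law only once they are known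
  to be nonnegative and to sum to 1; this is where \<open>Q_diag\<close> enters.\<close>

lemma set_pmf_jump: "i \<in> {1..K} \<Longrightarrow> set_pmf (jump i) \<subseteq> {1..K}"
proof (cases "Q i i = 0")
  case False
  assume i: "i \<in> {1..K}"
  let ?f = "\<lambda>j. if j \<in> {1..K} \<and> j \<noteq> i then Q i j / (- Q i i) else 0"
  have "0 \<le> Q i j / (- Q i i)" if "j \<in> {1..K}" "j \<noteq> i" for j
    using Q_offdiag[OF i, of j] rate_nonneg[OF i] that by (intro divide_nonneg_nonneg) auto
  then have f: "0 \<le> ?f j" for j by (cases "j \<in> {1..K} \<and> j \<noteq> i") (simp_all only: if_True if_False simp_thms order_refl)
  have "(\<integral>\<^sup>+j. ennreal (?f j) \<partial>count_space UNIV) = (\<Sum>j\<in>{1..K}. ennreal (?f j))"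
    by (rule nn_integral_count_space') auto
  also have "\<dots> = ennreal (\<Sum>j\<in>{1..K}. ?f j)"
    by (rule sum_ennreal) (rule f)
  also have "(\<Sum>j\<in>{1..K}. ?f j) = (\<Sum>j\<in>{1..K} - {i}. Q i j / (- Q i i))"
    by (rule sum.mono_neutral_cong_right) auto
  also have "\<dots> = 1"
    unfolding sum_divide_distrib[symmetric] using Q_diag[OF i] False by simp
  finally have "pmf (jump i) j = ?f j" for j
    unfolding jump_def using False f by (simp only: if_False, intro pmf_embed_pmf) simp_all
  then show ?thesis
    by (auto simp: set_pmf_iff split: if_splits)
qed (auto simp: jump_def)

lemma AE_jump_law: "AE \<phi> in jump_law. \<forall>i\<in>{1..K}. \<phi> i \<in> {1..K}"
  unfolding jump_law_def
proof (rule AE_finite_allI)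
  fix i assume "i \<in> {1..K}"
  then show "AE \<phi> in Pi\<^sub>M {1..K} (\<lambda>i. measure_pmf (jump i)). \<phi> i \<in> {1..K}"
    using set_pmf_jump[of i]
    by (intro AE_PiM_component measure_pmf.prob_space_axioms) (auto simp: AE_measure_pmf_iff subset_eq)
qed simp

lemma measurable_jump_apply [measurable (raw)]:
  assumes [measurable]: "f \<in> N \<rightarrow>\<^sub>M jump_law" "g \<in> N \<rightarrow>\<^sub>M count_space UNIV"
  shows "(\<lambda>x. f x (g x)) \<in> N \<rightarrow>\<^sub>M count_space UNIV"
proof -
  have "(\<lambda>\<phi>. \<phi> i) \<in> jump_law \<rightarrow>\<^sub>M count_space UNIV" for i
  proof (cases "i \<in> {1..K}")
    case True
    then show ?thesis
      using measurable_component_singleton[of i "{1..K}" "\<lambda>i. measure_pmf (jump i)"]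
      unfolding jump_law_def by (simp cong: measurable_cong_sets)
  next
    case False
    \<comment> \<open>Points of the product space are extensional: off the index set every
      coordinate has the default value \<open>undefined\<close>, hence is constant.\<close>
    then have "\<phi> i = undefined" if "\<phi> \<in> space jump_law" for \<phi>
      using that by (auto simp: jump_law_def space_PiM PiE_def extensional_def)
    then show ?thesis by (subst measurable_cong[where g="\<lambda>_. undefined"]) auto
  qed
  then have [measurable]: "(\<lambda>x. f x i) \<in> N \<rightarrow>\<^sub>M count_space UNIV" for i
    by (rule measurable_compose[OF assms(1)])
  show ?thesis
    by (rule measurable_compose_countable[where g=g and f="\<lambda>i x. f x i"]) measurable
qed

lemma measurable_visited [measurable (raw)]:
  assumes [measurable]: "g \<in> N \<rightarrow>\<^sub>M jumps"
  shows "(\<lambda>x. visited i (g x) n) \<in> N \<rightarrow>\<^sub>M count_space UNIV"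
  by (induction n) simp_all

lemma measurable_jump_time [measurable (raw)]:
  assumes [measurable]: "f \<in> N \<rightarrow>\<^sub>M stream_space borel" "g \<in> N \<rightarrow>\<^sub>M jumps"
  shows "(\<lambda>x. jump_time i (f x) (g x) n) \<in> borel_measurable N"
proof -
  have [measurable]: "(\<lambda>x. ereal (rate (visited i (g x) k))) \<in> borel_measurable N" for k
    by (rule measurable_compose_countable[where g="\<lambda>x. visited i (g x) k" and f="\<lambda>j x. ereal (rate j)"]) measurable
  show ?thesis unfolding jump_time_def divide_ereal_def by measurable
qed

lemma measurable_regime_left [measurable (raw)]:
  assumes [measurable]: "f \<in> N \<rightarrow>\<^sub>M stream_space borel" "g \<in> N \<rightarrow>\<^sub>M jumps" "t \<in> borel_measurable N"
  shows "(\<lambda>x. regime_left i (f x) (g x) (t x)) \<in> N \<rightarrow>\<^sub>M count_space UNIV"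
  unfolding regime_left_def
  by (rule measurable_compose_countable[where f="\<lambda>n x. visited i (g x) n"]) measurable

text \<open>The cost sees the regime only through its left limits at the arrival times. Recording
  them in a stream makes the cost a function of streams that can be shifted by one arrival.\<close>

definition regime_path :: "nat \<Rightarrow> real stream \<Rightarrow> (nat \<Rightarrow> nat) stream \<Rightarrow> real stream \<Rightarrow> nat stream" where
  "regime_path i e \<phi> x = smap (\<lambda>n. regime_left i e \<phi> (arr x (Suc n))) nats"

lemma regime_path_snth [simp]: "regime_path i e \<phi> x !! n = regime_left i e \<phi> (arr x (Suc n))"
  by (simp add: regime_path_def)

lemma measurable_regime_path [measurable (raw)]:
  assumes [measurable]: "f \<in> N \<rightarrow>\<^sub>M stream_space borel" "g \<in> N \<rightarrow>\<^sub>M jumps" "x \<in> N \<rightarrow>\<^sub>M stream_space borel"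
  shows "(\<lambda>w. regime_path i (f w) (g w) (x w)) \<in> N \<rightarrow>\<^sub>M stream_space (count_space UNIV)"
proof (rule measurable_stream_space2)
  show "(\<lambda>w. regime_path i (f w) (g w) (x w) !! n) \<in> N \<rightarrow>\<^sub>M count_space UNIV" for n
    unfolding regime_path_snth arr_def by measurable
qed

lemma visited_shift: "visited i \<phi> (Suc n) = visited (shd \<phi> i) (stl \<phi>) n"
  by (induction n) simp_all

lemma jump_time_shift:
  "jump_time i e \<phi> (Suc n) = ereal (shd e) / ereal (rate i) + jump_time (shd \<phi> i) (stl e) (stl \<phi>) n"
  unfolding jump_time_def
  unfolding sum.lessThan_Suc_shift visited_shift by simp

text \<open>The first holding time may be the remainder of a started one and hence vanish; \<open>rate i \<noteq> 0\<close>
  then excludes the junk value \<open>0 / 0\<close> in \<open>jump_time\<close>.\<close>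

definition good_regime :: "nat \<Rightarrow> real stream \<Rightarrow> (nat \<Rightarrow> nat) stream \<Rightarrow> bool" where
  "good_regime i e \<phi> \<longleftrightarrow> i \<in> {1..K} \<and> 0 \<le> shd e \<and> (shd e = 0 \<longrightarrow> rate i \<noteq> 0) \<and> (\<forall>k. 0 < stl e !! k)
     \<and> (\<forall>B. \<exists>n. B \<le> (\<Sum>k<n. e !! k)) \<and> (\<forall>k. \<forall>i\<in>{1..K}. (\<phi> !! k) i \<in> {1..K})"

lemma AE_jump_stream: "AE \<phi> in jumps. \<forall>k. \<forall>i\<in>{1..K}. (\<phi> !! k) i \<in> {1..K}"
proof -
  have "AE \<phi> in jumps. stream_all (\<lambda>f. \<forall>i\<in>{1..K}. f i \<in> {1..K}) \<phi>"
    by (rule JL.AE_stream_all) (use AE_jump_law in auto)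
  then show ?thesis by (simp only: stream_all_def)
qed

lemma AE_good_regime:
  assumes "i \<in> {1..K}"
  shows "AE e in holdings. AE \<phi> in jumps. good_regime i e \<phi>"
proof -
  have e: "AE e in holdings. stream_all (\<lambda>x. 0 < x) e"
    by (rule E1.AE_stream_all) (use AE_exp_law_pos in auto)
  have "AE e in holdings. \<forall>B. \<exists>n. B \<le> (\<Sum>k<n. e !! k)"
    by (rule AE_stream_exp_law_sums_unbounded) simp
  with e show ?thesis
  proof eventually_elim
    case (elim e)
    then have "0 < e !! k" for k by (simp add: stream_all_def)
    from this[of 0] this[of "Suc _"] have "0 < shd e" "\<And>k. 0 < stl e !! k" by simp_all
    with elim(2) assms show ?case
      by (intro eventually_mono[OF AE_jump_stream]) (auto simp: good_regime_def)
  qed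
qed

lemma good_regime_stl:
  assumes "good_regime i e \<phi>"
  shows "good_regime (shd \<phi> i) (stl e) (stl \<phi>)"
proof -
  have "\<exists>n. B \<le> (\<Sum>k<n. stl e !! k)" for B
  proof -
    obtain n where n: "B + shd e \<le> (\<Sum>k<n. e !! k)" using assms unfolding good_regime_def by blast
    have "(\<Sum>k<n. e !! k) \<le> (\<Sum>k<Suc n. e !! k)"
      using assms by (cases n) (auto simp: good_regime_def order_less_imp_le)
    also have "\<dots> = shd e + (\<Sum>k<n. stl e !! k)" by (simp add: sum.lessThan_Suc_shift del: sum.lessThan_Suc)
    finally show ?thesis using n by (intro exI[of _ n]) simp
  qed
  moreover have "0 < shd (stl e)" "\<forall>k. 0 < stl (stl e) !! k" "shd \<phi> i \<in> {1..K}"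
    "\<forall>k. \<forall>i\<in>{1..K}. (stl \<phi> !! k) i \<in> {1..K}"
    using assms unfolding good_regime_def by (metis snth.simps)+
  ultimately show ?thesis unfolding good_regime_def by auto
qed

text \<open>During real time \<open>d\<close> the regime \<open>i\<close> uses up
  \<open>rate i * d\<close> of its standard exponential clock; what is left may be 0, which
  \<open>good_regime\<close> allows for the first clock only.\<close>

lemma good_regime_residual:
  assumes "good_regime i e \<phi>" "rate i * d \<le> shd e"
  shows "good_regime i ((shd e - rate i * d) ## stl e) \<phi>"
proof -
  have "\<exists>n. B \<le> (\<Sum>k<n. ((shd e - rate i * d) ## stl e) !! k)" for B
  proof -
    obtain n where n: "B + rate i * d + shd e \<le> (\<Sum>k<n. e !! k)" using assms unfolding good_regime_def by blast
    have "(\<Sum>k<n. e !! k) \<le> (\<Sum>k<Suc n. e !! k)"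
      using assms by (cases n) (auto simp: good_regime_def order_less_imp_le)
    also have "\<dots> = shd e + (\<Sum>k<n. stl e !! k)" by (simp add: sum.lessThan_Suc_shift del: sum.lessThan_Suc)
    also have "\<dots> = rate i * d + (\<Sum>k<Suc n. ((shd e - rate i * d) ## stl e) !! k)"
      by (simp add: sum.lessThan_Suc_shift del: sum.lessThan_Suc)
    finally show ?thesis using n assms by (intro exI[of _ "Suc n"]) (simp add: good_regime_def)
  qed
  then show ?thesis using assms unfolding good_regime_def by auto
qed

text \<open>There are finitely many regimes, so all rates lie below a common \<open>A\<close>, and
  the jump times dominate the partial sums of the standard clocks divided by \<open>A\<close>. On
  good paths these sums are unbounded.\<close>

lemma no_explosion:
  assumes "good_regime i e \<phi>"
  shows "\<exists>n. ereal t \<le> jump_time i e \<phi> (Suc n)"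
proof -
  \<comment> \<open>The summand 1 keeps \<open>A\<close> positive even when all rates
    vanish.\<close>
  define A where "A = 1 + (\<Sum>j\<in>{1..K}. rate j)"
  have A: "rate j \<le> A" if "j \<in> {1..K}" for j
    unfolding A_def using member_le_sum[of j "{1..K}" rate] that rate_nonneg by force
  have "0 \<le> (\<Sum>j\<in>{1..K}. rate j)" by (intro sum_nonneg rate_nonneg)
  then have A0: "0 < A" unfolding A_def by simp
  have vis: "visited i \<phi> k \<in> {1..K}" for k
    using assms by (induction k) (auto simp: good_regime_def)
  have e: "0 \<le> e !! k" for k
    using assms by (cases k) (auto simp: good_regime_def order_less_imp_le)
  have summand: "ereal (e !! k / A) \<le> ereal (e !! k) / ereal (rate (visited i \<phi> k))" for k
  proof (cases "rate (visited i \<phi> k) = 0")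
    case True
    then show ?thesis
      using e[of k] A0 by (cases "e !! k = 0") (auto simp: divide_ereal_def)
  next
    case False
    then have "0 < rate (visited i \<phi> k)" using rate_nonneg[OF vis[of k]] by simp
    then have "e !! k / A \<le> e !! k / rate (visited i \<phi> k)"
      using A[OF vis[of k]] e[of k] by (intro frac_le) auto
    then show ?thesis using False by simp
  qed
  obtain n where n: "A * t \<le> (\<Sum>k<n. e !! k)" using assms unfolding good_regime_def by blast
  have "A * t \<le> (\<Sum>k<Suc n. e !! k)" using n e[of n] by simp
  then have "t \<le> (\<Sum>k<Suc n. e !! k / A)"
    unfolding sum_divide_distrib[symmetric] using A0 by (simp add: field_simps)
  then have "ereal t \<le> (\<Sum>k<Suc n. ereal (e !! k / A))" by (simp only: sum_ereal ereal_less_eq)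
  also have "\<dots> \<le> jump_time i e \<phi> (Suc n)"
    unfolding jump_time_def by (rule sum_mono) (rule summand)
  finally show ?thesis by blast
qed

text \<open>The comparison with the first clock is weak because of the left limit: at the jump time
  itself the old regime still counts.\<close>

lemma regime_left_first_jump:
  assumes good: "good_regime i e \<phi>" and t: "0 < t"
  shows "regime_left i e \<phi> t =
    (if rate i * t \<le> shd e then i else regime_left (shd \<phi> i) (stl e) (stl \<phi>) (t - shd e / rate i))"
proof -
  have i: "i \<in> {1..K}" and e: "0 \<le> shd e" "shd e = 0 \<Longrightarrow> rate i \<noteq> 0"
    using good by (auto simp: good_regime_def)
  have j0: "jump_time i e \<phi> (Suc 0) = ereal (shd e) / ereal (rate i)" by (simp add: jump_time_def)
  show ?thesis
  proof (cases "rate i * t \<le> shd e")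
    case True
    have "ereal t \<le> jump_time i e \<phi> (Suc 0)"
    proof (cases "rate i = 0")
      case True
      then have "0 < shd e" using e by force
      then show ?thesis using True by (simp add: j0 divide_ereal_def)
    next
      case False
      then have "0 < rate i" using rate_nonneg[OF i] by simp
      then show ?thesis using True by (simp add: j0 field_simps)
    qed
    then show ?thesis using True by (simp add: regime_left_def)
  next
    case False
    then have a: "0 < rate i" using rate_nonneg[OF i] e by (cases "rate i = 0") auto
    then have n0: "\<not> ereal t \<le> jump_time i e \<phi> (Suc 0)" using False by (simp add: j0 field_simps)
    obtain n where n: "ereal t \<le> jump_time i e \<phi> (Suc n)" using no_explosion[OF good] by blast
    have "(LEAST n. ereal t \<le> jump_time i e \<phi> (Suc n)) = Suc (LEAST n. ereal t \<le> jump_time i e \<phi> (Suc (Suc n)))"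
      using n n0 by (rule Least_Suc)
    moreover have "ereal t \<le> jump_time i e \<phi> (Suc (Suc n)) \<longleftrightarrow>
        ereal (t - shd e / rate i) \<le> jump_time (shd \<phi> i) (stl e) (stl \<phi>) (Suc n)" for n
      using a unfolding jump_time_shift[of i e \<phi> "Suc n"]
      by (cases "jump_time (shd \<phi> i) (stl e) (stl \<phi>) (Suc n)") auto
    ultimately show ?thesis using False by (simp add: regime_left_def visited_shift del: visited.simps(2))
  qed
qed

lemma regime_left_in:
  assumes "i \<in> {1..K}" "\<And>k i. i \<in> {1..K} \<Longrightarrow> (\<phi> !! k) i \<in> {1..K}"
  shows "regime_left i e \<phi> t \<in> {1..K}"
proof -
  have "visited i \<phi> k \<in> {1..K}" for k
    using assms by (induction k) auto
  then show ?thesis unfolding regime_left_def .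
qed

text \<open>\<open>at_regime n f d i e \<phi>\<close> is the value of \<open>f\<close> at the regime in force at time \<open>d\<close>, at the remainder
  of its standard exponential holding time followed by the later ones, and at the later jumps,
  provided that exactly \<open>n\<close> jumps occur before \<open>d\<close>; otherwise it is \<open>0\<close>.\<close>

primrec at_regime :: "nat \<Rightarrow> (nat \<Rightarrow> real stream \<Rightarrow> (nat \<Rightarrow> nat) stream \<Rightarrow> ennreal) \<Rightarrow>
    real \<Rightarrow> nat \<Rightarrow> real stream \<Rightarrow> (nat \<Rightarrow> nat) stream \<Rightarrow> ennreal" where
  "at_regime 0 f d i e \<phi> = (if rate i * d \<le> shd e then f i ((shd e - rate i * d) ## stl e) \<phi> else 0)"
| "at_regime (Suc n) f d i e \<phi> =
    (if rate i * d \<le> shd e then 0 else at_regime n f (d - shd e / rate i) (shd \<phi> i) (stl e) (stl \<phi>))"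

lemma measurable_at_regime:
  assumes f: "\<And>i. (\<lambda>(e, \<phi>). f i e \<phi>) \<in> borel_measurable regime_law"
  shows "(\<lambda>(d, e, \<phi>). at_regime n f d i e \<phi>) \<in> borel_measurable (borel \<Otimes>\<^sub>M regime_law)"
proof (induction n arbitrary: i)
  case 0
  note f [measurable]
  show ?case unfolding at_regime.simps by measurable
next
  case (Suc n)
  have IH: "(\<lambda>x. at_regime n f (a x) j (b x) (c x)) \<in> borel_measurable N"
    if "a \<in> borel_measurable N" "b \<in> N \<rightarrow>\<^sub>M holdings" "c \<in> N \<rightarrow>\<^sub>M jumps"
    for a b c j and N :: "(real \<times> real stream \<times> (nat \<Rightarrow> nat) stream) measure"
    using measurable_compose[OF measurable_Pair[OF that(1) measurable_Pair[OF that(2,3)]] Suc.IH[of j]] by simp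
  have jump: "(\<lambda>(d, e, \<phi>). at_regime n f (d - shd e / rate i) (shd \<phi> i) (stl e) (stl \<phi>))
      \<in> borel_measurable (borel \<Otimes>\<^sub>M regime_law)"
    unfolding case_prod_beta
  proof (rule measurable_compose_countable[where g="\<lambda>x. shd (snd (snd x)) i"
          and f="\<lambda>j x. at_regime n f (fst x - shd (fst (snd x)) / rate i) j (stl (fst (snd x))) (stl (snd (snd x)))"])
    show "(\<lambda>x. at_regime n f (fst x - shd (fst (snd x)) / rate i) j (stl (fst (snd x))) (stl (snd (snd x))))
        \<in> borel_measurable (borel \<Otimes>\<^sub>M regime_law)" for j
      by (rule IH) measurable
    show "(\<lambda>x. shd (snd (snd x)) i) \<in> borel \<Otimes>\<^sub>M regime_law \<rightarrow>\<^sub>M count_space UNIV"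
      by (rule measurable_jump_apply) measurable
  qed
  show ?case
    unfolding at_regime.simps case_prod_beta
    by (rule measurable_If[OF measurable_const jump[unfolded case_prod_beta]]) measurable
qed

text \<open>Markov property on the event of exactly \<open>n\<close> jumps before \<open>d\<close>:
  replacing \<open>f\<close> by its average over fresh clocks and jumps leaves the mean unchanged.
  Conditioning on the first clock and jump reduces \<open>n\<close>; memorylessness of the running
  clock is used only when no jump is left.\<close>

lemma nn_integral_at_regime:
  assumes f: "\<And>i. (\<lambda>(e, \<phi>). f i e \<phi>) \<in> borel_measurable regime_law"
    and i: "i \<in> {1..K}" and d: "0 \<le> d"
  defines "f' \<equiv> \<lambda>i _ _. \<integral>\<^sup>+e. \<integral>\<^sup>+\<phi>. f i e \<phi> \<partial>jumps \<partial>holdings"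
  shows "(\<integral>\<^sup>+e. \<integral>\<^sup>+\<phi>. at_regime n f d i e \<phi> \<partial>jumps \<partial>holdings)
       = (\<integral>\<^sup>+e. \<integral>\<^sup>+\<phi>. at_regime n f' d i e \<phi> \<partial>jumps \<partial>holdings)"
  using i d
proof (induction n arbitrary: d i)
  case 0
  note f [measurable]
  have a: "0 \<le> rate i * d" using rate_nonneg 0 by (intro mult_nonneg_nonneg) auto
  define H where "H y = (\<integral>\<^sup>+e. \<integral>\<^sup>+\<phi>. f i (y ## e) \<phi> \<partial>jumps \<partial>holdings)" for y
  have [measurable]: "H \<in> borel_measurable borel" unfolding H_def by measurable
  have H: "(\<integral>\<^sup>+e. \<integral>\<^sup>+\<phi>. f i e \<phi> \<partial>jumps \<partial>holdings) = (\<integral>\<^sup>+y. H y \<partial>exp_law 1)"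
    unfolding H_def by (rule E1.nn_integral_stream_space) measurable
  have "(\<integral>\<^sup>+e. \<integral>\<^sup>+\<phi>. at_regime 0 f d i e \<phi> \<partial>jumps \<partial>holdings)
      = (\<integral>\<^sup>+y. \<integral>\<^sup>+e. \<integral>\<^sup>+\<phi>. at_regime 0 f d i (y ## e) \<phi> \<partial>jumps \<partial>holdings \<partial>exp_law 1)"
    unfolding at_regime.simps by (rule E1.nn_integral_stream_space) measurable
  also have "\<dots> = (\<integral>\<^sup>+y. (if rate i * d \<le> y then H (y - rate i * d) else 0) \<partial>exp_law 1)"
    by (intro nn_integral_cong) (simp add: H_def)
  also have "\<dots> = ennreal (exp (- 1 * (rate i * d))) * (\<integral>\<^sup>+y. H y \<partial>exp_law 1)"
    by (rule nn_integral_exp_law_memoryless) (use a in auto)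
  \<comment> \<open>Memorylessness is applied forwards to \<open>H\<close> and then backwards to the
    constant equal to its mean; both produce the same survival factor.\<close>
  also have "\<dots> = ennreal (exp (- 1 * (rate i * d))) * (\<integral>\<^sup>+y. (\<integral>\<^sup>+y. H y \<partial>exp_law 1) \<partial>exp_law 1)"
    using E1.emeasure_space_1 by simp
  also have "\<dots> = (\<integral>\<^sup>+y. (if rate i * d \<le> y then \<integral>\<^sup>+y. H y \<partial>exp_law 1 else 0) \<partial>exp_law 1)"
    by (rule nn_integral_exp_law_memoryless[symmetric]) (use a in auto)
  also have "\<dots> = (\<integral>\<^sup>+y. \<integral>\<^sup>+e. \<integral>\<^sup>+\<phi>. at_regime 0 f' d i (y ## e) \<phi> \<partial>jumps \<partial>holdings \<partial>exp_law 1)"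
    by (intro nn_integral_cong) (simp add: f'_def H JS.emeasure_space_1 ES.emeasure_space_1)
  also have "\<dots> = (\<integral>\<^sup>+e. \<integral>\<^sup>+\<phi>. at_regime 0 f' d i e \<phi> \<partial>jumps \<partial>holdings)"
    unfolding at_regime.simps f'_def by (rule E1.nn_integral_stream_space[symmetric]) measurable
  finally show ?case .
next
  case (Suc n)
  have f': "(\<lambda>(e, \<phi>). f' i e \<phi>) \<in> borel_measurable regime_law" for i
    unfolding f'_def by simp
  have unfold: "(\<integral>\<^sup>+e. \<integral>\<^sup>+\<phi>. at_regime (Suc n) g d i e \<phi> \<partial>jumps \<partial>holdings)
      = (\<integral>\<^sup>+y. \<integral>\<^sup>+\<phi>0. (if rate i * d \<le> y then 0
          else \<integral>\<^sup>+e. \<integral>\<^sup>+\<phi>. at_regime n g (d - y / rate i) (\<phi>0 i) e \<phi> \<partial>jumps \<partial>holdings)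
          \<partial>jump_law \<partial>exp_law 1)"
    if g: "\<And>i. (\<lambda>(e, \<phi>). g i e \<phi>) \<in> borel_measurable regime_law" for g
  proof -
    note measurable_at_regime[OF g, where n=n, measurable]
    note measurable_at_regime[OF g, where n="Suc n", measurable]
    have [measurable]: "(\<lambda>(\<phi>0, e, \<phi>). at_regime n g d (\<phi>0 i) e \<phi>) \<in> borel_measurable (jump_law \<Otimes>\<^sub>M regime_law)" for d
      unfolding case_prod_beta
    proof (rule measurable_compose_countable[where g="\<lambda>x. fst x i" and f="\<lambda>j x. at_regime n g d j (fst (snd x)) (snd (snd x))"])
      show "(\<lambda>x. at_regime n g d j (fst (snd x)) (snd (snd x))) \<in> borel_measurable (jump_law \<Otimes>\<^sub>M regime_law)" for j
        using measurable_compose[OF measurable_Pair[OF measurable_const[of d borel] measurable_snd] measurable_at_regime[OF g, where n=n and i=j]]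
        by (simp add: case_prod_beta)
      show "(\<lambda>x. fst x i) \<in> jump_law \<Otimes>\<^sub>M regime_law \<rightarrow>\<^sub>M count_space UNIV"
        by (rule measurable_jump_apply) measurable
    qed
    interpret P: pair_sigma_finite jump_law holdings ..
    have "(\<integral>\<^sup>+e. \<integral>\<^sup>+\<phi>. at_regime (Suc n) g d i e \<phi> \<partial>jumps \<partial>holdings)
       = (\<integral>\<^sup>+y. \<integral>\<^sup>+e. \<integral>\<^sup>+\<phi>. at_regime (Suc n) g d i (y ## e) \<phi> \<partial>jumps \<partial>holdings \<partial>exp_law 1)"
      by (rule E1.nn_integral_stream_space) measurable
    also have "\<dots> = (\<integral>\<^sup>+y. \<integral>\<^sup>+e. \<integral>\<^sup>+\<phi>0. \<integral>\<^sup>+\<phi>. at_regime (Suc n) g d i (y ## e) (\<phi>0 ## \<phi>)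
         \<partial>jumps \<partial>jump_law \<partial>holdings \<partial>exp_law 1)"
      by (intro nn_integral_cong JL.nn_integral_stream_space) measurable
    also have "\<dots> = (\<integral>\<^sup>+y. \<integral>\<^sup>+e. \<integral>\<^sup>+\<phi>0. (if rate i * d \<le> y then 0
         else \<integral>\<^sup>+\<phi>. at_regime n g (d - y / rate i) (\<phi>0 i) e \<phi> \<partial>jumps) \<partial>jump_law \<partial>holdings \<partial>exp_law 1)"
      by (intro nn_integral_cong) simp
    \<comment> \<open>The first jump is moved outside the later clocks, so that the inner integral
      becomes the one of the induction hypothesis with a fixed starting regime.\<close>
    also have "\<dots> = (\<integral>\<^sup>+y. \<integral>\<^sup>+\<phi>0. \<integral>\<^sup>+e. (if rate i * d \<le> y then 0
         else \<integral>\<^sup>+\<phi>. at_regime n g (d - y / rate i) (\<phi>0 i) e \<phi> \<partial>jumps) \<partial>holdings \<partial>jump_law \<partial>exp_law 1)"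
      by (intro nn_integral_cong P.Fubini') measurable
    also have "\<dots> = (\<integral>\<^sup>+y. \<integral>\<^sup>+\<phi>0. (if rate i * d \<le> y then 0
          else \<integral>\<^sup>+e. \<integral>\<^sup>+\<phi>. at_regime n g (d - y / rate i) (\<phi>0 i) e \<phi> \<partial>jumps \<partial>holdings)
          \<partial>jump_law \<partial>exp_law 1)"
      by (intro nn_integral_cong) simp
    finally show ?thesis .
  qed
  show ?case
    unfolding unfold[OF f] unfold[OF f']
  proof (intro nn_integral_cong_AE eventually_mono[OF AE_exp_law_nonneg] eventually_mono[OF AE_jump_law])
    fix y :: real and \<phi>0 :: "nat \<Rightarrow> nat" assume y: "0 \<le> y" and \<phi>0: "\<forall>i\<in>{1..K}. \<phi>0 i \<in> {1..K}"
    show "(if rate i * d \<le> y then 0 else \<integral>\<^sup>+e. \<integral>\<^sup>+\<phi>. at_regime n f (d - y / rate i) (\<phi>0 i) e \<phi> \<partial>jumps \<partial>holdings)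
        = (if rate i * d \<le> y then 0 else \<integral>\<^sup>+e. \<integral>\<^sup>+\<phi>. at_regime n f' (d - y / rate i) (\<phi>0 i) e \<phi> \<partial>jumps \<partial>holdings)"
    proof (cases "rate i * d \<le> y")
      case False
      then have "0 < rate i" using y rate_nonneg[OF Suc.prems(1)] by (cases "rate i = 0") auto
      then have "0 \<le> d - y / rate i" using False by (simp add: field_simps)
      then show ?thesis using False Suc.IH[of "\<phi>0 i"] \<phi>0 Suc.prems(1) by simp
    qed simp
  qed
qed

lemma suminf_at_regime:
  "(\<Sum>n. at_regime n f d i e \<phi>) = (if rate i * d \<le> shd e then f i ((shd e - rate i * d) ## stl e) \<phi>
     else \<Sum>n. at_regime n f (d - shd e / rate i) (shd \<phi> i) (stl e) (stl \<phi>))"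
  using suminf_offset[of "\<lambda>n. at_regime n f d i e \<phi>" 1] by simp

text \<open>Exactly one summand survives, the one for the actual number of jumps before
  \<open>d\<close>, and its restarted path is the original one seen from \<open>d\<close> on. The
  given \<open>n\<close> merely bounds that number and drives the induction.\<close>

lemma suminf_at_regime_path:
  assumes good: "good_regime i e \<phi>" and d: "0 < d" and x: "\<And>k. 0 < x !! k"
    and n: "ereal d \<le> jump_time i e \<phi> (Suc n)"
  shows "(\<Sum>n. at_regime n (\<lambda>j e \<phi>. B j (regime_path j e \<phi> x)) d i e \<phi>)
       = B (regime_left i e \<phi> d) (smap (\<lambda>n. regime_left i e \<phi> (d + arr x (Suc n))) nats)"
  using good d n
proof (induction n arbitrary: d i e \<phi>)
  have "0 \<le> arr x n" for n unfolding arr_def using x by (intro sum_nonneg) (simp add: order_less_imp_le)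
  then have arr: "0 < arr x (Suc n)" for n using x[of n] by (simp add: arr_def add_nonneg_pos)
  have base: "(\<Sum>n. at_regime n (\<lambda>j e \<phi>. B j (regime_path j e \<phi> x)) d i e \<phi>)
       = B (regime_left i e \<phi> d) (smap (\<lambda>n. regime_left i e \<phi> (d + arr x (Suc n))) nats)"
    if good: "good_regime i e \<phi>" and d: "0 < d" and le: "rate i * d \<le> shd e" for i e \<phi> d
  proof -
    let ?e = "(shd e - rate i * d) ## stl e"
    have "regime_left i ?e \<phi> t = regime_left i e \<phi> (d + t)" if t: "0 < t" for t
    proof -
      have A: "rate i * (d + t) \<le> shd e \<longleftrightarrow> rate i * t \<le> shd ?e" unfolding stream.sel distrib_left by linarith
      have B: "\<not> rate i * t \<le> shd ?e \<Longrightarrow> d + t - shd e / rate i = t - shd ?e / rate i"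
        using le good by (cases "rate i = 0") (auto simp: field_simps good_regime_def)
      have dt: "0 < d + t" using d t by simp
      show ?thesis
        unfolding regime_left_first_jump[OF good dt] regime_left_first_jump[OF good_regime_residual[OF good le] t] A
        by (cases "rate i * t \<le> shd ?e") (simp_all only: if_True if_False simp_thms B stream.sel)
    qed
    then have "regime_path i ?e \<phi> x = smap (\<lambda>n. regime_left i e \<phi> (d + arr x (Suc n))) nats"
      unfolding regime_path_def using arr by (intro stream.map_cong refl) simp
    moreover have "regime_left i e \<phi> d = i" using regime_left_first_jump[OF good d] le by simp
    ultimately show ?thesis using le by (subst suminf_at_regime) simp
  qed
  {
    case 0
    have "rate i * d \<le> shd e"
    proof (rule ccontr)
      assume *: "\<not> rate i * d \<le> shd e"
      then have "0 < rate i" using rate_nonneg[of i] 0 by (cases "rate i = 0") (auto simp: good_regime_def)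
      then show False using * 0(3) by (simp add: jump_time_def field_simps)
    qed
    with 0 show ?case by (intro base)
  next
    case (Suc n)
    show ?case
    proof (cases "rate i * d \<le> shd e")
      case False
      then have a: "0 < rate i" using rate_nonneg[of i] Suc.prems by (cases "rate i = 0") (auto simp: good_regime_def)
      have d': "0 < d - shd e / rate i" using False a by (simp add: field_simps)
      have "ereal (d - shd e / rate i) \<le> jump_time (shd \<phi> i) (stl e) (stl \<phi>) (Suc n)"
        using Suc.prems(3) a unfolding jump_time_shift[of i e \<phi> "Suc n"]
        by (cases "jump_time (shd \<phi> i) (stl e) (stl \<phi>) (Suc n)") auto
      note IH = Suc.IH[OF good_regime_stl[OF Suc.prems(1)] d' this]
      have rl: "regime_left i e \<phi> (d + t) = regime_left (shd \<phi> i) (stl e) (stl \<phi>) (d - shd e / rate i + t)" if "0 \<le> t" for t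
      proof -
        have "rate i * d \<le> rate i * (d + t)" using a that by simp
        then show ?thesis
          using regime_left_first_jump[OF Suc.prems(1), of "d + t"] False Suc.prems(2) that
          by (simp add: algebra_simps)
      qed
      show ?thesis
        using IH rl[of 0] rl[OF less_imp_le[OF arr]] False by (subst suminf_at_regime) simp
    qed (use base Suc.prems in blast)
  }
qed

lemma regime_path_SCons:
  "regime_path i e \<phi> (d ## x) = regime_left i e \<phi> d ## smap (\<lambda>n. regime_left i e \<phi> (d + arr x (Suc n))) nats"
proof -
  have "arr (d ## x) (Suc n) = d + arr x n" for n
    unfolding arr_def sum.lessThan_Suc_shift by simp
  then have "regime_path i e \<phi> (d ## x) !! n =
      (regime_left i e \<phi> d ## smap (\<lambda>n. regime_left i e \<phi> (d + arr x (Suc n))) nats) !! n" for n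
    unfolding regime_path_snth by (cases n) (simp_all add: arr_def[of _ 0])
  then have "snth (regime_path i e \<phi> (d ## x)) =
      snth (regime_left i e \<phi> d ## smap (\<lambda>n. regime_left i e \<phi> (d + arr x (Suc n))) nats)"
    by blast
  then show ?thesis by (metis stream_smap_nats)
qed

subsection \<open>Costs along a path\<close>

lemma nn_integral_regime_law:
  "(\<lambda>(e, \<phi>). f e \<phi>) \<in> borel_measurable regime_law \<Longrightarrow>
    (\<integral>\<^sup>+r. f (fst r) (snd r) \<partial>regime_law) = (\<integral>\<^sup>+e. \<integral>\<^sup>+\<phi>. f e \<phi> \<partial>jumps \<partial>holdings)"
  using JS.nn_integral_fst[of "\<lambda>(e, \<phi>). f e \<phi>" holdings] by (simp add: case_prod_unfold)

text \<open>Markov property of the regime at the next arrival. The integrand is expanded over the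
  number of jumps before \<open>d\<close>, every term is averaged by
  \<open>nn_integral_at_regime\<close>, and the expansion is folded back for the averaged functional
  \<open>b\<close>, which depends on the regime alone.\<close>

lemma nn_integral_regime_markov:
  assumes B: "\<And>j. B j \<in> borel_measurable (stream_space (count_space UNIV))"
    and i: "i \<in> {1..K}" and d: "0 < d" and x: "\<And>k. 0 < x !! k"
  shows "(\<integral>\<^sup>+r. B (regime_left i (fst r) (snd r) d) (stl (regime_path i (fst r) (snd r) (d ## x))) \<partial>regime_law)
       = (\<integral>\<^sup>+r. \<integral>\<^sup>+r'. B (regime_left i (fst r) (snd r) d)
           (regime_path (regime_left i (fst r) (snd r) d) (fst r') (snd r') x) \<partial>regime_law \<partial>regime_law)"
proof -
  note B [measurable]
  have x_space [measurable]: "(\<lambda>_. x) \<in> N \<rightarrow>\<^sub>M stream_space borel" for N :: "'b measure"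
    by (rule measurable_const) (simp add: space_stream_space)
  have x_space' [measurable]: "(\<lambda>_. d ## x) \<in> N \<rightarrow>\<^sub>M stream_space borel" for N :: "'b measure"
    by (rule measurable_const) (simp add: space_stream_space)
  define f where "f j e \<phi> = B j (regime_path j e \<phi> x)" for j e \<phi>
  have f: "(\<lambda>(e, \<phi>). f j e \<phi>) \<in> borel_measurable regime_law" for j
    unfolding f_def by measurable
  define b where "b j = (\<integral>\<^sup>+e. \<integral>\<^sup>+\<phi>. f j e \<phi> \<partial>jumps \<partial>holdings)" for j
  have b: "(\<lambda>(e, \<phi>). b j) \<in> borel_measurable regime_law" for j
    by simp
  have meas: "(\<lambda>e. \<integral>\<^sup>+\<phi>. at_regime n g d i e \<phi> \<partial>jumps) \<in> borel_measurable holdings"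
    "(\<lambda>\<phi>. at_regime n g d i e \<phi>) \<in> borel_measurable jumps"
    if g: "\<And>j. (\<lambda>(e, \<phi>). g j e \<phi>) \<in> borel_measurable regime_law" for g n and e :: "real stream"
  proof -
    have [measurable]: "(\<lambda>(e, \<phi>). at_regime n g d i e \<phi>) \<in> borel_measurable regime_law"
      using measurable_compose[OF measurable_Pair[OF measurable_const[of d borel] measurable_ident] measurable_at_regime[OF g, where n=n and i=i]]
      by (simp add: case_prod_beta)
    have [simp]: "e \<in> space holdings" by (simp add: space_stream_space)
    show "(\<lambda>e. \<integral>\<^sup>+\<phi>. at_regime n g d i e \<phi> \<partial>jumps) \<in> borel_measurable holdings"
      by measurable
    show "(\<lambda>\<phi>. at_regime n g d i e \<phi>) \<in> borel_measurable jumps"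
      by measurable
  qed
  have sum: "(\<integral>\<^sup>+e. \<integral>\<^sup>+\<phi>. (\<Sum>n. at_regime n g d i e \<phi>) \<partial>jumps \<partial>holdings)
      = (\<Sum>n. \<integral>\<^sup>+e. \<integral>\<^sup>+\<phi>. at_regime n g d i e \<phi> \<partial>jumps \<partial>holdings)"
    if g: "\<And>j. (\<lambda>(e, \<phi>). g j e \<phi>) \<in> borel_measurable regime_law" for g
    using meas[OF g] by (simp add: nn_integral_suminf)
  have "(\<integral>\<^sup>+r. B (regime_left i (fst r) (snd r) d) (stl (regime_path i (fst r) (snd r) (d ## x))) \<partial>regime_law)
     = (\<integral>\<^sup>+e. \<integral>\<^sup>+\<phi>. B (regime_left i e \<phi> d) (stl (regime_path i e \<phi> (d ## x))) \<partial>jumps \<partial>holdings)"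
  proof (rule nn_integral_regime_law)
    show "(\<lambda>(e, \<phi>). B (regime_left i e \<phi> d) (stl (regime_path i e \<phi> (d ## x)))) \<in> borel_measurable regime_law"
      unfolding case_prod_beta
      by (rule measurable_compose_countable[where g="\<lambda>r. regime_left i (fst r) (snd r) d"
           and f="\<lambda>j r. B j (stl (regime_path i (fst r) (snd r) (d ## x)))"]) measurable
  qed
  also have "\<dots> = (\<integral>\<^sup>+e. \<integral>\<^sup>+\<phi>. (\<Sum>n. at_regime n f d i e \<phi>) \<partial>jumps \<partial>holdings)"
  proof (rule nn_integral_cong_AE, rule eventually_mono[OF AE_good_regime[OF i]],
      rule nn_integral_cong_AE, erule eventually_mono)
    fix e \<phi> assume good: "good_regime i e \<phi>"
    obtain n where "ereal d \<le> jump_time i e \<phi> (Suc n)" using no_explosion[OF good] by blast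
    from suminf_at_regime_path[where x=x and B=B, OF good d x this]
    show "B (regime_left i e \<phi> d) (stl (regime_path i e \<phi> (d ## x))) = (\<Sum>n. at_regime n f d i e \<phi>)"
      unfolding f_def regime_path_SCons by simp
  qed
  also have "\<dots> = (\<integral>\<^sup>+e. \<integral>\<^sup>+\<phi>. (\<Sum>n. at_regime n (\<lambda>j _ _. b j) d i e \<phi>) \<partial>jumps \<partial>holdings)"
    unfolding sum[OF f] sum[of "\<lambda>j _ _. b j", OF b]
    unfolding b_def using f i d by (intro suminf_cong nn_integral_at_regime) auto
  also have "\<dots> = (\<integral>\<^sup>+e. \<integral>\<^sup>+\<phi>. b (regime_left i e \<phi> d) \<partial>jumps \<partial>holdings)"
  proof (rule nn_integral_cong_AE, rule eventually_mono[OF AE_good_regime[OF i]],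
      rule nn_integral_cong_AE, erule eventually_mono)
    fix e \<phi> assume good: "good_regime i e \<phi>"
    obtain n where "ereal d \<le> jump_time i e \<phi> (Suc n)" using no_explosion[OF good] by blast
    from suminf_at_regime_path[where x=x and B="\<lambda>j _. b j", OF good d x this]
    show "(\<Sum>n. at_regime n (\<lambda>j _ _. b j) d i e \<phi>) = b (regime_left i e \<phi> d)" by simp
  qed
  also have "\<dots> = (\<integral>\<^sup>+r. b (regime_left i (fst r) (snd r) d) \<partial>regime_law)"
    by (rule nn_integral_regime_law[symmetric]) measurable
  also have "\<dots> = (\<integral>\<^sup>+r. \<integral>\<^sup>+r'. f (regime_left i (fst r) (snd r) d) (fst r') (snd r') \<partial>regime_law \<partial>regime_law)"
    unfolding b_def nn_integral_regime_law[OF f, symmetric] ..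
  finally show ?thesis unfolding f_def .
qed

section \<open>The laws of scores, arrivals and service times\<close>

lemma f_S_nonneg: "s \<in> {0..1} \<Longrightarrow> 0 \<le> f_S s"
proof -
  assume "s \<in> {0..1}"
  \<comment> \<open>Positivity is given on the open interval only; at the end points the density is
    a limit of positive values.\<close>
  then have s: "s \<in> closure {0<..<1}" by simp
  have cont: "continuous_on (closure {0<..<1}) f_S" using f_S_cont by simp
  have "0 \<le> f_S t" if "t \<in> {0<..<1}" for t using f_S_pos[OF that] by simp
  then show ?thesis by (rule continuous_ge_on_closure[OF cont s])
qed

lemma measurable_f_S [measurable]: "f_S \<in> borel_measurable (restrict_space borel {0..1})"
  by (rule borel_measurable_continuous_on_restrict[OF f_S_cont])

lemma sets_score_law: "sets score_law = sets (restrict_space borel {0..1})"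
  by (simp add: score_law_def sets_restrict_space)

lemma space_score_law [simp]: "space score_law = {0..1}"
  by (simp add: score_law_def space_restrict_space)

sublocale SL: prob_space score_law
proof
  have "emeasure score_law (space score_law) = (\<integral>\<^sup>+s. ennreal (f_S s) \<partial>restrict_space lborel {0..1})"
    unfolding score_law_def
    by (subst emeasure_density) (auto simp: space_restrict_space sets_restrict_space measurable_f_S
        intro!: nn_integral_cong measurable_f_S[unfolded measurable_cong_sets[OF sets_restrict_space_cong[OF sets_lborel[symmetric]] refl]])
  also have "\<dots> = (\<integral>\<^sup>+s. ennreal (f_S s) * indicator {0..1} s \<partial>lborel)"
    by (subst nn_integral_restrict_space) auto
  also have "\<dots> = 1"
    using nn_integral_has_integral_lebesgue[OF f_S_nonneg f_S_density]
    by (simp add: nn_integral_completion ennreal_mult'' ennreal_indicator[symmetric] mult.commute)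
  finally show "emeasure score_law (space score_law) = 1" .
qed

abbreviation "scores \<equiv> stream_space score_law"
abbreviation "arrivals \<equiv> stream_space (exp_law lam)"
abbreviation "services \<equiv> stream_space (exp_law mu)"

sublocale SS: prob_space scores by (rule SL.prob_space_stream_space)
sublocale XL: prob_space "exp_law lam" using lam_pos by (rule prob_space_exp_law)
sublocale XS: prob_space arrivals by (rule XL.prob_space_stream_space)
sublocale VL: prob_space "exp_law mu" using mu_pos by (rule prob_space_exp_law)
sublocale VS: prob_space services by (rule VL.prob_space_stream_space)

text \<open>The interval is open at 0 and closed at \<open>d\<close> because, with left limits, one
  content governs the queue length from just after an arrival up to and including the next arrival
  time.\<close>

definition holding_cost :: "real \<Rightarrow> real list \<Rightarrow> ennreal" where
  "holding_cost d w = (\<integral>\<^sup>+t. (if 0 < t \<and> t \<le> d then ennreal (exp (- alpha * t) * h (length (serve m t w))) else 0) \<partial>lborel)"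

lemma measurable_holding_cost [measurable (raw)]:
  assumes [measurable]: "f \<in> borel_measurable N" "g \<in> N \<rightarrow>\<^sub>M list_space"
  shows "(\<lambda>x. holding_cost (f x) (g x)) \<in> borel_measurable N"
  unfolding holding_cost_def by measurable

text \<open>The cost up to the \<open>n\<close>-th arrival, where \<open>\<rho>\<close> lists the regimes found by the arrivals.\<close>

primrec cost_upto :: "(nat \<Rightarrow> nat \<Rightarrow> real \<Rightarrow> bool) \<Rightarrow> (real \<Rightarrow> nat \<Rightarrow> real) \<Rightarrow> nat \<Rightarrow>
    real list \<Rightarrow> nat stream \<Rightarrow> real stream \<Rightarrow> real stream \<Rightarrow> real stream \<Rightarrow> ennreal" where
  "cost_upto u c 0 w \<rho> x s v = 0"
| "cost_upto u c (Suc n) w \<rho> x s v = holding_cost (shd x) w + ennreal (exp (- alpha * shd x)) *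
    (if u (length (serve m (shd x) w)) (shd \<rho>) (shd s)
     then ennreal c_h + cost_upto u c n (serve m (shd x) w @ [shd v]) (stl \<rho>) (stl x) (stl s) (stl v)
     else ennreal (c (shd s) (shd \<rho>)) + cost_upto u c n (serve m (shd x) w) (stl \<rho>) (stl x) (stl s) (stl v))"

text \<open>A form of \<open>content\<close> that can be restarted after an arrival: the initial
  content, the regimes met and the service times of the arrivals are arguments of their own.\<close>

primrec content_from :: "(nat \<Rightarrow> nat \<Rightarrow> real \<Rightarrow> bool) \<Rightarrow> real list \<Rightarrow> nat stream \<Rightarrow>
    real stream \<Rightarrow> real stream \<Rightarrow> real stream \<Rightarrow> nat \<Rightarrow> real list" where
  "content_from u w \<rho> x s v 0 = w"
| "content_from u w \<rho> x s v (Suc n) =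
    (let w' = serve m (x !! n) (content_from u w \<rho> x s v n) in
       if u (length w') (\<rho> !! n) (s !! n) then w' @ [v !! n] else w')"

text \<open>\<open>content_from\<close> recurses at the last arrival while \<open>cost_upto\<close>
  unfolds at the first one; this shift reconciles the two and turns \<open>cost_upto\<close> into a
  discounted sum.\<close>

lemma content_from_shift:
  "content_from u w \<rho> x s v (Suc n) =
     content_from u (content_from u w \<rho> x s v 1) (stl \<rho>) (stl x) (stl s) (stl v) n"
proof (induction n)
  case (Suc n)
  have "content_from u w \<rho> x s v (Suc (Suc n)) = (let w' = serve m (x !! Suc n) (content_from u w \<rho> x s v (Suc n)) in
       if u (length w') (\<rho> !! Suc n) (s !! Suc n) then w' @ [v !! Suc n] else w')"
    by (rule content_from.simps(2))
  then show ?case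
    unfolding Suc snth.simps by (simp only: content_from.simps(2)[of _ _ _ _ _ _ n])
qed simp

lemma content_eq_content_from:
  "content u q rg x s v n = content_from u (stake q v) (smap (\<lambda>n. rg (arr x (Suc n))) nats) x s (sdrop q v) n"
  by (induction n) (simp_all add: sdrop_snth Let_def)

lemma cost_upto_eq_sum:
  "cost_upto u c n w \<rho> x s v = (\<Sum>k<n. ennreal (exp (- alpha * arr x k)) *
     (let w' = content_from u w \<rho> x s v k in holding_cost (x !! k) w' + ennreal (exp (- alpha * x !! k)) *
       ennreal (if u (length (serve m (x !! k) w')) (\<rho> !! k) (s !! k) then c_h else c (s !! k) (\<rho> !! k))))"
proof (induction n arbitrary: w \<rho> x s v)
  case (Suc n)
  let ?w = "content_from u w \<rho> x s v 1"
  let ?f = "\<lambda>w \<rho> x s v k. ennreal (exp (- alpha * arr x k)) *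
     (let w' = content_from u w \<rho> x s v k in holding_cost (x !! k) w' + ennreal (exp (- alpha * x !! k)) *
       ennreal (if u (length (serve m (x !! k) w')) (\<rho> !! k) (s !! k) then c_h else c (s !! k) (\<rho> !! k)))"
  have arr: "arr x (Suc k) = shd x + arr (stl x) k" for k
    unfolding arr_def sum.lessThan_Suc_shift by simp
  have "exp (- alpha * arr x (Suc k)) = exp (- alpha * shd x) * exp (- alpha * arr (stl x) k)" for k
    unfolding arr by (simp add: mult_exp_exp algebra_simps)
  then have "?f w \<rho> x s v (Suc k) = ennreal (exp (- alpha * shd x)) * ?f ?w (stl \<rho>) (stl x) (stl s) (stl v) k" for k
    unfolding content_from_shift[of u w \<rho> x s v k] snth.simps Let_def by (simp add: ennreal_mult' mult.assoc del: content_from.simps)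
  then have "(\<Sum>k<Suc n. ?f w \<rho> x s v k) = ?f w \<rho> x s v 0 + ennreal (exp (- alpha * shd x)) * cost_upto u c n ?w (stl \<rho>) (stl x) (stl s) (stl v)"
    unfolding Suc sum.lessThan_Suc_shift sum_distrib_left by simp
  also have "\<dots> = cost_upto u c (Suc n) w \<rho> x s v"
    by (simp add: arr_def Let_def distrib_left add.assoc)
  finally show ?case ..
qed simp

text \<open>When interarrival times are positive and arrival times unbounded, the intervals between
  consecutive arrivals, open on the left and closed on the right, partition the positive half line.
  The time integral becomes a series over arrivals, which is merged with the series of decision
  costs; partial sums are the costs up to the \<open>n\<close>-th arrival.\<close>

lemma path_cost_eq_SUP:
  assumes pos: "\<And>k. 0 < x !! k" and unb: "\<And>B. \<exists>n. B \<le> arr x n"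
  shows "path_cost u q rg x s v =
    (SUP n. cost_upto u c_auto n (stake q v) (smap (\<lambda>n. rg (arr x (Suc n))) nats) x s (sdrop q v))"
proof -
  let ?\<rho> = "smap (\<lambda>n. rg (arr x (Suc n))) nats"
  define w where "w n = content_from u (stake q v) ?\<rho> x s (sdrop q v) n" for n
  have w: "content u q rg x s v n = w n" for n unfolding w_def by (rule content_eq_content_from)
  have arr_Suc: "arr x (Suc n) = arr x n + x !! n" for n by (simp add: arr_def)
  have mono: "arr x a \<le> arr x b" if "a \<le> b" for a b
    by (rule lift_Suc_mono_le[OF _ that]) (use arr_Suc pos in \<open>simp add: less_imp_le\<close>)
  have arr0: "arr x 0 = 0" by (simp add: arr_def)
  have least: "(LEAST n. t \<le> arr x (Suc n)) = n" if "arr x n < t" "t \<le> arr x (Suc n)" for t n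
  proof (rule Least_equality)
    fix k assume "t \<le> arr x (Suc k)"
    then have "arr x n < arr x (Suc k)" using that by simp
    then show "n \<le> k" using mono[of "Suc k" n] by (meson not_le not_less_eq_eq)
  qed (fact that(2))
  have queue: "queue_left u q rg x s v t = length (serve m (t - arr x n) (w n))"
    if "arr x n < t" "t \<le> arr x (Suc n)" for t n
    unfolding queue_left_def least[OF that] Let_def w ..
  let ?act = "\<lambda>n. ennreal (if u (length (serve m (x !! n) (w n))) (?\<rho> !! n) (s !! n) then c_h else c_auto (s !! n) (?\<rho> !! n))"
  have queue_arr: "queue_left u q rg x s v (arr x (Suc n)) = length (serve m (x !! n) (w n))" for n
    using queue[of n "arr x (Suc n)"] arr_Suc[of n] pos[of n] by simp
  let ?f = "\<lambda>n t. if arr x n < t \<and> t \<le> arr x (Suc n) then ennreal (exp (- alpha * t) * h (length (serve m (t - arr x n) (w n)))) else 0"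
  have "(\<integral>\<^sup>+t\<in>{0..}. ennreal (exp (- alpha * t) * h (queue_left u q rg x s v t)) \<partial>lborel)
     = (\<integral>\<^sup>+t. (\<Sum>n. ?f n t) \<partial>lborel)"
  \<comment> \<open>Time 0 belongs to none of the intervals between arrivals, but is a null
    set.\<close>
  proof (rule nn_integral_cong_AE, rule eventually_mono[OF AE_lborel_singleton[of 0]])
    fix t :: real assume t0: "t \<noteq> 0"
    show "ennreal (exp (- alpha * t) * h (queue_left u q rg x s v t)) * indicator {0..} t
       = (\<Sum>n. ?f n t)"
    proof (cases "0 < t")
      case False
      have "0 \<le> arr x n" for n using mono[of 0 n] arr0 by simp
      then have "\<not> arr x n < t" for n using False by (meson le_less_trans)
      then show ?thesis using False t0 by simp
    next
      case True
      obtain n where n: "arr x n < t" "t \<le> arr x (Suc n)"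
      proof -
        define N where "N = (LEAST n. t \<le> arr x n)"
        have N: "t \<le> arr x N" unfolding N_def using unb[of t] by (rule LeastI_ex)
        then have "N \<noteq> 0" using arr0 True by (cases N) auto
        then obtain n where "N = Suc n" by (cases N) auto
        moreover from this have "\<not> t \<le> arr x n" unfolding N_def by (intro not_less_Least) simp
        ultimately show ?thesis using that[of n] N by (simp add: not_le)
      qed
      have "(\<Sum>k. ?f k t)
        = (\<Sum>k\<in>{n}. ?f k t)"
        using least n by (intro suminf_finite) auto
      then show ?thesis using n queue[OF n] True by simp
    qed
  qed
  also have "\<dots> = (\<Sum>n. \<integral>\<^sup>+t. ?f n t \<partial>lborel)"
    by (rule nn_integral_suminf) measurable
  also have "\<dots> = (\<Sum>n. ennreal (exp (- alpha * arr x n)) * holding_cost (x !! n) (w n))"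
  proof (rule suminf_cong)
    fix n
    have "(\<integral>\<^sup>+t. ?f n t \<partial>lborel)
      = (\<integral>\<^sup>+t. (if 0 < t \<and> t \<le> x !! n then ennreal (exp (- alpha * (arr x n + t)) * h (length (serve m t (w n)))) else 0) \<partial>lborel)"
      by (subst nn_integral_real_affine[where c=1 and t="arr x n"]) (auto simp: arr_Suc intro!: nn_integral_cong)
    also have "\<dots> = (\<integral>\<^sup>+t. ennreal (exp (- alpha * arr x n)) *
        (if 0 < t \<and> t \<le> x !! n then ennreal (exp (- alpha * t) * h (length (serve m t (w n)))) else 0) \<partial>lborel)"
    proof (intro nn_integral_cong)
      fix t
      have "exp (- alpha * (arr x n + t)) = exp (- alpha * arr x n) * exp (- alpha * t)"
        by (simp add: mult_exp_exp algebra_simps)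
      then show "(if 0 < t \<and> t \<le> x !! n then ennreal (exp (- alpha * (arr x n + t)) * h (length (serve m t (w n)))) else 0)
        = ennreal (exp (- alpha * arr x n)) * (if 0 < t \<and> t \<le> x !! n then ennreal (exp (- alpha * t) * h (length (serve m t (w n)))) else 0)"
        by (simp add: ennreal_mult' mult.assoc)
    qed
    also have "\<dots> = ennreal (exp (- alpha * arr x n)) * holding_cost (x !! n) (w n)"
      unfolding holding_cost_def by (rule nn_integral_cmult) measurable
    finally show "(\<integral>\<^sup>+t. ?f n t \<partial>lborel)
       = ennreal (exp (- alpha * arr x n)) * holding_cost (x !! n) (w n)" .
  qed
  finally have 1: "(\<integral>\<^sup>+t\<in>{0..}. ennreal (exp (- alpha * t) * h (queue_left u q rg x s v t)) \<partial>lborel)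
     = (\<Sum>n. ennreal (exp (- alpha * arr x n)) * holding_cost (x !! n) (w n))" .
  have 2: "ennreal (exp (- alpha * arr x (Suc n)) * (if u (queue_left u q rg x s v (arr x (Suc n))) (rg (arr x (Suc n))) (s !! n)
      then c_h else c_auto (s !! n) (rg (arr x (Suc n)))))
      = ennreal (exp (- alpha * arr x n)) * (ennreal (exp (- alpha * x !! n)) * ?act n)" for n
  proof -
    have "exp (- alpha * arr x (Suc n)) = exp (- alpha * arr x n) * exp (- alpha * x !! n)"
      unfolding arr_Suc by (simp add: mult_exp_exp algebra_simps)
    then show ?thesis unfolding queue_arr by (simp add: ennreal_mult' mult.assoc)
  qed
  have "path_cost u q rg x s v = (\<Sum>n. ennreal (exp (- alpha * arr x n)) * holding_cost (x !! n) (w n))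
     + (\<Sum>n. ennreal (exp (- alpha * arr x n)) * (ennreal (exp (- alpha * x !! n)) * ?act n))"
    unfolding path_cost_def Let_def 1 2 ..
  also have "\<dots> = (\<Sum>n. ennreal (exp (- alpha * arr x n)) * (holding_cost (x !! n) (w n) + ennreal (exp (- alpha * x !! n)) * ?act n))"
    by (subst suminf_add) (auto simp: distrib_left)
  also have "\<dots> = (SUP n. \<Sum>k<n. ennreal (exp (- alpha * arr x k)) * (holding_cost (x !! k) (w k) + ennreal (exp (- alpha * x !! k)) * ?act k))"
    by (rule suminf_eq_SUP)
  also have "\<dots> = (SUP n. cost_upto u c_auto n (stake q v) ?\<rho> x s (sdrop q v))"
    unfolding cost_upto_eq_sum Let_def w_def ..
  finally show ?thesis .
qed

end

subsection \<open>Expected costs\<close>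

lemma measurable_compose3:
  assumes F: "(\<lambda>(x, y, z). F x y z) \<in> A \<Otimes>\<^sub>M B \<Otimes>\<^sub>M C \<rightarrow>\<^sub>M D"
    and "f \<in> N \<rightarrow>\<^sub>M A" "g \<in> N \<rightarrow>\<^sub>M B" "k \<in> N \<rightarrow>\<^sub>M C"
  shows "(\<lambda>y. F (f y) (g y) (k y)) \<in> N \<rightarrow>\<^sub>M D"
  using measurable_compose[OF measurable_Pair[OF assms(2) measurable_Pair[OF assms(3,4)]] F] by simp

lemma (in prob_space) nn_integral_affine:
  assumes [measurable]: "f \<in> borel_measurable M"
  shows "(\<integral>\<^sup>+x. a + b * f x \<partial>M) = a + b * (\<integral>\<^sup>+x. f x \<partial>M)"
  by (simp add: nn_integral_add nn_integral_cmult emeasure_space_1)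

lemma space_stream_space_borel [simp]: "space (stream_space borel) = UNIV"
  by (simp add: space_stream_space)

declare stream_space_Stream [simp]

context hybrid_control
begin

text \<open>The same measurable sets as \<open>noise\<close>, with \<open>borel\<close> in place of
  the exponential laws; measurability is stated over it independently of the rates.\<close>

abbreviation "noise_algebra \<equiv> stream_space (borel :: real measure) \<Otimes>\<^sub>M scores \<Otimes>\<^sub>M stream_space (borel :: real measure)"
abbreviation "noise \<equiv> arrivals \<Otimes>\<^sub>M scores \<Otimes>\<^sub>M services"

sublocale SV: pair_prob_space scores services ..
sublocale XSV: pair_prob_space arrivals "scores \<Otimes>\<^sub>M services" ..

lemma nn_integral_noise:
  assumes F: "(\<lambda>(x, s, v). F x s v) \<in> borel_measurable noise_algebra"
  shows "(\<integral>\<^sup>+z. F (fst z) (fst (snd z)) (snd (snd z)) \<partial>noise)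
       = (\<integral>\<^sup>+x. \<integral>\<^sup>+s. \<integral>\<^sup>+v. F x s v \<partial>services \<partial>scores \<partial>arrivals)"
proof -
  note measurable_compose3[OF F, measurable (raw)]
  have "(\<integral>\<^sup>+z. F (fst z) (fst (snd z)) (snd (snd z)) \<partial>noise)
      = (\<integral>\<^sup>+x. \<integral>\<^sup>+y. F x (fst y) (snd y) \<partial>(scores \<Otimes>\<^sub>M services) \<partial>arrivals)"
    using SV.nn_integral_fst[of "\<lambda>z. F (fst z) (fst (snd z)) (snd (snd z))" arrivals, symmetric]
    by simp
  also have "\<dots> = (\<integral>\<^sup>+x. \<integral>\<^sup>+s. \<integral>\<^sup>+v. F x s v \<partial>services \<partial>scores \<partial>arrivals)"
  proof (rule nn_integral_cong)
    fix x :: "real stream"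
    have "(\<lambda>y. F x (fst y) (snd y)) \<in> borel_measurable (scores \<Otimes>\<^sub>M services)"
      by measurable
    from VS.nn_integral_fst[OF this]
    show "(\<integral>\<^sup>+y. F x (fst y) (snd y) \<partial>(scores \<Otimes>\<^sub>M services))
      = (\<integral>\<^sup>+s. \<integral>\<^sup>+v. F x s v \<partial>services \<partial>scores)"
      by simp
  qed
  finally show ?thesis .
qed

text \<open>The first entries of all three streams are collected in front, leaving an integral over
  fresh streams; this is the renewal of the exogenous input at the first arrival.\<close>

lemma nn_integral_noise_SCons:
  assumes F: "(\<lambda>(x, s, v). F x s v) \<in> borel_measurable noise_algebra"
  shows "(\<integral>\<^sup>+z. F (fst z) (fst (snd z)) (snd (snd z)) \<partial>noise)
    = (\<integral>\<^sup>+x0. \<integral>\<^sup>+s0. \<integral>\<^sup>+v0. \<integral>\<^sup>+z. F (x0 ## fst z) (s0 ## fst (snd z)) (v0 ## snd (snd z))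
        \<partial>noise \<partial>exp_law mu \<partial>score_law \<partial>exp_law lam)"
proof -
  note measurable_compose3[OF F, measurable (raw)]
  interpret XsL: pair_sigma_finite arrivals score_law ..
  interpret XsM: pair_sigma_finite arrivals "exp_law mu" ..
  interpret SsM: pair_sigma_finite scores "exp_law mu" ..
  have "(\<integral>\<^sup>+z. F (fst z) (fst (snd z)) (snd (snd z)) \<partial>noise) = (\<integral>\<^sup>+x. \<integral>\<^sup>+s. \<integral>\<^sup>+v. F x s v \<partial>services \<partial>scores \<partial>arrivals)"
    by (rule nn_integral_noise[OF F])
  also have "\<dots> = (\<integral>\<^sup>+x0. \<integral>\<^sup>+x. \<integral>\<^sup>+s. \<integral>\<^sup>+v. F (x0 ## x) s v \<partial>services \<partial>scores \<partial>arrivals \<partial>exp_law lam)"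
    by (rule XL.nn_integral_stream_space) measurable
  also have "\<dots> = (\<integral>\<^sup>+x0. \<integral>\<^sup>+x. \<integral>\<^sup>+s0. \<integral>\<^sup>+s. \<integral>\<^sup>+v. F (x0 ## x) (s0 ## s) v \<partial>services \<partial>scores \<partial>score_law \<partial>arrivals \<partial>exp_law lam)"
    by (intro nn_integral_cong SL.nn_integral_stream_space) measurable
  also have "\<dots> = (\<integral>\<^sup>+x0. \<integral>\<^sup>+x. \<integral>\<^sup>+s0. \<integral>\<^sup>+s. \<integral>\<^sup>+v0. \<integral>\<^sup>+v. F (x0 ## x) (s0 ## s) (v0 ## v) \<partial>services \<partial>exp_law mu \<partial>scores \<partial>score_law \<partial>arrivals \<partial>exp_law lam)"
    by (intro nn_integral_cong VL.nn_integral_stream_space) measurable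
  also have "\<dots> = (\<integral>\<^sup>+x0. \<integral>\<^sup>+x. \<integral>\<^sup>+s0. \<integral>\<^sup>+v0. \<integral>\<^sup>+s. \<integral>\<^sup>+v. F (x0 ## x) (s0 ## s) (v0 ## v) \<partial>services \<partial>scores \<partial>exp_law mu \<partial>score_law \<partial>arrivals \<partial>exp_law lam)"
    by (intro nn_integral_cong SsM.Fubini'[symmetric]) measurable
  also have "\<dots> = (\<integral>\<^sup>+x0. \<integral>\<^sup>+s0. \<integral>\<^sup>+x. \<integral>\<^sup>+v0. \<integral>\<^sup>+s. \<integral>\<^sup>+v. F (x0 ## x) (s0 ## s) (v0 ## v) \<partial>services \<partial>scores \<partial>exp_law mu \<partial>arrivals \<partial>score_law \<partial>exp_law lam)"
    by (intro nn_integral_cong XsL.Fubini'[symmetric]) measurable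
  also have "\<dots> = (\<integral>\<^sup>+x0. \<integral>\<^sup>+s0. \<integral>\<^sup>+v0. \<integral>\<^sup>+x. \<integral>\<^sup>+s. \<integral>\<^sup>+v. F (x0 ## x) (s0 ## s) (v0 ## v) \<partial>services \<partial>scores \<partial>arrivals \<partial>exp_law mu \<partial>score_law \<partial>exp_law lam)"
    by (intro nn_integral_cong XsM.Fubini'[symmetric]) measurable
  also have "\<dots> = (\<integral>\<^sup>+x0. \<integral>\<^sup>+s0. \<integral>\<^sup>+v0. \<integral>\<^sup>+z. F (x0 ## fst z) (s0 ## fst (snd z)) (v0 ## snd (snd z))
        \<partial>noise \<partial>exp_law mu \<partial>score_law \<partial>exp_law lam)"
    by (intro nn_integral_cong nn_integral_noise[symmetric]) measurable
  finally show ?thesis .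
qed

lemma AE_noise_pos: "AE z in noise. \<forall>k. 0 < fst z !! k"
proof -
  have "AE x in arrivals. stream_all (\<lambda>x. 0 < x) x"
    by (rule XL.AE_stream_all) (use AE_exp_law_pos in auto)
  then have "AE x in arrivals. AE y in scores \<Otimes>\<^sub>M services. \<forall>k. 0 < fst (x, y) !! k"
    by eventually_elim (simp add: stream_all_def)
  moreover have "Measurable.pred noise (\<lambda>z. \<forall>k. 0 < fst z !! k)" by measurable
  ultimately show ?thesis by (intro XSV.AE_pair_measure) (auto simp: pred_def)
qed

end

text \<open>Measurability is asked for every natural number \<open>j\<close>, so that regimes can be
  treated as arbitrary measurable maps into the naturals. The cost is a separate parameter
  \<open>c\<close> in order that \<open>c_auto\<close> can be replaced by an extension beyond the
  regimes \<open>{1..K}\<close>.\<close>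

locale measurable_policy = hybrid_control +
  fixes u :: "nat \<Rightarrow> nat \<Rightarrow> real \<Rightarrow> bool" and c :: "real \<Rightarrow> nat \<Rightarrow> real"
  assumes u_measurable: "\<And>q j. Measurable.pred score_law (u q j)"
    and c_measurable: "\<And>j. (\<lambda>s. c s j) \<in> borel_measurable score_law"
begin

lemma measurable_action [measurable (raw)]:
  assumes q: "q \<in> N \<rightarrow>\<^sub>M count_space UNIV" and j: "j \<in> N \<rightarrow>\<^sub>M count_space UNIV" and s: "s \<in> N \<rightarrow>\<^sub>M score_law"
  shows "Measurable.pred N (\<lambda>x. u (q x) (j x) (s x))"
proof -
  have "Measurable.pred N (\<lambda>x. u q' j' (s x))" for q' j'
    by (rule measurable_compose[OF s u_measurable])
  then have "Measurable.pred N (\<lambda>x. u q' (j x) (s x))" for q'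
    by (rule measurable_compose_countable[where g=j and f="\<lambda>j' x. u q' j' (s x)"]) (rule j)
  then show ?thesis
    by (rule measurable_compose_countable[where g=q and f="\<lambda>q' x. u q' (j x) (s x)"]) (rule q)
qed

lemma measurable_auto_cost [measurable (raw)]:
  assumes j: "j \<in> N \<rightarrow>\<^sub>M count_space UNIV" and s: "s \<in> N \<rightarrow>\<^sub>M score_law"
  shows "(\<lambda>x. c (s x) (j x)) \<in> borel_measurable N"
proof -
  have "(\<lambda>x. c (s x) j') \<in> borel_measurable N" for j'
    by (rule measurable_compose[OF s c_measurable])
  then show ?thesis
    by (rule measurable_compose_countable[where g=j and f="\<lambda>j' x. c (s x) j'"]) (rule j)
qed

lemma measurable_cost_upto [measurable (raw)]:
  assumes "w \<in> N \<rightarrow>\<^sub>M list_space" "\<rho> \<in> N \<rightarrow>\<^sub>M stream_space (count_space UNIV)" "x \<in> N \<rightarrow>\<^sub>M stream_space borel"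
    "s \<in> N \<rightarrow>\<^sub>M scores" "v \<in> N \<rightarrow>\<^sub>M stream_space borel"
  shows "(\<lambda>y. cost_upto u c n (w y) (\<rho> y) (x y) (s y) (v y)) \<in> borel_measurable N"
  using assms
proof (induction n arbitrary: w \<rho> x s v)
  case (Suc n)
  note Suc.prems [measurable]
  have [measurable]: "Measurable.pred N (\<lambda>y. u (length (serve m (shd (x y)) (w y))) (shd (\<rho> y)) (shd (s y)))"
    by (rule measurable_action) measurable
  have [measurable]: "(\<lambda>y. c (shd (s y)) (shd (\<rho> y))) \<in> borel_measurable N"
    by (rule measurable_auto_cost) measurable
  have [measurable]: "(\<lambda>y. cost_upto u c n (serve m (shd (x y)) (w y) @ [shd (v y)]) (stl (\<rho> y)) (stl (x y)) (stl (s y)) (stl (v y))) \<in> borel_measurable N"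
    "(\<lambda>y. cost_upto u c n (serve m (shd (x y)) (w y)) (stl (\<rho> y)) (stl (x y)) (stl (s y)) (stl (v y))) \<in> borel_measurable N"
    by (rule Suc.IH; measurable)+
  show ?case unfolding cost_upto.simps by measurable
qed simp

definition cost_from :: "nat \<Rightarrow> real list \<Rightarrow> nat \<Rightarrow> ennreal" where
  "cost_from n w i = (\<integral>\<^sup>+z. \<integral>\<^sup>+r. cost_upto u c n w (regime_path i (fst r) (snd r) (fst z)) (fst z) (fst (snd z)) (snd (snd z))
     \<partial>regime_law \<partial>noise)"

lemma measurable_cost_from [measurable]: "(\<lambda>w. cost_from n w i) \<in> borel_measurable list_space"
  unfolding cost_from_def by measurable

definition expected_cost :: "nat \<Rightarrow> nat \<Rightarrow> nat \<Rightarrow> ennreal" where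
  "expected_cost n q i = (\<integral>\<^sup>+w. cost_from n w i \<partial>exp_list mu q)"

definition decision_cost_from :: "nat \<Rightarrow> real list \<Rightarrow> nat \<Rightarrow> ennreal" where
  "decision_cost_from n w j = (\<integral>\<^sup>+s. (if u (length w) j s then ennreal c_h + (\<integral>\<^sup>+v. cost_from n (w @ [v]) j \<partial>exp_law mu)
      else ennreal (c s j) + cost_from n w j) \<partial>score_law)"

text \<open>One step of the recursion with the remaining service times still explicit. Only the
  regime is restarted here, by its Markov property at the first arrival; the content is averaged
  afterwards, in \<open>expected_cost_Suc\<close>.\<close>

lemma cost_from_Suc:
  assumes i: "i \<in> {1..K}"
  shows "cost_from (Suc n) w i = (\<integral>\<^sup>+x. holding_cost x w + ennreal (exp (- alpha * x)) *
     (\<integral>\<^sup>+r. decision_cost_from n (serve m x w) (regime_left i (fst r) (snd r) x) \<partial>regime_law) \<partial>exp_law lam)"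
proof -
  have w [measurable]: "(\<lambda>_. w) \<in> N \<rightarrow>\<^sub>M list_space" for N :: "'b measure" by simp
  \<comment> \<open>\<open>A\<close> is the cost from the first arrival on, discounted to that
    arrival, when it finds content \<open>w'\<close> and regime \<open>j\<close>; \<open>G\<close>
    below averages it over a fresh regime path started at \<open>j\<close>.\<close>
  define A where "A w' j s0 v0 \<rho> x s v = (if u (length w') j s0 then ennreal c_h + cost_upto u c n (w' @ [v0]) \<rho> x s v
      else ennreal (c s0 j) + cost_upto u c n w' \<rho> x s v)" for w' j s0 v0 \<rho> x s v
  have A_meas [measurable (raw)]: "(\<lambda>y. A w' j (s0 y) (v0 y) (\<rho> y) (x y) (s y) (v y)) \<in> borel_measurable N"
    if [measurable]: "s0 \<in> N \<rightarrow>\<^sub>M score_law" "v0 \<in> borel_measurable N" "\<rho> \<in> N \<rightarrow>\<^sub>M stream_space (count_space UNIV)"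
      "x \<in> N \<rightarrow>\<^sub>M stream_space borel" "s \<in> N \<rightarrow>\<^sub>M scores" "v \<in> N \<rightarrow>\<^sub>M stream_space borel"
    for w' j s0 v0 \<rho> x s v and N :: "'b measure"
    unfolding A_def by measurable
  define G where "G w' j s0 v0 z = (\<integral>\<^sup>+r. A w' j s0 v0 (regime_path j (fst r) (snd r) (fst z)) (fst z) (fst (snd z)) (snd (snd z)) \<partial>regime_law)"
    for w' j s0 v0 z
  have G_meas [measurable (raw)]: "(\<lambda>y. G w' j (s0 y) (v0 y) (z y)) \<in> borel_measurable N"
    if [measurable]: "s0 \<in> N \<rightarrow>\<^sub>M score_law" "v0 \<in> borel_measurable N" "z \<in> N \<rightarrow>\<^sub>M noise_algebra"
    for w' j s0 v0 z and N :: "'b measure"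
    unfolding G_def by measurable
  have decision: "(\<integral>\<^sup>+s0. \<integral>\<^sup>+v0. \<integral>\<^sup>+z. G w' j s0 v0 z \<partial>noise \<partial>exp_law mu \<partial>score_law) = decision_cost_from n w' j" for w' j
  proof -
    have "(\<integral>\<^sup>+v0. \<integral>\<^sup>+z. G w' j s0 v0 z \<partial>noise \<partial>exp_law mu)
       = (if u (length w') j s0 then ennreal c_h + (\<integral>\<^sup>+v. cost_from n (w' @ [v]) j \<partial>exp_law mu)
          else ennreal (c s0 j) + cost_from n w' j)" for s0
    proof -
      have G: "G w' j s0 v0 z = (if u (length w') j s0
         then ennreal c_h + (\<integral>\<^sup>+r. cost_upto u c n (w' @ [v0]) (regime_path j (fst r) (snd r) (fst z)) (fst z) (fst (snd z)) (snd (snd z)) \<partial>regime_law)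
         else ennreal (c s0 j) + (\<integral>\<^sup>+r. cost_upto u c n w' (regime_path j (fst r) (snd r) (fst z)) (fst z) (fst (snd z)) (snd (snd z)) \<partial>regime_law))"
        if "z \<in> space noise" for v0 z
      proof -
        have [measurable]: "(\<lambda>_. fst z) \<in> N \<rightarrow>\<^sub>M stream_space borel" "(\<lambda>_. fst (snd z)) \<in> N \<rightarrow>\<^sub>M scores"
          "(\<lambda>_. snd (snd z)) \<in> N \<rightarrow>\<^sub>M stream_space borel" for N :: "'b measure"
          using that by (auto simp: space_pair_measure space_stream_space)
        show ?thesis
          unfolding G_def A_def
          by (auto simp: nn_integral_add RL.emeasure_space_1)
      qed
      have "(\<integral>\<^sup>+z. G w' j s0 v0 z \<partial>noise) = (\<integral>\<^sup>+z. (if u (length w') j s0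
         then ennreal c_h + (\<integral>\<^sup>+r. cost_upto u c n (w' @ [v0]) (regime_path j (fst r) (snd r) (fst z)) (fst z) (fst (snd z)) (snd (snd z)) \<partial>regime_law)
         else ennreal (c s0 j) + (\<integral>\<^sup>+r. cost_upto u c n w' (regime_path j (fst r) (snd r) (fst z)) (fst z) (fst (snd z)) (snd (snd z)) \<partial>regime_law)) \<partial>noise)" for v0
        by (rule nn_integral_cong[OF G])
      then have "(\<integral>\<^sup>+z. G w' j s0 v0 z \<partial>noise) = (if u (length w') j s0 then ennreal c_h + cost_from n (w' @ [v0]) j
          else ennreal (c s0 j) + cost_from n w' j)" for v0
        unfolding cost_from_def by (auto simp: nn_integral_add XSV.emeasure_space_1)
      then show ?thesis by (simp add: nn_integral_add VL.emeasure_space_1[simplified])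
    qed
    then show ?thesis unfolding decision_cost_from_def by simp
  qed
  define F where "F x0 s0 v0 z = (\<integral>\<^sup>+r. cost_upto u c (Suc n) w (regime_path i (fst r) (snd r) (x0 ## fst z)) (x0 ## fst z)
      (s0 ## fst (snd z)) (v0 ## snd (snd z)) \<partial>regime_law)" for x0 s0 v0 z
  interpret N1: pair_sigma_finite regime_law noise ..
  interpret N2: pair_sigma_finite regime_law "exp_law mu" ..
  interpret N3: pair_sigma_finite regime_law score_law ..
  have step: "(\<integral>\<^sup>+s0. \<integral>\<^sup>+v0. \<integral>\<^sup>+z. F x0 s0 v0 z \<partial>noise \<partial>exp_law mu \<partial>score_law)
    = holding_cost x0 w + ennreal (exp (- alpha * x0)) *
     (\<integral>\<^sup>+r. decision_cost_from n (serve m x0 w) (regime_left i (fst r) (snd r) x0) \<partial>regime_law)" if x0: "0 < x0" for x0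
  proof -
    define g where "g r s0 v0 z = G (serve m x0 w) (regime_left i (fst r) (snd r) x0) s0 v0 z" for r s0 v0 z
    have g_meas [measurable (raw)]: "(\<lambda>y. g (r y) (s0 y) (v0 y) (z y)) \<in> borel_measurable N"
      if [measurable]: "r \<in> N \<rightarrow>\<^sub>M stream_space borel \<Otimes>\<^sub>M jumps" "s0 \<in> N \<rightarrow>\<^sub>M score_law" "v0 \<in> borel_measurable N" "z \<in> N \<rightarrow>\<^sub>M noise_algebra"
      for r s0 v0 z and N :: "'b measure"
      unfolding g_def
      by (rule measurable_compose_countable[where g="\<lambda>y. regime_left i (fst (r y)) (snd (r y)) x0"
           and f="\<lambda>j y. G (serve m x0 w) j (s0 y) (v0 y) (z y)"]) measurable
    have F: "F x0 s0 v0 z = holding_cost x0 w + ennreal (exp (- alpha * x0)) * (\<integral>\<^sup>+r. g r s0 v0 z \<partial>regime_law)"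
      if z: "z \<in> space noise" "\<forall>k. 0 < fst z !! k" and s0: "s0 \<in> space score_law" for s0 v0 z
    proof -
      have [measurable]: "(\<lambda>_. fst z) \<in> N \<rightarrow>\<^sub>M stream_space borel" "(\<lambda>_. fst (snd z)) \<in> N \<rightarrow>\<^sub>M scores"
          "(\<lambda>_. snd (snd z)) \<in> N \<rightarrow>\<^sub>M stream_space borel" "(\<lambda>_. s0) \<in> N \<rightarrow>\<^sub>M score_law" for N :: "'b measure"
        using z s0 by (auto simp: space_pair_measure space_stream_space)
      let ?B = "\<lambda>j \<rho>. A (serve m x0 w) j s0 v0 \<rho> (fst z) (fst (snd z)) (snd (snd z))"
      have B: "(\<lambda>\<rho>. ?B j \<rho>) \<in> borel_measurable (stream_space (count_space UNIV))" for j
        by measurable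
      let ?b = "\<lambda>r. ?B (regime_left i (fst r) (snd r) x0) (stl (regime_path i (fst r) (snd r) (x0 ## fst z)))"
      have b: "?b \<in> borel_measurable regime_law"
        by (rule measurable_compose_countable[where g="\<lambda>r. regime_left i (fst r) (snd r) x0"
           and f="\<lambda>j r. ?B j (stl (regime_path i (fst r) (snd r) (x0 ## fst z)))"]) measurable
      have "F x0 s0 v0 z = (\<integral>\<^sup>+r. holding_cost x0 w + ennreal (exp (- alpha * x0)) * ?b r \<partial>regime_law)"
        unfolding F_def A_def cost_upto.simps regime_path_SCons stream.sel ..
      also have "\<dots> = holding_cost x0 w + ennreal (exp (- alpha * x0)) * (\<integral>\<^sup>+r. ?b r \<partial>regime_law)"
        using b by (simp add: nn_integral_add nn_integral_cmult RL.emeasure_space_1)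
      also have "(\<integral>\<^sup>+r. ?b r \<partial>regime_law) = (\<integral>\<^sup>+r. g r s0 v0 z \<partial>regime_law)"
        unfolding g_def G_def
        by (rule nn_integral_regime_markov[where B="?B", OF B i x0]) (use z in auto)
      finally show ?thesis .
    qed
    have "(\<integral>\<^sup>+s0. \<integral>\<^sup>+v0. \<integral>\<^sup>+z. F x0 s0 v0 z \<partial>noise \<partial>exp_law mu \<partial>score_law)
      = (\<integral>\<^sup>+s0. \<integral>\<^sup>+v0. \<integral>\<^sup>+z. holding_cost x0 w + ennreal (exp (- alpha * x0)) * (\<integral>\<^sup>+r. g r s0 v0 z \<partial>regime_law) \<partial>noise \<partial>exp_law mu \<partial>score_law)"
    proof (rule nn_integral_cong, rule nn_integral_cong)
      fix s0 v0 assume s0: "s0 \<in> space score_law"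
      have "AE z in noise. F x0 s0 v0 z = holding_cost x0 w + ennreal (exp (- alpha * x0)) * (\<integral>\<^sup>+r. g r s0 v0 z \<partial>regime_law)"
        using AE_noise_pos AE_space[of noise] by eventually_elim (rule F[OF _ _ s0])
      then show "(\<integral>\<^sup>+z. F x0 s0 v0 z \<partial>noise) = (\<integral>\<^sup>+z. holding_cost x0 w + ennreal (exp (- alpha * x0)) * (\<integral>\<^sup>+r. g r s0 v0 z \<partial>regime_law) \<partial>noise)"
        by (rule nn_integral_cong_AE)
    qed
    also have "\<dots> = holding_cost x0 w + ennreal (exp (- alpha * x0)) *
        (\<integral>\<^sup>+s0. \<integral>\<^sup>+v0. \<integral>\<^sup>+z. \<integral>\<^sup>+r. g r s0 v0 z \<partial>regime_law \<partial>noise \<partial>exp_law mu \<partial>score_law)"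
    proof -
      let ?a = "holding_cost x0 w" and ?b = "ennreal (exp (- alpha * x0))"
      have "(\<integral>\<^sup>+s0. \<integral>\<^sup>+v0. \<integral>\<^sup>+z. ?a + ?b * (\<integral>\<^sup>+r. g r s0 v0 z \<partial>regime_law) \<partial>noise \<partial>exp_law mu \<partial>score_law)
         = (\<integral>\<^sup>+s0. \<integral>\<^sup>+v0. ?a + ?b * (\<integral>\<^sup>+z. \<integral>\<^sup>+r. g r s0 v0 z \<partial>regime_law \<partial>noise) \<partial>exp_law mu \<partial>score_law)"
        by (rule nn_integral_cong, rule nn_integral_cong, rule XSV.nn_integral_affine) measurable
      also have "\<dots> = (\<integral>\<^sup>+s0. ?a + ?b * (\<integral>\<^sup>+v0. \<integral>\<^sup>+z. \<integral>\<^sup>+r. g r s0 v0 z \<partial>regime_law \<partial>noise \<partial>exp_law mu) \<partial>score_law)"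
        by (rule nn_integral_cong, rule VL.nn_integral_affine) measurable
      also have "\<dots> = ?a + ?b * (\<integral>\<^sup>+s0. \<integral>\<^sup>+v0. \<integral>\<^sup>+z. \<integral>\<^sup>+r. g r s0 v0 z \<partial>regime_law \<partial>noise \<partial>exp_law mu \<partial>score_law)"
        by (rule SL.nn_integral_affine) measurable
      finally show ?thesis .
    qed
    \<comment> \<open>The integral over the regime path up to the arrival is moved outermost, so
      that \<open>decision\<close> can be applied with the regime met by the arrival held
      fixed.\<close>
    also have "(\<integral>\<^sup>+s0. \<integral>\<^sup>+v0. \<integral>\<^sup>+z. \<integral>\<^sup>+r. g r s0 v0 z \<partial>regime_law \<partial>noise \<partial>exp_law mu \<partial>score_law)
       = (\<integral>\<^sup>+s0. \<integral>\<^sup>+v0. \<integral>\<^sup>+r. \<integral>\<^sup>+z. g r s0 v0 z \<partial>noise \<partial>regime_law \<partial>exp_law mu \<partial>score_law)"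
      by (intro nn_integral_cong N1.Fubini') measurable
    also have "\<dots> = (\<integral>\<^sup>+s0. \<integral>\<^sup>+r. \<integral>\<^sup>+v0. \<integral>\<^sup>+z. g r s0 v0 z \<partial>noise \<partial>exp_law mu \<partial>regime_law \<partial>score_law)"
      by (intro nn_integral_cong N2.Fubini') measurable
    also have "\<dots> = (\<integral>\<^sup>+r. \<integral>\<^sup>+s0. \<integral>\<^sup>+v0. \<integral>\<^sup>+z. g r s0 v0 z \<partial>noise \<partial>exp_law mu \<partial>score_law \<partial>regime_law)"
      by (intro N3.Fubini') measurable
    finally show ?thesis unfolding g_def decision .
  qed
  have "cost_from (Suc n) w i = (\<integral>\<^sup>+x0. \<integral>\<^sup>+s0. \<integral>\<^sup>+v0. \<integral>\<^sup>+z. F x0 s0 v0 z \<partial>noise \<partial>exp_law mu \<partial>score_law \<partial>exp_law lam)"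
    unfolding cost_from_def F_def
    by (rule nn_integral_noise_SCons[where F="\<lambda>x s v. \<integral>\<^sup>+r. cost_upto u c (Suc n) w (regime_path i (fst r) (snd r) x) x s v \<partial>regime_law"])
      measurable
  also have "\<dots> = (\<integral>\<^sup>+x0. holding_cost x0 w + ennreal (exp (- alpha * x0)) *
     (\<integral>\<^sup>+r. decision_cost_from n (serve m x0 w) (regime_left i (fst r) (snd r) x0) \<partial>regime_law) \<partial>exp_law lam)"
    by (intro nn_integral_cong_AE eventually_mono[OF AE_exp_law_pos] step)
  finally show ?thesis .
qed

end

text \<open>The exceptional null set is enlarged to a rectangle, so the predicates may be
  nonmeasurable. This serves for properties that quantify over all arrival streams or all times at
  once.\<close>

lemma (in pair_sigma_finite)
  shows AE_pair_fst: "(AE x in M1. P x) \<Longrightarrow> AE z in M1 \<Otimes>\<^sub>M M2. P (fst z)"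
    and AE_pair_snd: "(AE y in M2. R y) \<Longrightarrow> AE z in M1 \<Otimes>\<^sub>M M2. R (snd z)"
proof -
  assume "AE x in M1. P x"
  then obtain N where N: "N \<in> null_sets M1" "{x \<in> space M1. \<not> P x} \<subseteq> N"
    by (auto simp: eventually_ae_filter)
  then have "N \<times> space M2 \<in> null_sets (M1 \<Otimes>\<^sub>M M2)"
    by (auto simp: null_sets_def M2.emeasure_pair_measure_Times)
  then show "AE z in M1 \<Otimes>\<^sub>M M2. P (fst z)"
    by (rule AE_I') (use N in \<open>auto simp: space_pair_measure\<close>)
next
  assume "AE y in M2. R y"
  then obtain N where N: "N \<in> null_sets M2" "{y \<in> space M2. \<not> R y} \<subseteq> N"
    by (auto simp: eventually_ae_filter)
  then have "space M1 \<times> N \<in> null_sets (M1 \<Otimes>\<^sub>M M2)"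
    by (auto simp: null_sets_def M2.emeasure_pair_measure_Times)
  then show "AE z in M1 \<Otimes>\<^sub>M M2. R (snd z)"
    by (rule AE_I') (use N in \<open>auto simp: space_pair_measure\<close>)
qed

lemma measurable_death_mean:
  assumes "0 < r" and [measurable]: "f \<in> borel_measurable N"
  shows "(\<lambda>y. death_mean r m (f y) g q) \<in> borel_measurable N"
proof -
  interpret prob_space "exp_list r q" by (rule prob_space_exp_list[OF assms(1)])
  show ?thesis unfolding death_mean_def by measurable
qed

section \<open>The recursion in terms of queue length and regime alone\<close>

context hybrid_control
begin

definition hold_mean :: "real \<Rightarrow> nat \<Rightarrow> ennreal" where
  "hold_mean x q = (\<integral>\<^sup>+t. (if 0 < t \<and> t \<le> x
     then ennreal (exp (- alpha * t)) * death_mean mu m t (\<lambda>n. ennreal (h n)) q else 0) \<partial>lborel)"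

text \<open>Half of the dynamic programming operator: the passage to the next arrival, where
  \<open>B\<close> is charged. Keeping it apart from the decision lets a fixed policy
  (\<open>decision_cost\<close>) and the optimal choice share the same passage.\<close>

definition arrival_step :: "(nat \<Rightarrow> nat \<Rightarrow> ennreal) \<Rightarrow> nat \<Rightarrow> nat \<Rightarrow> ennreal" where
  "arrival_step B q i = (\<integral>\<^sup>+x. hold_mean x q + ennreal (exp (- alpha * x)) *
     (\<integral>\<^sup>+r. death_mean mu m x (\<lambda>q'. B q' (regime_left i (fst r) (snd r) x)) q \<partial>regime_law) \<partial>exp_law lam)"

definition decision_cost :: "(nat \<Rightarrow> nat \<Rightarrow> real \<Rightarrow> bool) \<Rightarrow> (real \<Rightarrow> nat \<Rightarrow> real) \<Rightarrow>
    (nat \<Rightarrow> nat \<Rightarrow> ennreal) \<Rightarrow> nat \<Rightarrow> nat \<Rightarrow> ennreal" where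
  "decision_cost u c f q j = (\<integral>\<^sup>+s. (if u q j s then ennreal c_h + f (Suc q) j else ennreal (c s j) + f q j) \<partial>score_law)"

lemma measurable_death_mean_mu [measurable (raw)]:
  "f \<in> borel_measurable N \<Longrightarrow> (\<lambda>y. death_mean mu m (f y) g q) \<in> borel_measurable N"
  by (rule measurable_death_mean[OF mu_pos])

lemma measurable_death_mean_regime:
  fixes B :: "nat \<Rightarrow> nat \<Rightarrow> ennreal"
  assumes [measurable]: "f \<in> borel_measurable N" "g \<in> N \<rightarrow>\<^sub>M count_space UNIV"
  shows "(\<lambda>y. death_mean mu m (f y) (\<lambda>q'. B q' (g y)) q) \<in> borel_measurable N"
  by (rule measurable_compose_countable[where g=g and f="\<lambda>j y. death_mean mu m (f y) (\<lambda>q'. B q' j) q"]) measurable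

lemma measurable_hold_mean [measurable (raw)]:
  assumes [measurable]: "f \<in> borel_measurable N"
  shows "(\<lambda>y. hold_mean (f y) q) \<in> borel_measurable N"
  unfolding hold_mean_def by measurable

lemma nn_integral_holding_cost: "(\<integral>\<^sup>+w. holding_cost x w \<partial>exp_list mu q) = hold_mean x q"
proof -
  interpret E: prob_space "exp_list mu q" by (rule prob_space_exp_list[OF mu_pos])
  interpret P: pair_sigma_finite lborel "exp_list mu q" ..
  have "(\<integral>\<^sup>+w. holding_cost x w \<partial>exp_list mu q) = (\<integral>\<^sup>+t. \<integral>\<^sup>+w.
     (if 0 < t \<and> t \<le> x then ennreal (exp (- alpha * t) * h (length (serve m t w))) else 0) \<partial>exp_list mu q \<partial>lborel)"
    unfolding holding_cost_def by (rule P.Fubini') measurable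
  also have "\<dots> = hold_mean x q"
    unfolding hold_mean_def death_mean_def
  proof (rule nn_integral_cong)
    fix t :: real
    have "(\<integral>\<^sup>+w. ennreal (exp (- alpha * t) * h (length (serve m t w))) \<partial>exp_list mu q)
       = ennreal (exp (- alpha * t)) * (\<integral>\<^sup>+w. ennreal (h (length (serve m t w))) \<partial>exp_list mu q)"
      unfolding ennreal_mult'[OF exp_ge_zero] by (rule nn_integral_cmult) measurable
    then have "(\<integral>\<^sup>+w. (if b then ennreal (exp (- alpha * t) * h (length (serve m t w))) else 0) \<partial>exp_list mu q)
      = (if b then ennreal (exp (- alpha * t)) * (\<integral>\<^sup>+w. ennreal (h (length (serve m t w))) \<partial>exp_list mu q) else 0)" for b
      by simp
    then show "(\<integral>\<^sup>+w. (if 0 < t \<and> t \<le> x then ennreal (exp (- alpha * t) * h (length (serve m t w))) else 0) \<partial>exp_list mu q)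
      = (if 0 < t \<and> t \<le> x then ennreal (exp (- alpha * t)) * (\<integral>\<^sup>+w. ennreal (h (length (serve m t w))) \<partial>exp_list mu q) else 0)"
      .
  qed
  finally show ?thesis .
qed

text \<open>Policies and automation costs are constrained only at regimes in \<open>{1..K}\<close>
  and scores in the unit interval; this permits changing them elsewhere for the sake of
  measurability.\<close>

lemma cost_upto_cong:
  assumes "\<And>k. \<rho> !! k \<in> {1..K}" "\<And>k. s !! k \<in> {0..1}"
    and "\<And>q j s. j \<in> {1..K} \<Longrightarrow> s \<in> {0..1} \<Longrightarrow> u q j s = u' q j s"
    and "\<And>j s. j \<in> {1..K} \<Longrightarrow> s \<in> {0..1} \<Longrightarrow> c s j = c' s j"
  shows "cost_upto u c n w \<rho> x s v = cost_upto u' c' n w \<rho> x s v"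
  using assms(1,2)
proof (induction n arbitrary: w \<rho> x s v)
  case (Suc n)
  have "stl \<rho> !! k \<in> {1..K}" "stl s !! k \<in> {0..1}" for k
    using Suc.prems(1)[of "Suc k"] Suc.prems(2)[of "Suc k"] by simp_all
  note IH = Suc.IH[of "stl \<rho>" "stl s", OF this]
  have "shd \<rho> \<in> {1..K}" "shd s \<in> {0..1}" using Suc.prems(1)[of 0] Suc.prems(2)[of 0] by simp_all
  then show ?case unfolding cost_upto.simps IH using assms(3,4) by simp
qed simp

lemma incseq_cost_upto: "incseq (\<lambda>n. cost_upto u c n w \<rho> x s v)"
  unfolding cost_upto_eq_sum by (auto intro!: incseq_SucI)

end

context measurable_policy
begin

lemma measurable_decision_cost_from [measurable]:
  "(\<lambda>w. decision_cost_from n w j) \<in> borel_measurable list_space"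
  unfolding decision_cost_from_def by measurable

text \<open>The action depends on the content only through its length, which is almost surely
  \<open>q\<close>, and one fresh service time appended to \<open>q\<close> fresh ones has the law
  for \<open>Suc q\<close>.\<close>

lemma nn_integral_decision_cost_from:
  "(\<integral>\<^sup>+w. decision_cost_from n w j \<partial>exp_list mu q) = decision_cost u c (expected_cost n) q j"
proof -
  interpret E: prob_space "exp_list mu q" by (rule prob_space_exp_list[OF mu_pos])
  interpret P: pair_sigma_finite score_law "exp_list mu q" ..
  have snoc: "(\<integral>\<^sup>+w. \<integral>\<^sup>+v. cost_from n (w @ [v]) j \<partial>exp_law mu \<partial>exp_list mu q) = expected_cost n (Suc q) j"
  proof -
    have "expected_cost n (Suc q) j = (\<integral>\<^sup>+w. \<integral>\<^sup>+w'. cost_from n (w @ w') j \<partial>exp_list mu 1 \<partial>exp_list mu q)"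
      unfolding expected_cost_def
      using nn_integral_exp_list_append[OF mu_pos, of "\<lambda>w. cost_from n w j" q 1] by simp
    also have "\<dots> = (\<integral>\<^sup>+w. \<integral>\<^sup>+v. cost_from n (w @ [v]) j \<partial>exp_law mu \<partial>exp_list mu q)"
    proof (rule nn_integral_cong)
      fix w :: "real list"
      show "(\<integral>\<^sup>+w'. cost_from n (w @ w') j \<partial>exp_list mu 1) = (\<integral>\<^sup>+v. cost_from n (w @ [v]) j \<partial>exp_law mu)"
        using nn_integral_exp_list_Suc[OF mu_pos, of "\<lambda>w'. cost_from n (w @ w') j" 0]
        by (simp add: nn_integral_exp_list_0[OF mu_pos])
    qed
    finally show ?thesis ..
  qed
  have "(\<integral>\<^sup>+w. decision_cost_from n w j \<partial>exp_list mu q)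
     = (\<integral>\<^sup>+w. \<integral>\<^sup>+s. (if u q j s then ennreal c_h + (\<integral>\<^sup>+v. cost_from n (w @ [v]) j \<partial>exp_law mu)
          else ennreal (c s j) + cost_from n w j) \<partial>score_law \<partial>exp_list mu q)"
    unfolding decision_cost_from_def
    by (intro nn_integral_cong_AE eventually_mono[OF AE_exp_list_length[OF mu_pos]]) simp
  also have "\<dots> = (\<integral>\<^sup>+s. \<integral>\<^sup>+w. (if u q j s then ennreal c_h + (\<integral>\<^sup>+v. cost_from n (w @ [v]) j \<partial>exp_law mu)
          else ennreal (c s j) + cost_from n w j) \<partial>exp_list mu q \<partial>score_law)"
    by (rule P.Fubini') measurable
  also have "\<dots> = decision_cost u c (expected_cost n) q j"
    unfolding decision_cost_def
    by (rule nn_integral_cong)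
      (auto simp: nn_integral_add E.emeasure_space_1[simplified] snoc expected_cost_def[of n q j, symmetric])
  finally show ?thesis .
qed

text \<open>The next arrival meets \<open>serve m x w\<close>, not a fresh list. By
  \<open>nn_integral_serve_markov\<close> it may be replaced by fresh times given its length, and
  this closes the recursion on the queue length.\<close>

lemma expected_cost_Suc:
  assumes i: "i \<in> {1..K}"
  shows "expected_cost (Suc n) q i = arrival_step (decision_cost u c (expected_cost n)) q i"
proof -
  interpret E: prob_space "exp_list mu q" by (rule prob_space_exp_list[OF mu_pos])
  interpret P: pair_sigma_finite "exp_law lam" "exp_list mu q" ..
  interpret R: pair_sigma_finite regime_law "exp_list mu q" ..
  let ?d = "decision_cost_from n"
  have [measurable]: "(\<lambda>y. ?d (serve m (f y) (w y)) (regime_left i (fst (r y)) (snd (r y)) (f y))) \<in> borel_measurable N"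
    if [measurable]: "f \<in> borel_measurable N" "w \<in> N \<rightarrow>\<^sub>M list_space" "r \<in> N \<rightarrow>\<^sub>M stream_space borel \<Otimes>\<^sub>M jumps"
    for f w r and N :: "'b measure"
    by (rule measurable_compose_countable[where g="\<lambda>y. regime_left i (fst (r y)) (snd (r y)) (f y)"
          and f="\<lambda>j y. ?d (serve m (f y) (w y)) j"]) measurable
  have "expected_cost (Suc n) q i = (\<integral>\<^sup>+w. \<integral>\<^sup>+x. holding_cost x w + ennreal (exp (- alpha * x)) *
     (\<integral>\<^sup>+r. ?d (serve m x w) (regime_left i (fst r) (snd r) x) \<partial>regime_law) \<partial>exp_law lam \<partial>exp_list mu q)"
    unfolding expected_cost_def cost_from_Suc[OF i] ..
  also have "\<dots> = (\<integral>\<^sup>+x. \<integral>\<^sup>+w. holding_cost x w + ennreal (exp (- alpha * x)) *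
     (\<integral>\<^sup>+r. ?d (serve m x w) (regime_left i (fst r) (snd r) x) \<partial>regime_law) \<partial>exp_list mu q \<partial>exp_law lam)"
    by (rule P.Fubini') measurable
  also have "\<dots> = arrival_step (decision_cost u c (expected_cost n)) q i"
    unfolding arrival_step_def
  proof (rule nn_integral_cong_AE, rule eventually_mono[OF AE_exp_law_nonneg])
    fix x :: real assume x: "0 \<le> x"
    have "(\<integral>\<^sup>+w. holding_cost x w + ennreal (exp (- alpha * x)) *
        (\<integral>\<^sup>+r. ?d (serve m x w) (regime_left i (fst r) (snd r) x) \<partial>regime_law) \<partial>exp_list mu q)
      = hold_mean x q + ennreal (exp (- alpha * x)) *
        (\<integral>\<^sup>+w. \<integral>\<^sup>+r. ?d (serve m x w) (regime_left i (fst r) (snd r) x) \<partial>regime_law \<partial>exp_list mu q)"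
      unfolding nn_integral_holding_cost[symmetric]
      by (subst nn_integral_add, measurable) (subst nn_integral_cmult, measurable)
    also have "(\<integral>\<^sup>+w. \<integral>\<^sup>+r. ?d (serve m x w) (regime_left i (fst r) (snd r) x) \<partial>regime_law \<partial>exp_list mu q)
      = (\<integral>\<^sup>+r. \<integral>\<^sup>+w. ?d (serve m x w) (regime_left i (fst r) (snd r) x) \<partial>exp_list mu q \<partial>regime_law)"
      by (rule R.Fubini') measurable
    also have "\<dots> = (\<integral>\<^sup>+r. death_mean mu m x (\<lambda>q'. decision_cost u c (expected_cost n) q' (regime_left i (fst r) (snd r) x)) q \<partial>regime_law)"
      unfolding death_mean_def nn_integral_decision_cost_from[symmetric]
      by (intro nn_integral_cong nn_integral_serve_markov[OF mu_pos _ m_ge_1 x]) measurable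
    finally show "(\<integral>\<^sup>+w. holding_cost x w + ennreal (exp (- alpha * x)) *
        (\<integral>\<^sup>+r. ?d (serve m x w) (regime_left i (fst r) (snd r) x) \<partial>regime_law) \<partial>exp_list mu q)
      = hold_mean x q + ennreal (exp (- alpha * x)) *
        (\<integral>\<^sup>+r. death_mean mu m x (\<lambda>q'. decision_cost u c (expected_cost n) q' (regime_left i (fst r) (snd r) x)) q \<partial>regime_law)" .
  qed
  finally show ?thesis .
qed

lemma expected_cost_0: "expected_cost 0 q i = 0"
  by (simp add: expected_cost_def cost_from_def)

text \<open>Almost every path satisfies the conditions of \<open>path_cost_eq_SUP\<close>, and the
  truncated costs increase, so monotone convergence applies. The policy \<open>u'\<close> and
  \<open>c_auto\<close> have to agree with \<open>u\<close> and \<open>c\<close> only at regimes and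
  scores that occur almost surely. The initial service times are then split off the service
  stream.\<close>

lemma J_eq_SUP_expected_cost:
  assumes \<theta>: "\<theta> \<in> {1..K}"
    and uu': "\<And>q j s. j \<in> {1..K} \<Longrightarrow> s \<in> {0..1} \<Longrightarrow> u' q j s = u q j s"
    and cc': "\<And>j s. j \<in> {1..K} \<Longrightarrow> s \<in> {0..1} \<Longrightarrow> c_auto s j = c s j"
  shows "J u' q \<theta> = (SUP n. expected_cost n q \<theta>)"
proof -
  interpret VR: pair_prob_space services regime_law ..
  interpret SVR: pair_prob_space scores "services \<Otimes>\<^sub>M regime_law" ..
  interpret XSVR: pair_prob_space arrivals "scores \<Otimes>\<^sub>M services \<Otimes>\<^sub>M regime_law" ..
  interpret E: prob_space "exp_list mu q" by (rule prob_space_exp_list[OF mu_pos])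
  interpret XE: pair_sigma_finite "exp_list mu q" arrivals ..
  interpret SE: pair_sigma_finite "exp_list mu q" scores ..
  have input_law: "input_law = arrivals \<Otimes>\<^sub>M scores \<Otimes>\<^sub>M services \<Otimes>\<^sub>M regime_law"
    unfolding input_law_def jump_law_def ..
  define g where "g n x s v r = cost_upto u c n (stake q v) (regime_path \<theta> (fst r) (snd r) x) x s (sdrop q v)" for n x s v r
  have [measurable (raw)]: "(\<lambda>y. g n (x y) (s y) (v y) (r y)) \<in> borel_measurable N"
    if [measurable]: "x \<in> N \<rightarrow>\<^sub>M stream_space borel" "s \<in> N \<rightarrow>\<^sub>M scores" "v \<in> N \<rightarrow>\<^sub>M stream_space borel"
      "r \<in> N \<rightarrow>\<^sub>M stream_space borel \<Otimes>\<^sub>M jumps" for n x s v r and N :: "'b measure"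
  proof -
    have [measurable]: "stake q \<in> stream_space borel \<rightarrow>\<^sub>M list_space" by (rule measurable_stake_list_space) simp
    show ?thesis unfolding g_def by measurable
  qed
  have x_pos: "AE x in arrivals. stream_all (\<lambda>x. 0 < x) x"
    by (rule XL.AE_stream_all) (use AE_exp_law_pos in auto)
  have x_unb: "AE x in arrivals. \<forall>B. \<exists>n. B \<le> (\<Sum>k<n. x !! k)"
    by (rule AE_stream_exp_law_sums_unbounded[OF lam_pos])
  have s: "AE s in scores. \<forall>k. s !! k \<in> {0..1}"
    by (rule AE_I2) (auto simp: space_stream_space streams_iff_snth)
  have r: "AE r in regime_law. \<forall>x k. regime_path \<theta> (fst r) (snd r) x !! k \<in> {1..K}"
    using RL.AE_pair_snd[OF AE_jump_stream]
    by eventually_elim (use \<theta> in \<open>auto simp only: regime_path_snth intro!: regime_left_in\<close>)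
  have "AE x in arrivals. (\<forall>k. 0 < x !! k) \<and> (\<forall>B. \<exists>n. B \<le> arr x n)"
    using x_pos x_unb by eventually_elim (simp add: arr_def stream_all_def)
  then have AE_x: "AE z in input_law. (\<forall>k. 0 < fst z !! k) \<and> (\<forall>B. \<exists>n. B \<le> arr (fst z) n)"
    unfolding input_law by (rule XSVR.AE_pair_fst)
  have AE_s: "AE z in input_law. \<forall>k. fst (snd z) !! k \<in> {0..1}"
    unfolding input_law by (intro XSVR.AE_pair_snd SVR.AE_pair_fst s)
  have AE_r: "AE z in input_law. \<forall>x k. regime_path \<theta> (fst (snd (snd (snd z)))) (snd (snd (snd (snd z)))) x !! k \<in> {1..K}"
    unfolding input_law by (intro XSVR.AE_pair_snd SVR.AE_pair_snd VR.AE_pair_snd r)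
  have "J u' q \<theta> = (\<integral>\<^sup>+z. (SUP n. g n (fst z) (fst (snd z)) (fst (snd (snd z))) (snd (snd (snd z)))) \<partial>input_law)"
    unfolding J_def
  proof (rule nn_integral_cong_AE, use AE_x AE_s AE_r in eventually_elim)
    case (elim z)
    obtain x s v e \<phi> where z: "z = (x, s, v, e, \<phi>)" by (cases z) auto
    have "path_cost u' q (regime_left \<theta> e \<phi>) x s v =
        (SUP n. cost_upto u' c_auto n (stake q v) (regime_path \<theta> e \<phi> x) x s (sdrop q v))"
      unfolding regime_path_def using elim(1) by (intro path_cost_eq_SUP) (auto simp: z)
    also have "\<dots> = (SUP n. cost_upto u c n (stake q v) (regime_path \<theta> e \<phi> x) x s (sdrop q v))"
      using elim(2,3) uu' cc' by (intro SUP_cong refl cost_upto_cong) (auto simp: z)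
    finally show ?case by (simp add: z g_def)
  qed
  also have "\<dots> = (SUP n. \<integral>\<^sup>+z. g n (fst z) (fst (snd z)) (fst (snd (snd z))) (snd (snd (snd z))) \<partial>input_law)"
    unfolding input_law
    by (rule nn_integral_monotone_convergence_SUP)
      (auto simp: incseq_def le_fun_def g_def intro: incseqD[OF incseq_cost_upto])
  finally have J: "J u' q \<theta> = (SUP n. \<integral>\<^sup>+z. g n (fst z) (fst (snd z)) (fst (snd (snd z))) (snd (snd (snd z))) \<partial>input_law)" .
  have "(\<integral>\<^sup>+z. g n (fst z) (fst (snd z)) (fst (snd (snd z))) (snd (snd (snd z))) \<partial>input_law) = expected_cost n q \<theta>" for n
  proof -
    have "(\<integral>\<^sup>+z. g n (fst z) (fst (snd z)) (fst (snd (snd z))) (snd (snd (snd z))) \<partial>input_law)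
        = (\<integral>\<^sup>+x. \<integral>\<^sup>+z. g n x (fst z) (fst (snd z)) (snd (snd z)) \<partial>(scores \<Otimes>\<^sub>M services \<Otimes>\<^sub>M regime_law) \<partial>arrivals)"
      unfolding input_law
      using SVR.nn_integral_fst[of "\<lambda>z. g n (fst z) (fst (snd z)) (fst (snd (snd z))) (snd (snd (snd z)))" arrivals] by simp
    also have "\<dots> = (\<integral>\<^sup>+x. \<integral>\<^sup>+s. \<integral>\<^sup>+z. g n x s (fst z) (snd z) \<partial>(services \<Otimes>\<^sub>M regime_law) \<partial>scores \<partial>arrivals)"
    proof (rule nn_integral_cong)
      fix x :: "real stream"
      show "(\<integral>\<^sup>+z. g n x (fst z) (fst (snd z)) (snd (snd z)) \<partial>(scores \<Otimes>\<^sub>M services \<Otimes>\<^sub>M regime_law))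
          = (\<integral>\<^sup>+s. \<integral>\<^sup>+z. g n x s (fst z) (snd z) \<partial>(services \<Otimes>\<^sub>M regime_law) \<partial>scores)"
        using VR.nn_integral_fst[of "\<lambda>z. g n x (fst z) (fst (snd z)) (snd (snd z))" scores] by simp
    qed
    also have "\<dots> = (\<integral>\<^sup>+x. \<integral>\<^sup>+s. \<integral>\<^sup>+v. \<integral>\<^sup>+r. g n x s v r \<partial>regime_law \<partial>services \<partial>scores \<partial>arrivals)"
    proof (rule nn_integral_cong, rule nn_integral_cong)
      fix x :: "real stream" and s assume [simp]: "s \<in> space scores"
      have "(\<lambda>z. g n x s (fst z) (snd z)) \<in> borel_measurable (services \<Otimes>\<^sub>M regime_law)" by measurable
      from RL.nn_integral_fst[OF this]
      show "(\<integral>\<^sup>+z. g n x s (fst z) (snd z) \<partial>(services \<Otimes>\<^sub>M regime_law)) = (\<integral>\<^sup>+v. \<integral>\<^sup>+r. g n x s v r \<partial>regime_law \<partial>services)"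
        by simp
    qed
    also have "\<dots> = (\<integral>\<^sup>+x. \<integral>\<^sup>+s. \<integral>\<^sup>+w. \<integral>\<^sup>+v. \<integral>\<^sup>+r. cost_upto u c n w (regime_path \<theta> (fst r) (snd r) x) x s v
        \<partial>regime_law \<partial>services \<partial>exp_list mu q \<partial>scores \<partial>arrivals)"
    proof (rule nn_integral_cong, rule nn_integral_cong)
      fix x :: "real stream" and s assume [simp]: "s \<in> space scores"
      show "(\<integral>\<^sup>+v. \<integral>\<^sup>+r. g n x s v r \<partial>regime_law \<partial>services) = (\<integral>\<^sup>+w. \<integral>\<^sup>+v. \<integral>\<^sup>+r. cost_upto u c n w (regime_path \<theta> (fst r) (snd r) x) x s v
        \<partial>regime_law \<partial>services \<partial>exp_list mu q)"
        unfolding g_def by (rule nn_integral_stake_sdrop[OF mu_pos]) measurable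
    qed
    also have "\<dots> = (\<integral>\<^sup>+x. \<integral>\<^sup>+w. \<integral>\<^sup>+s. \<integral>\<^sup>+v. \<integral>\<^sup>+r. cost_upto u c n w (regime_path \<theta> (fst r) (snd r) x) x s v
        \<partial>regime_law \<partial>services \<partial>scores \<partial>exp_list mu q \<partial>arrivals)"
      by (rule nn_integral_cong, rule SE.Fubini') measurable
    also have "\<dots> = (\<integral>\<^sup>+w. \<integral>\<^sup>+x. \<integral>\<^sup>+s. \<integral>\<^sup>+v. \<integral>\<^sup>+r. cost_upto u c n w (regime_path \<theta> (fst r) (snd r) x) x s v
        \<partial>regime_law \<partial>services \<partial>scores \<partial>arrivals \<partial>exp_list mu q)"
      by (rule XE.Fubini') measurable
    also have "\<dots> = expected_cost n q \<theta>"
      unfolding expected_cost_def cost_from_def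
      by (rule nn_integral_cong, rule nn_integral_noise[symmetric]) measurable
    finally show ?thesis .
  qed
  then show ?thesis unfolding J by simp
qed

end

subsection \<open>The Bellman equation\<close>

text \<open>Allowing the value \<open>\<infinity>\<close> makes the property pass through sums,
  multiples and integrals by integrating the inequalities; finiteness is restored afterwards from a
  bound.\<close>

definition mono_convex_ext :: "(nat \<Rightarrow> ennreal) \<Rightarrow> bool" where
  "mono_convex_ext f \<longleftrightarrow> (\<forall>q. f q \<le> f (q + 1) \<and> f (q + 1) + f (q + 1) \<le> f q + f (q + 2))"

lemma mono_convex_iff: "mono_convex f \<longleftrightarrow> mono_convex_ext f \<and> (\<forall>q. f q < \<infinity>)"
  by (auto simp: mono_convex_def mono_convex_ext_def)

lemma mono_convex_ext_add:
  assumes "mono_convex_ext f" "mono_convex_ext g"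
  shows "mono_convex_ext (\<lambda>q. f q + g q)"
  unfolding mono_convex_ext_def
proof (intro allI conjI)
  fix q
  show "f q + g q \<le> f (q + 1) + g (q + 1)"
    using assms unfolding mono_convex_ext_def by (intro add_mono) blast+
  have "(f (q + 1) + f (q + 1)) + (g (q + 1) + g (q + 1)) \<le> (f q + f (q + 2)) + (g q + g (q + 2))"
    using assms unfolding mono_convex_ext_def by (intro add_mono[of "_ + _" "_ + _" "_ + _" "_ + _"]) blast+
  then show "f (q + 1) + g (q + 1) + (f (q + 1) + g (q + 1)) \<le> f q + g q + (f (q + 2) + g (q + 2))"
    by (simp only: ac_simps)
qed

lemma mono_convex_ext_cmult:
  assumes "mono_convex_ext f"
  shows "mono_convex_ext (\<lambda>q. a * f q)"
  using assms unfolding mono_convex_ext_def distrib_left[symmetric] by (auto intro!: mult_left_mono)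

lemma mono_convex_ext_nn_integral:
  assumes meas: "\<And>q. (\<lambda>x. f x q) \<in> borel_measurable M" and "AE x in M. mono_convex_ext (f x)"
  shows "mono_convex_ext (\<lambda>q. \<integral>\<^sup>+x. f x q \<partial>M)"
  unfolding mono_convex_ext_def nn_integral_add[OF meas meas, symmetric]
proof (intro allI conjI nn_integral_mono_AE)
  fix q
  show "AE x in M. f x q \<le> f x (q + 1)" "AE x in M. f x (q + 1) + f x (q + 1) \<le> f x q + f x (q + 2)"
    using assms(2) by (eventually_elim, simp add: mono_convex_ext_def)+
qed

text \<open>Convexity survives the admission decision because \<open>f q + f (q + 3) \<ge> f (q + 1) + f (q + 2)\<close>
  covers the case of different decisions at \<open>q\<close> and \<open>q + 2\<close>.\<close>

lemma mono_convex_min: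
  assumes f: "mono_convex f" and "0 \<le> a" "0 \<le> b"
  shows "mono_convex (\<lambda>q. min (ennreal b + f (Suc q)) (ennreal a + f q))"
proof -
  obtain g where g: "f = (\<lambda>q. ennreal (g q))" "\<And>q. 0 \<le> g q" "\<And>q. g q \<le> g (q + 1)"
    "\<And>q. 2 * g (q + 1) \<le> g q + g (q + 2)"
    using mono_convexE[OF f] by metis
  have "min (ennreal b + f (Suc q)) (ennreal a + f q) = ennreal (min (b + g (Suc q)) (a + g q))" for q
    unfolding g(1) using g(2) assms
    by (simp add: ennreal_plus[symmetric] min_def del: ennreal_plus)
  moreover have "mono_convex (\<lambda>q. ennreal (min (b + g (Suc q)) (a + g q)))"
  proof (rule mono_convexI)
    fix q
    show "0 \<le> min (b + g (Suc q)) (a + g q)" using g(2) assms by simp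
    show "min (b + g (Suc q)) (a + g q) \<le> min (b + g (Suc (q + 1))) (a + g (q + 1))"
      using g(3)[of q] g(3)[of "Suc q"] by (simp add: min_le_iff_disj)
    show "2 * min (b + g (Suc (q + 1))) (a + g (q + 1)) \<le>
        min (b + g (Suc q)) (a + g q) + min (b + g (Suc (q + 2))) (a + g (q + 2))"
      using g(4)[of q] g(4)[of "Suc q"] unfolding min_def by (simp add: numeral_2_eq_2)
  qed
  ultimately show ?thesis by simp
qed

lemma min_add_SUP_ennreal:
  fixes f g :: "nat \<Rightarrow> ennreal"
  assumes "incseq f" "incseq g"
  shows "min (a + (SUP n. f n)) (b + (SUP n. g n)) = (SUP n. min (a + f n) (b + g n))"
proof (rule LIMSEQ_unique)
  show "(\<lambda>n. min (a + f n) (b + g n)) \<longlonglongrightarrow> min (a + (SUP n. f n)) (b + (SUP n. g n))"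
    using assms by (intro tendsto_min tendsto_add tendsto_const LIMSEQ_SUP)
  show "(\<lambda>n. min (a + f n) (b + g n)) \<longlonglongrightarrow> (SUP n. min (a + f n) (b + g n))"
    by (intro LIMSEQ_SUP monoI min.mono add_left_mono) (use assms in \<open>auto simp: incseq_def\<close>)
qed

lemma death_mean_mono: "(\<And>n. g n \<le> g' n) \<Longrightarrow> death_mean r m d g q \<le> death_mean r m d g' q"
  unfolding death_mean_def by (intro nn_integral_mono) simp

text \<open>Between arrivals the content cannot grow, so only the values of \<open>g\<close> up to
  \<open>q\<close> are ever met.\<close>

lemma death_mean_le:
  assumes "0 < r" and "\<And>n. n \<le> q \<Longrightarrow> g n \<le> B"
  shows "death_mean r m d g q \<le> B"
proof -
  interpret prob_space "exp_list r q" by (rule prob_space_exp_list[OF assms(1)])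
  have "death_mean r m d g q \<le> (\<integral>\<^sup>+w. B \<partial>exp_list r q)"
    unfolding death_mean_def
  proof (rule nn_integral_mono_AE, use AE_exp_list_length[OF assms(1), of q] in eventually_elim)
    fix w :: "real list" assume "length w = q"
    then show "g (length (serve m d w)) \<le> B" using length_serve_le[of m d w] by (intro assms(2)) simp
  qed
  then show ?thesis using emeasure_space_1 by simp
qed

lemma death_mean_SUP:
  assumes "\<And>q. incseq (\<lambda>n. B n q)"
  shows "death_mean r m d (\<lambda>q. SUP n. B n q) q = (SUP n. death_mean r m d (B n) q)"
  unfolding death_mean_def using assms
  by (intro nn_integral_monotone_convergence_SUP) (auto simp: incseq_def le_fun_def)

context hybrid_control
begin

text \<open>The default 0 outside \<open>{1..K}\<close> makes the cost measurable and bounded by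
  \<open>c_auto 1 K\<close> for every natural number \<open>j\<close>, so that the estimates on
  value iteration hold without restricting the regime.\<close>

definition auto_cost :: "real \<Rightarrow> nat \<Rightarrow> real" where
  "auto_cost s j = (if j \<in> {1..K} then c_auto s j else 0)"

lemma measurable_auto_cost_score [measurable]: "(\<lambda>s. auto_cost s j) \<in> borel_measurable score_law"
proof (cases "j \<in> {1..K}")
  case True
  then have "(\<lambda>s. c_auto s j) \<in> borel_measurable (restrict_space borel {0..1})"
    using c_auto_cont by (intro borel_measurable_continuous_on_restrict) blast
  then show ?thesis
    using True unfolding auto_cost_def measurable_cong_sets[OF sets_score_law refl] by simp
next
  case False
  then show ?thesis by (simp only: auto_cost_def if_False measurable_const space_borel UNIV_I)
qed

lemma auto_cost_bounds:
  assumes "s \<in> {0..1}"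
  shows "0 \<le> auto_cost s j" and "auto_cost s j \<le> c_auto 1 K"
proof -
  have K: "K \<in> {1..K}" using K_ge_1 by simp
  have nonneg: "0 \<le> c_auto 1 K" by (rule c_auto_nonneg[OF _ K]) simp
  show "0 \<le> auto_cost s j" using assms c_auto_nonneg by (auto simp: auto_cost_def)
  show "auto_cost s j \<le> c_auto 1 K"
  proof (cases "j \<in> {1..K}")
    case True
    have "c_auto s j \<le> c_auto 1 j"
      using strict_mono_on_leD[OF c_auto_strict_mono[OF True], of s 1] assms by simp
    also have "\<dots> \<le> c_auto 1 K"
      using c_auto_mono_regime[of 1] True K by (auto intro: mono_onD)
    finally show ?thesis using True by (simp add: auto_cost_def)
  qed (use nonneg in \<open>auto simp: auto_cost_def\<close>)
qed

lemma AE_regime_left: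
  assumes "i \<in> {1..K}"
  shows "AE r in regime_law. \<forall>x. regime_left i (fst r) (snd r) x \<in> {1..K}"
  using RL.AE_pair_snd[OF AE_jump_stream]
  by eventually_elim (use assms in \<open>auto simp only: intro!: regime_left_in\<close>)

lemma arrival_step_mono_AE:
  assumes "\<And>q j. P j \<Longrightarrow> B q j \<le> B' q j"
    and "AE r in regime_law. \<forall>x. P (regime_left i (fst r) (snd r) x)"
  shows "arrival_step B q i \<le> arrival_step B' q i"
  unfolding arrival_step_def
proof (rule nn_integral_mono, rule add_left_mono, rule mult_left_mono, rule nn_integral_mono_AE)
  fix x :: real
  show "AE r in regime_law. death_mean mu m x (\<lambda>q'. B q' (regime_left i (fst r) (snd r) x)) q
      \<le> death_mean mu m x (\<lambda>q'. B' q' (regime_left i (fst r) (snd r) x)) q"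
    using assms(2) by eventually_elim (auto intro!: death_mean_mono assms(1))
qed simp

lemma arrival_step_mono: "(\<And>q j. B q j \<le> B' q j) \<Longrightarrow> arrival_step B q i \<le> arrival_step B' q i"
  by (rule arrival_step_mono_AE[where P="\<lambda>_. True"]) auto

lemma arrival_step_mono_regimes:
  assumes "i \<in> {1..K}" "\<And>q j. j \<in> {1..K} \<Longrightarrow> B q j \<le> B' q j"
  shows "arrival_step B q i \<le> arrival_step B' q i"
  by (rule arrival_step_mono_AE[where P="\<lambda>j. j \<in> {1..K}"]) (use assms AE_regime_left in auto)

lemma measurable_arrival_regime [measurable]:
  "(\<lambda>x. \<integral>\<^sup>+r. death_mean mu m x (\<lambda>q'. B q' (regime_left i (fst r) (snd r) x)) q \<partial>regime_law) \<in> borel_measurable borel"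
proof -
  have [measurable]: "(\<lambda>y. death_mean mu m (fst y) (\<lambda>q'. B q' (regime_left i (fst (snd y)) (snd (snd y)) (fst y))) q)
     \<in> borel_measurable (borel \<Otimes>\<^sub>M regime_law)"
    by (rule measurable_death_mean_regime) measurable
  show ?thesis
    by (rule RL.borel_measurable_nn_integral) (simp add: case_prod_beta)
qed

lemma measurable_arrival_regime' [measurable]:
  "(\<lambda>r. death_mean mu m x (\<lambda>q'. B q' (regime_left i (fst r) (snd r) x)) q) \<in> borel_measurable regime_law"
  by (rule measurable_death_mean_regime) measurable

lemma arrival_step_SUP:
  assumes inc: "\<And>q j. incseq (\<lambda>n. B n q j)"
  shows "arrival_step (\<lambda>q j. SUP n. B n q j) q i = (SUP n. arrival_step (B n) q i)"
proof -
  let ?R = "\<lambda>n x. \<integral>\<^sup>+r. death_mean mu m x (\<lambda>q'. B n q' (regime_left i (fst r) (snd r) x)) q \<partial>regime_law"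
  have R: "(\<integral>\<^sup>+r. death_mean mu m x (\<lambda>q'. SUP n. B n q' (regime_left i (fst r) (snd r) x)) q \<partial>regime_law) = (SUP n. ?R n x)" for x
    unfolding death_mean_SUP[OF inc]
    by (rule nn_integral_monotone_convergence_SUP)
      (use inc in \<open>auto simp: incseq_def le_fun_def intro!: death_mean_mono\<close>)
  have incR: "incseq (\<lambda>n. ?R n x)" for x
    using inc by (auto simp: incseq_def intro!: nn_integral_mono death_mean_mono)
  have "arrival_step (\<lambda>q j. SUP n. B n q j) q i
      = (\<integral>\<^sup>+x. (SUP n. hold_mean x q + ennreal (exp (- alpha * x)) * ?R n x) \<partial>exp_law lam)"
    unfolding arrival_step_def R SUP_mult_left_ennreal by (simp add: ennreal_SUP_add_right)
  also have "\<dots> = (SUP n. arrival_step (B n) q i)"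
    unfolding arrival_step_def
    by (rule nn_integral_monotone_convergence_SUP)
      (use incR in \<open>auto simp: incseq_def le_fun_def intro!: add_left_mono mult_left_mono\<close>)
  finally show ?thesis .
qed

text \<open>The minimum stands inside the integral because the score is observed before the decision
  is taken.\<close>

definition min_cost :: "(nat \<Rightarrow> nat \<Rightarrow> ennreal) \<Rightarrow> nat \<Rightarrow> nat \<Rightarrow> ennreal" where
  "min_cost f q j = (\<integral>\<^sup>+s. min (ennreal c_h + f (Suc q) j) (ennreal (auto_cost s j) + f q j) \<partial>score_law)"

lemma min_cost_mono: "(\<And>q j. f q j \<le> f' q j) \<Longrightarrow> min_cost f q j \<le> min_cost f' q j"
  unfolding min_cost_def by (intro nn_integral_mono min.mono add_left_mono)

lemma min_cost_SUP:
  assumes inc: "\<And>q j. incseq (\<lambda>n. f n q j)"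
  shows "min_cost (\<lambda>q j. SUP n. f n q j) q j = (SUP n. min_cost (f n) q j)"
  unfolding min_cost_def min_add_SUP_ennreal[OF inc inc]
proof (rule nn_integral_monotone_convergence_SUP)
  show "incseq (\<lambda>n s. min (ennreal c_h + f n (Suc q) j) (ennreal (auto_cost s j) + f n q j))"
    by (intro monoI le_funI min.mono add_left_mono) (use inc in \<open>auto simp: incseq_def\<close>)
qed measurable

section \<open>Value iteration and optimality of its limit\<close>

primrec value_iter :: "nat \<Rightarrow> nat \<Rightarrow> nat \<Rightarrow> ennreal" where
  "value_iter 0 = (\<lambda>q i. 0)"
| "value_iter (Suc n) = arrival_step (min_cost (value_iter n))"

definition opt_cost :: "nat \<Rightarrow> nat \<Rightarrow> ennreal" where
  "opt_cost q i = (SUP n. value_iter n q i)"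

lemma incseq_value_iter: "incseq (\<lambda>n. value_iter n q i)"
proof (rule incseq_SucI)
  show "value_iter n q i \<le> value_iter (Suc n) q i" for n
  proof (induction n arbitrary: q i)
    case (Suc n)
    then show ?case unfolding value_iter.simps(2) by (intro arrival_step_mono min_cost_mono) simp
  qed simp
qed

text \<open>\<open>min_cost\<close> and \<open>arrival_step\<close> commute with suprema of
  increasing sequences, so applying them to the limit of the iterates gives the limit of the same
  sequence shifted by one.\<close>

lemma bellman_equation: "arrival_step (min_cost opt_cost) q i = opt_cost q i"
proof -
  have "incseq (\<lambda>n. min_cost (value_iter n) q j)" for q j
    using incseq_value_iter by (auto simp: incseq_def intro!: min_cost_mono)
  note arrival_step_SUP[OF this]
  moreover have "min_cost opt_cost = (\<lambda>q j. SUP n. min_cost (value_iter n) q j)"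
    unfolding opt_cost_def[abs_def] by (intro ext min_cost_SUP incseq_value_iter)
  ultimately have "arrival_step (min_cost opt_cost) q i = (SUP n. value_iter (Suc n) q i)"
    by (simp only: value_iter.simps)
  also have "\<dots> = opt_cost q i"
    unfolding opt_cost_def
    by (rule LIMSEQ_unique[OF LIMSEQ_SUP LIMSEQ_Suc[OF LIMSEQ_SUP]])
      (use incseq_value_iter[of q i] in \<open>auto simp: incseq_def simp del: value_iter.simps\<close>)
  finally show ?thesis .
qed

lemma min_cost_le_decision_cost: "min_cost f q j \<le> decision_cost u auto_cost f q j"
  unfolding min_cost_def decision_cost_def by (intro nn_integral_mono) auto

lemma decision_cost_mono:
  "(\<And>q. f q j \<le> f' q j) \<Longrightarrow> decision_cost u c f q j \<le> decision_cost u c f' q j"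
  unfolding decision_cost_def by (intro nn_integral_mono) (auto intro!: add_left_mono)

text \<open>Induction on the number of arrivals: the \<open>n\<close>-th iterate minimises at every
  arrival and hence stays below the cost up to the \<open>n\<close>-th arrival of any policy. Taking
  suprema on both sides gives the claim.\<close>

lemma opt_cost_le_J:
  assumes "u \<in> policies" and \<theta>: "\<theta> \<in> {1..K}"
  shows "opt_cost q \<theta> \<le> J u q \<theta>"
proof -
  \<comment> \<open>Membership in \<open>policies\<close> says nothing about \<open>j\<close>
    outside \<open>{1..K}\<close>; never escalating there makes the policy measurable at every
    \<open>j\<close> without changing its cost.\<close>
  define u' where "u' q j s \<longleftrightarrow> j \<in> {1..K} \<and> u q j s" for q j s
  have "Measurable.pred score_law (u' q j)" for q j
  proof (cases "j \<in> {1..K}")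
    case True
    then have "u' q j = u q j" unfolding u'_def by (intro ext) blast
    moreover have "u q j \<in> restrict_space borel {0..1} \<rightarrow>\<^sub>M count_space UNIV"
      using assms(1) True by (simp only: policies_def mem_Collect_eq)
    ultimately show ?thesis by (simp only: measurable_cong_sets[OF sets_score_law refl])
  next
    case False
    then have "u' q j = (\<lambda>_. False)" unfolding u'_def by (intro ext) blast
    then show ?thesis by simp
  qed
  then interpret M: measurable_policy lam mu alpha c_h m K Q f_S h c_auto u' auto_cost
    by unfold_locales (simp_all add: measurable_auto_cost_score)
  have "value_iter n q i \<le> M.expected_cost n q i" if "i \<in> {1..K}" for n q i
    using that
  proof (induction n arbitrary: q i)
    case (Suc n)
    have "min_cost (value_iter n) q j \<le> decision_cost u' auto_cost (M.expected_cost n) q j" if "j \<in> {1..K}" for q j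
      by (rule order_trans[OF min_cost_le_decision_cost], rule decision_cost_mono, rule Suc.IH[OF that])
    then show ?case
      unfolding value_iter.simps M.expected_cost_Suc[OF Suc.prems]
      by (intro arrival_step_mono_regimes Suc.prems)
  qed simp
  then have "opt_cost q \<theta> \<le> (SUP n. M.expected_cost n q \<theta>)"
    unfolding opt_cost_def using \<theta> by (intro SUP_mono) blast
  also have "\<dots> = J u q \<theta>"
    by (rule M.J_eq_SUP_expected_cost[OF \<theta>, symmetric]) (auto simp: u'_def auto_cost_def)
  finally show ?thesis .
qed

text \<open>Truncated costs carry no terminal term and start from 0, which lies below
  \<open>opt_cost\<close>. For the greedy policy the decision step applied to
  \<open>opt_cost\<close> equals the minimising one, so \<open>opt_cost\<close> is a fixed point and
  every further arrival keeps the truncated cost below it.\<close>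

lemma J_greedy_le_opt_cost:
  assumes \<theta>: "\<theta> \<in> {1..K}"
  shows "\<exists>u\<in>policies. J u q \<theta> \<le> opt_cost q \<theta>"
proof
  define u where "u q j s \<longleftrightarrow> ennreal c_h + opt_cost (Suc q) j \<le> ennreal (auto_cost s j) + opt_cost q j" for q j s
  have meas: "Measurable.pred score_law (u q j)" for q j
    unfolding u_def by measurable
  then interpret M: measurable_policy lam mu alpha c_h m K Q f_S h c_auto u auto_cost
    by unfold_locales (simp_all add: measurable_auto_cost_score)
  show "u \<in> policies"
    using meas unfolding policies_def measurable_cong_sets[OF sets_score_law refl] by auto
  have greedy: "decision_cost u auto_cost opt_cost = min_cost opt_cost"
    unfolding decision_cost_def min_cost_def u_def by (intro ext nn_integral_cong) (auto simp: min_def)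
  have "M.expected_cost n q i \<le> opt_cost q i" if "i \<in> {1..K}" for n q i
    using that
  proof (induction n arbitrary: q i)
    case 0
    then show ?case by (simp add: M.expected_cost_0)
  next
    case (Suc n)
    have "M.expected_cost (Suc n) q i \<le> arrival_step (decision_cost u auto_cost opt_cost) q i"
      unfolding M.expected_cost_Suc[OF Suc.prems]
      by (intro arrival_step_mono_regimes Suc.prems decision_cost_mono Suc.IH)
    also have "\<dots> = opt_cost q i"
      unfolding greedy by (rule bellman_equation)
    finally show ?case .
  qed
  then have "(SUP n. M.expected_cost n q \<theta>) \<le> opt_cost q \<theta>"
    using \<theta> by (intro SUP_least) blast
  moreover have "J u q \<theta> = (SUP n. M.expected_cost n q \<theta>)"
    by (rule M.J_eq_SUP_expected_cost[OF \<theta>]) (auto simp: auto_cost_def)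
  ultimately show "J u q \<theta> \<le> opt_cost q \<theta>" by simp
qed

lemma V_eq_opt_cost:
  assumes "\<theta> \<in> {1..K}"
  shows "V q \<theta> = enn2real (opt_cost q \<theta>)"
proof -
  obtain u where "u \<in> policies" "J u q \<theta> \<le> opt_cost q \<theta>"
    using J_greedy_le_opt_cost[OF assms] by blast
  then have "(INF u\<in>policies. J u q \<theta>) = opt_cost q \<theta>"
    using opt_cost_le_J[OF _ assms] by (intro antisym INF_greatest) (auto intro: INF_lower2)
  then show ?thesis by (simp add: V_def)
qed

text \<open>A bound for the cost of never escalating: the discounted integral of the constant rate
  \<open>h q\<close>, plus the expected discounted sum of the largest automation cost over a Poisson
  stream of rate \<open>lam\<close>.\<close>

definition cost_bound :: "nat \<Rightarrow> real" where
  "cost_bound q = h q / alpha + lam * c_auto 1 K / alpha"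

lemma c_auto_1_K_nonneg: "0 \<le> c_auto 1 K"
  using K_ge_1 by (intro c_auto_nonneg) auto

lemma hold_mean_le:
  assumes "0 \<le> x"
  shows "hold_mean x q \<le> ennreal (h q * (1 - exp (- alpha * x)) / alpha)"
proof -
  have "hold_mean x q \<le> (\<integral>\<^sup>+t. ennreal (exp (- alpha * t) * h q) * indicator {0..x} t \<partial>lborel)"
    unfolding hold_mean_def
  proof (rule nn_integral_mono)
    fix t :: real
    have "death_mean mu m t (\<lambda>n. ennreal (h n)) q \<le> ennreal (h q)"
      by (rule death_mean_le[OF mu_pos]) (intro ennreal_leI monoD[OF h_mono])
    then have "ennreal (exp (- alpha * t)) * death_mean mu m t (\<lambda>n. ennreal (h n)) q \<le> ennreal (exp (- alpha * t)) * ennreal (h q)"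
      by (rule mult_left_mono) simp
    also have "\<dots> = ennreal (exp (- alpha * t) * h q)"
      by (rule ennreal_mult'[symmetric]) simp
    finally show "(if 0 < t \<and> t \<le> x then ennreal (exp (- alpha * t)) * death_mean mu m t (\<lambda>n. ennreal (h n)) q else 0)
        \<le> ennreal (exp (- alpha * t) * h q) * indicator {0..x} t"
      by (simp split: split_indicator)
  qed
  also have "\<dots> = ennreal (- exp (- alpha * x) * h q / alpha - - exp (- alpha * 0) * h q / alpha)"
  proof (rule nn_integral_FTC_Icc)
    fix t :: real
    show "((\<lambda>t. - exp (- alpha * t) * h q / alpha) has_real_derivative exp (- alpha * t) * h q) (at t)"
      using alpha_pos by (auto intro!: derivative_eq_intros)
  qed (use assms h_nonneg in auto)
  also have "- exp (- alpha * x) * h q / alpha - - exp (- alpha * 0) * h q / alpha = h q * (1 - exp (- alpha * x)) / alpha"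
    using alpha_pos by (simp add: field_simps)
  finally show ?thesis .
qed

text \<open>Automation is one of the two options in the minimum, and under it the queue never
  exceeds \<open>q\<close>. The bound reproduces itself: the discount until the arrival has mean
  \<open>lam / (lam + alpha)\<close>, and the weights of \<open>h q\<close> before and after the
  arrival add up to \<open>1 / alpha\<close>.\<close>

lemma value_iter_le: "value_iter n q i \<le> ennreal (cost_bound q)"
proof (induction n arbitrary: q i)
  case (Suc n)
  let ?C = "c_auto 1 K"
  \<comment> \<open>\<open>?D\<close> equals \<open>?C + cost_bound q - h q / alpha\<close>, the
    share of the cost charged at the arrival that does not come from holding; multiplied by
    \<open>lam / (lam + alpha)\<close> it gives the second term of
    \<open>cost_bound\<close>.\<close>
  let ?D = "?C + lam * ?C / alpha"
  let ?R = "\<lambda>x. \<integral>\<^sup>+r. death_mean mu m x (\<lambda>q'. min_cost (value_iter n) q' (regime_left i (fst r) (snd r) x)) q \<partial>regime_law"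
  have C: "0 \<le> ?C" by (rule c_auto_1_K_nonneg)
  have D: "0 \<le> ?D" using C lam_pos alpha_pos by simp
  have bound_nonneg: "0 \<le> cost_bound q" for q
    unfolding cost_bound_def using C lam_pos alpha_pos h_nonneg by simp
  have min: "min_cost (value_iter n) q' j \<le> ennreal (?C + cost_bound q)" if "q' \<le> q" for q' q j
  proof -
    have le: "cost_bound q' \<le> cost_bound q"
      unfolding cost_bound_def using monoD[OF h_mono that] alpha_pos by (simp add: divide_right_mono)
    have "min_cost (value_iter n) q' j \<le> (\<integral>\<^sup>+s. ennreal (?C + cost_bound q) \<partial>score_law)"
      unfolding min_cost_def
    proof (rule nn_integral_mono)
      fix s assume "s \<in> space score_law"
      then have s: "s \<in> {0..1}" by simp
      have "min (ennreal c_h + value_iter n (Suc q') j) (ennreal (auto_cost s j) + value_iter n q' j)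
          \<le> ennreal (auto_cost s j) + value_iter n q' j" by simp
      also have "\<dots> \<le> ennreal ?C + ennreal (cost_bound q)"
        using auto_cost_bounds[OF s] Suc.IH[of q' j] le
        by (intro add_mono ennreal_leI) (auto intro: order_trans ennreal_leI)
      also have "\<dots> = ennreal (?C + cost_bound q)" using C bound_nonneg by (rule ennreal_plus[symmetric])
      finally show "min (ennreal c_h + value_iter n (Suc q') j) (ennreal (auto_cost s j) + value_iter n q' j) \<le> ennreal (?C + cost_bound q)" .
    qed
    then show ?thesis using SL.emeasure_space_1 by simp
  qed
  have "value_iter (Suc n) q i \<le> (\<integral>\<^sup>+x. ennreal (h q / alpha) + ennreal ?D * ennreal (exp (- alpha * x)) \<partial>exp_law lam)"
    unfolding value_iter.simps(2) arrival_step_def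
  proof (rule nn_integral_mono_AE, rule eventually_mono[OF AE_exp_law_nonneg])
    fix x :: real assume x: "0 \<le> x"
    have "?R x \<le> (\<integral>\<^sup>+r. ennreal (?C + cost_bound q) \<partial>regime_law)"
      by (intro nn_integral_mono death_mean_le[OF mu_pos] min)
    also have "\<dots> = ennreal (?C + cost_bound q)" using RL.emeasure_space_1 by simp
    finally have "hold_mean x q + ennreal (exp (- alpha * x)) *
        ?R x
      \<le> ennreal (h q * (1 - exp (- alpha * x)) / alpha) + ennreal (exp (- alpha * x)) * ennreal (?C + cost_bound q)"
      by (intro add_mono hold_mean_le x mult_left_mono) auto
    also have "\<dots> = ennreal (h q * (1 - exp (- alpha * x)) / alpha + exp (- alpha * x) * (?C + cost_bound q))"
      using x alpha_pos C bound_nonneg[of q] h_nonneg[of q] by (simp add: ennreal_mult'[symmetric] ennreal_plus[symmetric] del: ennreal_plus)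
    also have "h q * (1 - exp (- alpha * x)) / alpha + exp (- alpha * x) * (?C + cost_bound q) = h q / alpha + ?D * exp (- alpha * x)"
      using alpha_pos unfolding cost_bound_def by (simp add: field_simps)
    also have "ennreal \<dots> = ennreal (h q / alpha) + ennreal ?D * ennreal (exp (- alpha * x))"
      using alpha_pos D h_nonneg[of q] by (simp add: ennreal_mult'[symmetric] ennreal_plus[symmetric] del: ennreal_plus)
    finally show "hold_mean x q + ennreal (exp (- alpha * x)) *
        ?R x
      \<le> ennreal (h q / alpha) + ennreal ?D * ennreal (exp (- alpha * x))" .
  qed
  also have "\<dots> = ennreal (h q / alpha) + ennreal ?D * (\<integral>\<^sup>+x. ennreal (exp (- alpha * x)) \<partial>exp_law lam)"
    by (rule XL.nn_integral_affine) measurable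
  also have "\<dots> = ennreal (h q / alpha) + ennreal ?D * ennreal (lam / (lam + alpha))"
    using lam_pos alpha_pos by (subst nn_integral_exp_law_exp) auto
  also have "\<dots> = ennreal (h q / alpha + ?D * (lam / (lam + alpha)))"
    using lam_pos alpha_pos D h_nonneg[of q] by (simp add: ennreal_mult'[symmetric] ennreal_plus[symmetric] del: ennreal_plus)
  also have "?D * (lam / (lam + alpha)) = lam * ?C / alpha"
  proof -
    have "?D = ?C * (lam + alpha) / alpha" using alpha_pos by (simp add: field_simps)
    then show ?thesis using lam_pos alpha_pos by simp
  qed
  finally show ?case unfolding cost_bound_def .
qed simp

section \<open>Convexity of the value function and monotone thresholds\<close>

lemma mono_convex_h: "mono_convex (\<lambda>n. ennreal (h n))"
proof (rule mono_convexI)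
  show "2 * h (q + 1) \<le> h q + h (q + 2)" for q using h_convex[of q] by simp
qed (use h_nonneg monoD[OF h_mono] in auto)

text \<open>For a fixed score, a fixed time and a fixed regime path the inequalities hold as
  statements about functions of \<open>q\<close>, and integration transports them. The service step
  passes through real sequences and therefore needs finite values, which the bound on
  \<open>value_iter\<close> supplies at every stage.\<close>

lemma mono_convex_value_iter: "mono_convex (\<lambda>q. value_iter n q i)"
proof (induction n arbitrary: i)
  case 0
  show ?case by (simp add: mono_convex_def)
next
  case (Suc n)
  have finite: "value_iter n q i < \<infinity>" for n q i
    using value_iter_le[of n q i] by (simp add: le_less_trans)
  have min: "mono_convex (\<lambda>q. min_cost (value_iter n) q j)" for j
    unfolding mono_convex_iff
  proof (intro conjI allI)
    show "mono_convex_ext (\<lambda>q. min_cost (value_iter n) q j)"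
      unfolding min_cost_def
    proof (rule mono_convex_ext_nn_integral)
      show "AE s in score_law. mono_convex_ext (\<lambda>q. min (ennreal c_h + value_iter n (Suc q) j) (ennreal (auto_cost s j) + value_iter n q j))"
      proof (rule AE_I2)
        fix s assume "s \<in> space score_law"
        then have "0 \<le> auto_cost s j" using auto_cost_bounds by simp
        from mono_convex_min[OF Suc.IH this, of c_h j] c_h_pos
        show "mono_convex_ext (\<lambda>q. min (ennreal c_h + value_iter n (Suc q) j) (ennreal (auto_cost s j) + value_iter n q j))"
          by (simp add: mono_convex_iff)
      qed
    qed measurable
    fix q
    have "min_cost (value_iter n) q j \<le> (\<integral>\<^sup>+s. ennreal c_h + value_iter n (Suc q) j \<partial>score_law)"
      unfolding min_cost_def by (intro nn_integral_mono) simp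
    also have "\<dots> = ennreal c_h + value_iter n (Suc q) j" using SL.emeasure_space_1 by simp
    also have "\<dots> < \<infinity>" using finite by simp
    finally show "min_cost (value_iter n) q j < \<infinity>" .
  qed
  have hold: "mono_convex_ext (hold_mean x)" for x
    unfolding hold_mean_def
  proof (rule mono_convex_ext_nn_integral)
    show "AE t in lborel. mono_convex_ext (\<lambda>q. if 0 < t \<and> t \<le> x then ennreal (exp (- alpha * t)) * death_mean mu m t (\<lambda>n. ennreal (h n)) q else 0)"
    proof (rule AE_I2)
      fix t :: real
      have "mono_convex_ext (\<lambda>q. ennreal (exp (- alpha * t)) * death_mean mu m t (\<lambda>n. ennreal (h n)) q)" if "0 < t"
        using mono_convex_death_mean[OF mu_pos m_ge_1 mono_convex_h, of t] that
        by (intro mono_convex_ext_cmult) (simp add: mono_convex_iff)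
      then have if_b: "mono_convex_ext (\<lambda>q. if b then ennreal (exp (- alpha * t)) * death_mean mu m t (\<lambda>n. ennreal (h n)) q else 0)"
        if "b \<Longrightarrow> 0 < t" for b
        using that by (cases b) (simp_all, simp add: mono_convex_ext_def)
      show "mono_convex_ext (\<lambda>q. if 0 < t \<and> t \<le> x then ennreal (exp (- alpha * t)) * death_mean mu m t (\<lambda>n. ennreal (h n)) q else 0)"
        by (rule if_b) simp
    qed
  qed measurable
  let ?R = "\<lambda>x q. \<integral>\<^sup>+r. death_mean mu m x (\<lambda>q'. min_cost (value_iter n) q' (regime_left i (fst r) (snd r) x)) q \<partial>regime_law"
  have "mono_convex_ext (\<lambda>q. value_iter (Suc n) q i)"
    unfolding value_iter.simps(2) arrival_step_def
  proof (rule mono_convex_ext_nn_integral)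
    show "AE x in exp_law lam. mono_convex_ext (\<lambda>q. hold_mean x q + ennreal (exp (- alpha * x)) *
       ?R x q)"
    proof (rule eventually_mono[OF AE_exp_law_nonneg])
      fix x :: real assume x: "0 \<le> x"
      have "mono_convex_ext (death_mean mu m x (\<lambda>q'. min_cost (value_iter n) q' j))" for j
        using mono_convex_death_mean[OF mu_pos m_ge_1 min x] by (simp add: mono_convex_iff)
      then show "mono_convex_ext (\<lambda>q. hold_mean x q + ennreal (exp (- alpha * x)) *
         ?R x q)"
        by (intro mono_convex_ext_add hold mono_convex_ext_cmult mono_convex_ext_nn_integral measurable_arrival_regime') simp
    qed
  qed measurable
  then show ?case using finite unfolding mono_convex_iff by blast
qed

lemma opt_cost_finite: "opt_cost q i < \<infinity>"
proof -
  have "opt_cost q i \<le> ennreal (cost_bound q)"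
    unfolding opt_cost_def by (intro SUP_least value_iter_le)
  then show ?thesis by (simp add: le_less_trans)
qed

lemma opt_cost_convex: "opt_cost (q + 1) i + opt_cost (q + 1) i \<le> opt_cost q i + opt_cost (q + 2) i"
proof (rule LIMSEQ_le)
  have lim: "(\<lambda>n. value_iter n q i) \<longlonglongrightarrow> opt_cost q i" for q
    unfolding opt_cost_def by (rule LIMSEQ_SUP[OF incseq_value_iter])
  show "(\<lambda>n. value_iter n (q + 1) i + value_iter n (q + 1) i) \<longlonglongrightarrow> opt_cost (q + 1) i + opt_cost (q + 1) i"
    "(\<lambda>n. value_iter n q i + value_iter n (q + 2) i) \<longlonglongrightarrow> opt_cost q i + opt_cost (q + 2) i"
    by (intro tendsto_add lim)+
  show "\<exists>N. \<forall>n\<ge>N. value_iter n (q + 1) i + value_iter n (q + 1) i \<le> value_iter n q i + value_iter n (q + 2) i"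
    using mono_convex_value_iter by (auto simp: mono_convex_def)
qed

lemma V_convex:
  assumes "\<theta> \<in> {1..K}"
  shows "V (q + 1) \<theta> - V q \<theta> \<le> V (q + 2) \<theta> - V (q + 1) \<theta>"
proof -
  have "opt_cost q \<theta> = ennreal (V q \<theta>)" for q
    using opt_cost_finite[of q \<theta>] by (simp add: V_eq_opt_cost[OF assms])
  moreover have V: "0 \<le> V q \<theta>" for q by (simp add: V_def)
  ultimately have "V (q + 1) \<theta> + V (q + 1) \<theta> \<le> V q \<theta> + V (q + 2) \<theta>"
    using opt_cost_convex[of q \<theta>] by (simp add: ennreal_plus[symmetric] del: ennreal_plus)
  then show ?thesis by simp
qed

text \<open>A larger queue raises the marginal cost of one more task, so fewer scores qualify for
  escalation and the infimum over the smaller set is larger. An empty set has infimum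
  \<open>\<infinity>\<close> in \<open>ereal\<close>, which is the convention of the model.\<close>

lemma threshold_mono:
  assumes \<theta>: "\<theta> \<in> {1..K}" and "q1 \<le> q2"
  shows "threshold q1 \<theta> \<le> threshold q2 \<theta>"
proof -
  have "V (q1 + 1) \<theta> - V q1 \<theta> \<le> V (q2 + 1) \<theta> - V q2 \<theta>"
    by (rule lift_Suc_mono_le[where f="\<lambda>q. V (q + 1) \<theta> - V q \<theta>", OF _ \<open>q1 \<le> q2\<close>])
      (use V_convex[OF \<theta>] in simp)
  then show ?thesis
    unfolding threshold_def by (intro Inf_superset_mono image_mono) auto
qed

end

theorem theorem2:
  fixes lam mu alpha c_h :: real
    and m K :: nat
    and Q :: "nat \<Rightarrow> nat \<Rightarrow> real"
    and f_S :: "real \<Rightarrow> real"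
    and h :: "nat \<Rightarrow> real"
    and c_auto :: "real \<Rightarrow> nat \<Rightarrow> real"
    and \<theta> q1 q2 :: nat
  assumes "hybrid_control lam mu alpha c_h m K Q f_S h c_auto"
    and "\<theta> \<in> {1..K}"
    and "q1 < q2"
  shows "hybrid_control.threshold lam mu alpha c_h m K Q f_S h c_auto q1 \<theta>
       \<le> hybrid_control.threshold lam mu alpha c_h m K Q f_S h c_auto q2 \<theta>"
  using hybrid_control.threshold_mono[OF assms(1,2)] assms(3) by simp

end
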